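(* Let $A=-\mathcal{A}$ be the opposite of a Sturm-Liouville operator on $X=L^2_\rho(a,b)$, with eigenvalues $\{\lambda_n\}_{n\in\mathbb{N}}$, and let $\mu=\gamma+\epsilon$ with $\epsilon>0$ and $\lambda_n<\gamma<\infty$ for all $n$. Then, for any $\alpha>0$, the $C_0$-semigroup $(T(t))_{t\geq0}$ generated by $A$ (with domain $D(A)_\alpha$) on the space $X_\alpha=D((\mu I-A)^\alpha)$ is compact, i.e. $T(t)$ is a compact operator for all $t>0$.
   Context: Let $a<b$ be real. Let $p,\frac{dp}{dz},q,\rho$ be real-valued continuous functions on $[a,b]$ with $\rho>0$ and $p>0$. $X=L^2_\rho(a,b)$ denotes the space $L^2(a,b)$ of real-valued square integrable functions equipped with the inner product $\langle f,g\rangle_\rho=\int_a^b f(z)g(z)\rho(z)\,dz$. The Sturm-Liouville operator is $(\mathcal{A}f)(z)=\frac{1}{\rho(z)}\left(\frac{d}{dz}\left(-p(z)\frac{df}{dz}(z)\right)+q(z)f(z)\right)$ with domain $D(\mathcal{A})=\{f\in H^2(a,b):\ \alpha_a\frac{df}{dz}(a)+\beta_a f(a)=0=\alpha_b\frac{df}{dz}(b)+\beta_b f(b)\}$, where $(\alpha_a,\beta_a)\neq(0,0)\neq(\alpha_b,\beta_b)$ are real pairs. Put $A=-\mathcal{A}$, $D(A)=D(\mathcal{A})$. Known facts: $A$ is self-adjoint on $X$; its spectrum consists only of simple real eigenvalues $\{\lambda_n\}_{n\in\mathbb{N}}$, bounded from above; the normalized eigenfunctions $\{\phi_n\}_{n\in\mathbb{N}}$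 form an orthonormal basis of $X$; and $Af=\sum_{n=1}^\infty\lambda_n\langle f,\phi_n\rangle_\rho\phi_n$ for $f\in D(A)=\{f\in X:\ \sum_{n=1}^\infty\lambda_n^2\langle f,\phi_n\rangle_\rho^2<\infty\}$. For $\mu$ as in the claim and $\alpha>0$, $(\mu I-A)^\alpha f=\sum_{n=1}^\infty(\mu-\lambda_n)^\alpha\langle f,\phi_n\rangle_\rho\phi_n$ with domain $X_\alpha:=D((\mu I-A)^\alpha)=\{f\in X:\ \sum_{n=1}^\infty(\mu-\lambda_n)^{2\alpha}\langle f,\phi_n\rangle_\rho^2<\infty\}$, which is a real Hilbert space for the inner product $\langle f,g\rangle_\alpha=\langle(\mu I-A)^\alpha f,(\mu I-A)^\alpha g\rangle_\rho$. Put $\phi_{n,\alpha}=(\mu-\lambda_n)^{-\alpha}\phi_n$ and $D(A)_\alpha=\{f\in X_\alpha:\ \sum_{n=1}^\infty\lambda_n^2\langle f,\phi_{n,\alpha}\rangle_\alpha^2<\infty\}\subset D(A)$. The operator $A$ with domain $D(A)_\alpha$ is the infinitesimal generator of a $C_0$-semigroup $(T(t))_{t\ge0}$ on $X_\alpha$. *)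

theory Defs
  imports "HOL-Analysis.Analysis"
begin

text \<open>
  Lebesgue measurable functions on the real line modulo equality almost everywhere.  The elements
  of \<open>L\<^sup>2(a,b)\<close> are represented by the classes that vanish outside \<open>(a,b)\<close> (extension by zero), so
  that the spaces for all \<open>a\<close>, \<open>b\<close> are subspaces of one real vector space.
\<close>

definition ae_eq :: "(real \<Rightarrow> real) \<Rightarrow> (real \<Rightarrow> real) \<Rightarrow> bool" where
  "ae_eq f g \<longleftrightarrow> f \<in> borel_measurable lebesgue \<and> g \<in> borel_measurable lebesgue \<and>
     (AE x in lebesgue. f x = g x)"

quotient_type ae_fun = "real \<Rightarrow> real" / partial: ae_eq
proof (rule part_equivpI)
  show "\<exists>x. ae_eq x x"
    by (rule exI[of _ "\<lambda>_. 0"]) (simp add: ae_eq_def)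
  show "symp ae_eq"
    by (rule sympI) (auto simp: ae_eq_def eq_commute)
  show "transp ae_eq"
  proof (rule transpI)
    fix f g h assume "ae_eq f g" "ae_eq g h"
    then show "ae_eq f h"
      unfolding ae_eq_def by (auto elim: eventually_elim2)
  qed
qed

instantiation ae_fun :: real_vector
begin

lift_definition zero_ae_fun :: ae_fun is "\<lambda>_. 0"
  by (simp add: ae_eq_def)

lift_definition plus_ae_fun :: "ae_fun \<Rightarrow> ae_fun \<Rightarrow> ae_fun" is "\<lambda>f g x. f x + g x"
  unfolding ae_eq_def by (auto elim: eventually_elim2)

lift_definition minus_ae_fun :: "ae_fun \<Rightarrow> ae_fun \<Rightarrow> ae_fun" is "\<lambda>f g x. f x - g x"
  unfolding ae_eq_def by (auto elim: eventually_elim2)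

lift_definition uminus_ae_fun :: "ae_fun \<Rightarrow> ae_fun" is "\<lambda>f x. - f x"
  unfolding ae_eq_def by (auto elim: eventually_mono)

lift_definition scaleR_ae_fun :: "real \<Rightarrow> ae_fun \<Rightarrow> ae_fun" is "\<lambda>c f x. c * f x"
  unfolding ae_eq_def by (auto elim: eventually_mono)

instance
  by (standard; transfer) (auto simp: ae_eq_def algebra_simps)

end

text \<open>The class of the function that is \<open>u\<close> on \<open>[a,b]\<close> and \<open>0\<close> elsewhere; only meaningful if that
  function is measurable.\<close>

definition class_on :: "real \<Rightarrow> real \<Rightarrow> (real \<Rightarrow> real) \<Rightarrow> ae_fun" where
  "class_on a b u = abs_ae_fun (\<lambda>z. if z \<in> {a..b} then u z else 0)"

definition mult_on :: "real \<Rightarrow> real \<Rightarrow> (real \<Rightarrow> real) \<Rightarrow> ae_fun \<Rightarrow> ae_fun" where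
  "mult_on a b h f = class_on a b (\<lambda>z. h z * rep_ae_fun f z)"

definition L2 :: "real \<Rightarrow> real \<Rightarrow> ae_fun set" where
  "L2 a b = {f. integrable lebesgue (\<lambda>z. (rep_ae_fun f z)\<^sup>2) \<and>
     (AE z in lebesgue. z \<notin> {a<..<b} \<longrightarrow> rep_ae_fun f z = 0)}"

definition inner_weight :: "real \<Rightarrow> real \<Rightarrow> (real \<Rightarrow> real) \<Rightarrow> ae_fun \<Rightarrow> ae_fun \<Rightarrow> real" where
  "inner_weight a b rho f g =
     (LINT z:{a..b}|lebesgue. rep_ae_fun f z * rep_ae_fun g z * rho z)"


subsection \<open>Sobolev spaces on an interval and the Sturm-Liouville operator\<close>

definition test_function :: "real \<Rightarrow> real \<Rightarrow> (real \<Rightarrow> real) \<Rightarrow> bool" where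
  "test_function a b v \<longleftrightarrow> v C1_differentiable_on UNIV \<and>
     compact (closure {z. v z \<noteq> 0}) \<and> closure {z. v z \<noteq> 0} \<subseteq> {a<..<b}"

definition has_weak_deriv :: "real \<Rightarrow> real \<Rightarrow> ae_fun \<Rightarrow> ae_fun \<Rightarrow> bool" where
  "has_weak_deriv a b f g \<longleftrightarrow> (\<forall>v. test_function a b v \<longrightarrow>
     (LINT z:{a..b}|lebesgue. rep_ae_fun f z * deriv v z) =
     - (LINT z:{a..b}|lebesgue. rep_ae_fun g z * v z))"

definition H1 :: "real \<Rightarrow> real \<Rightarrow> ae_fun set" where
  "H1 a b = {f \<in> L2 a b. \<exists>g \<in> L2 a b. has_weak_deriv a b f g}"

definition weak_deriv :: "real \<Rightarrow> real \<Rightarrow> ae_fun \<Rightarrow> ae_fun" where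
  "weak_deriv a b f = (THE g. g \<in> L2 a b \<and> has_weak_deriv a b f g)"

definition H2 :: "real \<Rightarrow> real \<Rightarrow> ae_fun set" where
  "H2 a b = {f \<in> H1 a b. weak_deriv a b f \<in> H1 a b}"

text \<open>The point values \<open>f(a)\<close>, \<open>f'(a)\<close>, \<open>f(b)\<close>, \<open>f'(b)\<close> of \<open>f \<in> H\<^sup>2(a,b)\<close> are those of its continuously
  differentiable representative on \<open>[a,b]\<close>.  A boundary condition is given by its coefficient pair
  \<open>(\<alpha>,\<beta>)\<close>.\<close>

definition sturm_liouville_domain ::
  "real \<Rightarrow> real \<Rightarrow> real \<times> real \<Rightarrow> real \<times> real \<Rightarrow> ae_fun set" where
  "sturm_liouville_domain a b bc_a bc_b = {f \<in> H2 a b. \<exists>u u'.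
     f = class_on a b u \<and>
     (\<forall>z\<in>{a..b}. (u has_real_derivative u' z) (at z within {a..b})) \<and>
     continuous_on {a..b} u' \<and>
     fst bc_a * u' a + snd bc_a * u a = 0 \<and>
     fst bc_b * u' b + snd bc_b * u b = 0}"

definition sturm_liouville ::
  "real \<Rightarrow> real \<Rightarrow> (real \<Rightarrow> real) \<Rightarrow> (real \<Rightarrow> real) \<Rightarrow> (real \<Rightarrow> real) \<Rightarrow> ae_fun \<Rightarrow> ae_fun" where
  "sturm_liouville a b p q rho f =
     mult_on a b (\<lambda>z. 1 / rho z)
       (weak_deriv a b (mult_on a b (\<lambda>z. - p z) (weak_deriv a b f)) + mult_on a b q f)"


subsection \<open>Linear operators on a subspace \<open>V\<close> of a real vector space with norm \<open>N\<close>\<close>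

definition eigenvalues :: "'v::real_vector set \<Rightarrow> ('v \<Rightarrow> 'v) \<Rightarrow> real set" where
  "eigenvalues D A = {l. \<exists>f\<in>D. f \<noteq> 0 \<and> A f = l *\<^sub>R f}"

definition norm_of :: "('v \<Rightarrow> 'v \<Rightarrow> real) \<Rightarrow> 'v \<Rightarrow> real" where
  "norm_of ip f = sqrt (ip f f)"

definition bounded_operator_on ::
  "'v::real_vector set \<Rightarrow> ('v \<Rightarrow> real) \<Rightarrow> ('v \<Rightarrow> 'v) \<Rightarrow> bool" where
  "bounded_operator_on V N S \<longleftrightarrow>
     (\<forall>f\<in>V. S f \<in> V) \<and>
     (\<forall>f\<in>V. \<forall>g\<in>V. S (f + g) = S f + S g) \<and>
     (\<forall>f\<in>V. \<forall>c. S (c *\<^sub>R f) = c *\<^sub>R S f) \<and>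
     (\<exists>M. \<forall>f\<in>V. N (S f) \<le> M * N f)"

definition norm_topology :: "'v::real_vector set \<Rightarrow> ('v \<Rightarrow> real) \<Rightarrow> 'v topology" where
  "norm_topology V N =
     topology (\<lambda>U. U \<subseteq> V \<and> (\<forall>f\<in>U. \<exists>r>0. \<forall>g\<in>V. N (g - f) < r \<longrightarrow> g \<in> U))"

lemma openin_norm_topology:
  "openin (norm_topology V N) U \<longleftrightarrow>
     U \<subseteq> V \<and> (\<forall>f\<in>U. \<exists>r>0. \<forall>g\<in>V. N (g - f) < r \<longrightarrow> g \<in> U)"
proof -
  let ?P = "\<lambda>U. U \<subseteq> V \<and> (\<forall>f\<in>U. \<exists>r>0. \<forall>g\<in>V. N (g - f) < r \<longrightarrow> g \<in> U)"
  have "?P (S \<inter> U)" if S: "?P S" and U: "?P U" for S U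
  proof (intro conjI ballI)
    show "S \<inter> U \<subseteq> V" using S by blast
    fix f assume f: "f \<in> S \<inter> U"
    obtain r where r: "r > 0" "\<forall>g\<in>V. N (g - f) < r \<longrightarrow> g \<in> S" using S f by blast
    obtain s where s: "s > 0" "\<forall>g\<in>V. N (g - f) < s \<longrightarrow> g \<in> U" using U f by blast
    show "\<exists>r>0. \<forall>g\<in>V. N (g - f) < r \<longrightarrow> g \<in> S \<inter> U"
      using r s by (intro exI[of _ "min r s"]) auto
  qed
  moreover have "?P (\<Union> \<K>)" if K: "\<forall>U\<in>\<K>. ?P U" for \<K>
  proof (intro conjI ballI)
    show "\<Union> \<K> \<subseteq> V" using K by blast
    fix f assume "f \<in> \<Union> \<K>"
    then obtain U where "U \<in> \<K>" "f \<in> U" by blast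
    then obtain r where "r > 0" "\<forall>g\<in>V. N (g - f) < r \<longrightarrow> g \<in> U" using K by blast
    then show "\<exists>r>0. \<forall>g\<in>V. N (g - f) < r \<longrightarrow> g \<in> \<Union> \<K>"
      using \<open>U \<in> \<K>\<close> by blast
  qed
  ultimately have "istopology ?P"
    unfolding istopology_def by blast
  then show ?thesis
    by (simp add: norm_topology_def)
qed

definition compact_operator_on ::
  "'v::real_vector set \<Rightarrow> ('v \<Rightarrow> real) \<Rightarrow> ('v \<Rightarrow> 'v) \<Rightarrow> bool" where
  "compact_operator_on V N S \<longleftrightarrow> bounded_operator_on V N S \<and>
     (\<forall>B\<subseteq>V. (\<exists>M. \<forall>f\<in>B. N f \<le> M) \<longrightarrow>
       compactin (norm_topology V N) (norm_topology V N closure_of (S ` B)))"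

definition C0_semigroup_on ::
  "'v::real_vector set \<Rightarrow> ('v \<Rightarrow> real) \<Rightarrow> (real \<Rightarrow> 'v \<Rightarrow> 'v) \<Rightarrow> bool" where
  "C0_semigroup_on V N T \<longleftrightarrow>
     (\<forall>t\<ge>0. bounded_operator_on V N (T t)) \<and>
     (\<forall>f\<in>V. T 0 f = f) \<and>
     (\<forall>s\<ge>0. \<forall>t\<ge>0. \<forall>f\<in>V. T (s + t) f = T s (T t f)) \<and>
     (\<forall>f\<in>V. ((\<lambda>t. N (T t f - f)) \<longlongrightarrow> 0) (at_right 0))"

definition infinitesimal_generator_on ::
  "'v::real_vector set \<Rightarrow> ('v \<Rightarrow> real) \<Rightarrow> (real \<Rightarrow> 'v \<Rightarrow> 'v) \<Rightarrow> 'v set \<Rightarrow> ('v \<Rightarrow> 'v) \<Rightarrow> bool" where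
  "infinitesimal_generator_on V N T D A \<longleftrightarrow>
     D = {f \<in> V. \<exists>g\<in>V. ((\<lambda>t. N ((1 / t) *\<^sub>R (T t f - f) - g)) \<longlongrightarrow> 0) (at_right 0)} \<and>
     (\<forall>f\<in>D. A f \<in> V \<and> ((\<lambda>t. N ((1 / t) *\<^sub>R (T t f - f) - A f)) \<longlongrightarrow> 0) (at_right 0))"


subsection \<open>Fractional powers of \<open>\<mu>I - A\<close> in terms of the eigenpairs \<open>(\<lambda>\<^sub>n, \<phi>\<^sub>n)\<close> of \<open>A\<close>\<close>

definition frac_domain :: "'v::real_vector set \<Rightarrow> ('v \<Rightarrow> 'v \<Rightarrow> real) \<Rightarrow>
    (nat \<Rightarrow> real) \<Rightarrow> (nat \<Rightarrow> 'v) \<Rightarrow> real \<Rightarrow> real \<Rightarrow> 'v set" where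
  "frac_domain X ip lam phi mu alpha =
     {f \<in> X. summable (\<lambda>n. (mu - lam n) powr (2 * alpha) * (ip f (phi n))\<^sup>2)}"

definition frac_power :: "'v::real_vector set \<Rightarrow> ('v \<Rightarrow> 'v \<Rightarrow> real) \<Rightarrow>
    (nat \<Rightarrow> real) \<Rightarrow> (nat \<Rightarrow> 'v) \<Rightarrow> real \<Rightarrow> real \<Rightarrow> 'v \<Rightarrow> 'v" where
  "frac_power X ip lam phi mu alpha f =
     (THE g. g \<in> X \<and>
       (\<lambda>k. norm_of ip ((\<Sum>n<k. ((mu - lam n) powr alpha * ip f (phi n)) *\<^sub>R phi n) - g))
         \<longlonglongrightarrow> 0)"

definition frac_inner :: "'v::real_vector set \<Rightarrow> ('v \<Rightarrow> 'v \<Rightarrow> real) \<Rightarrow>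
    (nat \<Rightarrow> real) \<Rightarrow> (nat \<Rightarrow> 'v) \<Rightarrow> real \<Rightarrow> real \<Rightarrow> 'v \<Rightarrow> 'v \<Rightarrow> real" where
  "frac_inner X ip lam phi mu alpha f g =
     ip (frac_power X ip lam phi mu alpha f) (frac_power X ip lam phi mu alpha g)"

definition frac_generator_domain :: "'v::real_vector set \<Rightarrow> ('v \<Rightarrow> 'v \<Rightarrow> real) \<Rightarrow>
    (nat \<Rightarrow> real) \<Rightarrow> (nat \<Rightarrow> 'v) \<Rightarrow> real \<Rightarrow> real \<Rightarrow> 'v set" where
  "frac_generator_domain X ip lam phi mu alpha =
     {f \<in> frac_domain X ip lam phi mu alpha.
       summable (\<lambda>n. (lam n)\<^sup>2 *
         (frac_inner X ip lam phi mu alpha f ((mu - lam n) powr (- alpha) *\<^sub>R phi n))\<^sup>2)}"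

end

theory Submission
  imports Defs
begin

text \<open>
  The norm of \<open>X\<^sub>\<alpha>\<close> is the \<open>\<ell>\<^sup>2\<close> norm of the coefficients \<open>(\<mu> - \<lambda>\<^sub>n)\<^sup>\<alpha> \<langle>f, \<phi>\<^sub>n\<rangle>\<close>, and every \<open>\<ell>\<^sup>2\<close> sequence
  occurs as such coefficients.  Since \<open>A\<close> generates \<open>T\<close>, one has \<open>T(t) \<phi>\<^sub>n = exp (\<lambda>\<^sub>n t) \<phi>\<^sub>n\<close>, so that \<open>T(t)\<close>
  acts on the coefficients as the diagonal operator with entries \<open>exp (\<lambda>\<^sub>n t)\<close>.  This operator is
  compact because \<open>\<lambda>\<^sub>n\<close> tends to \<open>-\<infinity>\<close>: eigenfunctions are classical solutions of the
  Sturm-Liouville equation which, up to scaling, have the same initial values at \<open>a\<close>.  Hence those of two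
  close eigenvalues would be close to each other (Gronwall), which contradicts their orthogonality.
  All of this is done modulo the kernel of the norm of \<open>X\<^sub>\<alpha>\<close>, so that no completeness of the
  \<open>\<phi>\<^sub>n\<close> is needed.
\<close>

subsection \<open>Spaces with the seminorm of square summable coefficients\<close>

text \<open>\<open>T\<close> is given only through strong continuity at \<open>0\<close> and its
  generator. The orbit of an eigenvector has to be recovered from its one-sided derivative at time
  \<open>0\<close>; adding up the errors of many small steps requires a bound on \<open>T h\<close>
  uniform for small \<open>h\<close>. This is why a uniform boundedness principle is proved for a
  space that is merely seminormed. For the eigenvalues, the estimate has to be uniform over a
  bounded window. The integral of \<open>rho * u * u'\<close> for two eigenfunctions is an increment
  of the Wronskian, which separated boundary conditions annihilate; the same identity supplies the
  orthogonality, which is not among the hypotheses. To contradict it, \<open>u\<close> is bounded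
  below near \<open>a\<close> by a multiple of \<open>z - a\<close>: a linear rate also serves
  Dirichlet data, where \<open>u a = 0\<close>. A gap between eigenvalues in
  \<open>[x, gamma]\<close> leaves finitely many above each \<open>x\<close>, and so
  \<open>lam\<close> tends to minus infinity for any enumeration.\<close>

locale pseudo_ell2 =
  fixes V :: "'v::real_vector set" and C :: "'v \<Rightarrow> nat \<Rightarrow> real" and N :: "'v \<Rightarrow> real"
  assumes subspace_V: "subspace V"
    and C_add: "f \<in> V \<Longrightarrow> g \<in> V \<Longrightarrow> C (f + g) n = C f n + C g n"
    and C_scale: "f \<in> V \<Longrightarrow> C (c *\<^sub>R f) n = c * C f n"
    and C_summable: "f \<in> V \<Longrightarrow> summable (\<lambda>n. (C f n)\<^sup>2)"
    and C_surj: "summable (\<lambda>n. (x n)\<^sup>2) \<Longrightarrow> \<exists>f\<in>V. C f = x"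
    and N_eq: "f \<in> V \<Longrightarrow> N f = sqrt (\<Sum>n. (C f n)\<^sup>2)"
begin

lemma V_add: "f \<in> V \<Longrightarrow> g \<in> V \<Longrightarrow> f + g \<in> V"
  and V_diff: "f \<in> V \<Longrightarrow> g \<in> V \<Longrightarrow> f - g \<in> V"
  and V_scale: "f \<in> V \<Longrightarrow> c *\<^sub>R f \<in> V"
  and V_0: "0 \<in> V"
  using subspace_V by (auto simp: subspace_add subspace_diff subspace_scale subspace_0)

lemma C_diff: "f \<in> V \<Longrightarrow> g \<in> V \<Longrightarrow> C (f - g) n = C f n - C g n"
  using C_add[of f "(-1) *\<^sub>R g" n] C_scale[of g "-1" n] V_scale[of g "-1"] by simp

lemma C_0: "C 0 n = 0"
  using C_scale[OF V_0, of 0 n] by simp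

lemma N_nonneg: "f \<in> V \<Longrightarrow> 0 \<le> N f"
  by (simp add: N_eq C_summable suminf_nonneg)

text \<open>Bounding every finite section instead of the series lets finite-dimensional estimates
  for \<open>L2_set\<close>, such as Minkowski's inequality, carry over to \<open>N\<close> without
  manipulating infinite sums.\<close>

lemma N_le_iff:
  assumes "f \<in> V" "0 \<le> B"
  shows "N f \<le> B \<longleftrightarrow> (\<forall>k. L2_set (C f) {..<k} \<le> B)"
proof
  assume *: "N f \<le> B"
  have "L2_set (C f) {..<k} \<le> N f" for k
    unfolding L2_set_def N_eq[OF assms(1)]
    by (intro real_sqrt_le_mono sum_le_suminf C_summable assms) auto
  then show "\<forall>k. L2_set (C f) {..<k} \<le> B"
    using * order_trans by blast
next
  assume *: "\<forall>k. L2_set (C f) {..<k} \<le> B"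
  have "(\<Sum>n. (C f n)\<^sup>2) \<le> B\<^sup>2"
  proof (rule suminf_le_const[OF C_summable[OF assms(1)]])
    fix k
    have "sqrt (\<Sum>n<k. (C f n)\<^sup>2) \<le> B"
      using * by (simp add: L2_set_def)
    then show "(\<Sum>n<k. (C f n)\<^sup>2) \<le> B\<^sup>2"
      by (rule sqrt_le_D)
  qed
  then show "N f \<le> B"
    using assms by (simp add: N_eq real_le_lsqrt)
qed

lemma N_triangle:
  assumes "f \<in> V" "g \<in> V"
  shows "N (f + g) \<le> N f + N g"
proof -
  have "L2_set (C (f + g)) {..<k} \<le> N f + N g" for k
  proof -
    have "L2_set (C (f + g)) {..<k} = L2_set (\<lambda>n. C f n + C g n) {..<k}"
      using assms by (intro L2_set_cong) (auto simp: C_add)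
    also have "\<dots> \<le> L2_set (C f) {..<k} + L2_set (C g) {..<k}"
      by (rule L2_set_triangle_ineq)
    also have "\<dots> \<le> N f + N g"
      using N_le_iff[OF assms(1) N_nonneg[OF assms(1)]] N_le_iff[OF assms(2) N_nonneg[OF assms(2)]]
      by (intro add_mono) auto
    finally show ?thesis .
  qed
  then show ?thesis
    using N_le_iff[OF V_add[OF assms], of "N f + N g"] assms N_nonneg by auto
qed

lemma N_scale: "f \<in> V \<Longrightarrow> N (c *\<^sub>R f) = \<bar>c\<bar> * N f"
  by (simp add: N_eq V_scale C_scale power_mult_distrib suminf_mult C_summable real_sqrt_mult)

lemma N_minus: "f \<in> V \<Longrightarrow> N (- f) = N f"
  using N_scale[of f "-1"] by simp

lemma N_diff_commute: "f \<in> V \<Longrightarrow> g \<in> V \<Longrightarrow> N (f - g) = N (g - f)"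
  using N_minus[of "f - g"] V_diff by auto

lemma N_triangle_diff: "f \<in> V \<Longrightarrow> g \<in> V \<Longrightarrow> N (f - g) \<le> N f + N g"
  using N_triangle[of f "- g"] N_minus[of g] V_diff[OF V_0, of g] by simp

lemma N_triangle_mid:
  "f \<in> V \<Longrightarrow> g \<in> V \<Longrightarrow> h \<in> V \<Longrightarrow> N (f - h) \<le> N (f - g) + N (g - h)"
  using N_triangle[of "f - g" "g - h"] V_diff by simp

lemma C_le_N:
  assumes "f \<in> V" shows "\<bar>C f n\<bar> \<le> N f"
proof -
  have "\<bar>C f n\<bar> = L2_set (C f) {n}" by (simp add: L2_set_def)
  also have "\<dots> \<le> L2_set (C f) {..<Suc n}"
    unfolding L2_set_def by (intro real_sqrt_le_mono sum_mono2) auto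
  also have "\<dots> \<le> N f"
    using N_le_iff[OF assms N_nonneg[OF assms]] by blast
  finally show ?thesis .
qed

lemma N_eq_0_iff: "f \<in> V \<Longrightarrow> N f = 0 \<longleftrightarrow> (\<forall>n. C f n = 0)"
  using C_le_N[of f] by (auto simp: N_eq)

section \<open>The topology of \<open>N\<close> and its compact ellipsoids\<close>

abbreviation topo :: "'v topology" where "topo \<equiv> norm_topology V N"

lemma topspace_norm_topology: "topspace (topo) = V"
proof -
  have "openin (topo) V"
    unfolding openin_norm_topology by (auto intro: exI[of _ 1])
  then show ?thesis
    unfolding topspace_def using openin_norm_topology[of V N] by blast
qed

lemma openin_ball:
  assumes "f \<in> V" shows "openin (topo) {g \<in> V. N (g - f) < r}"
  unfolding openin_norm_topology
proof (intro conjI ballI)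
  fix g assume g: "g \<in> {g \<in> V. N (g - f) < r}"
  show "\<exists>s>0. \<forall>h\<in>V. N (h - g) < s \<longrightarrow> h \<in> {g \<in> V. N (g - f) < r}"
    using g N_triangle_mid[OF _ _ assms] by (intro exI[of _ "r - N (g - f)"]) force
qed auto

text \<open>On an ellipsoid whose axes tend to \<open>0\<close> the topology of \<open>N\<close> is that of coordinatewise
  convergence, for which the ellipsoid is compact by Tychonoff's theorem.\<close>

lemma compactin_ellipsoid:
  fixes d :: "nat \<Rightarrow> real"
  assumes d_pos: "\<And>n. d n > 0" and d_lim: "d \<longlonglongrightarrow> 0" and M: "M \<ge> 0"
  shows "compactin (topo) {f \<in> V. \<forall>k. L2_set (\<lambda>n. C f n / d n) {..<k} \<le> M}"
proof -
  define E where "E = {x :: nat \<Rightarrow> real. \<forall>k. L2_set (\<lambda>n. x n / d n) {..<k} \<le> M}"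
  have coord: "\<bar>x n\<bar> \<le> M * d n" if "x \<in> E" for x n
  proof -
    have "\<bar>x n / d n\<bar> = L2_set (\<lambda>n. x n / d n) {n}" by (simp add: L2_set_def)
    also have "\<dots> \<le> L2_set (\<lambda>n. x n / d n) {..<Suc n}"
      unfolding L2_set_def by (intro real_sqrt_le_mono sum_mono2) auto
    also have "\<dots> \<le> M" using that by (auto simp: E_def)
    finally show ?thesis using d_pos[of n] by (simp add: abs_divide field_simps)
  qed
  have "closed E"
  proof -
    have "E = (\<Inter>k. {x. L2_set (\<lambda>n. x n / d n) {..<k} \<le> M})"
      by (auto simp: E_def)
    moreover have "closed {x :: nat \<Rightarrow> real. L2_set (\<lambda>n. x n / d n) {..<k} \<le> M}" for k
      unfolding L2_set_def divide_inverse
      by (intro closed_Collect_le continuous_intros continuous_on_product_coordinates)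
    ultimately show ?thesis by auto
  qed
  moreover have "compact (PiE UNIV (\<lambda>n. {- (M * d n)..M * d n}))"
    using compactin_PiE[of "\<lambda>n. euclideanreal" UNIV "\<lambda>n. {- (M * d n)..M * d n}"]
    by (simp add: euclidean_product_topology)
  moreover have "E \<subseteq> PiE UNIV (\<lambda>n. {- (M * d n)..M * d n})"
    using coord by (force simp: PiE_def abs_le_iff)
  ultimately have "compact E"
    by (metis compact_Int_closed inf.absorb_iff2)
  define K where "K = {f \<in> V. C f \<in> E}"
  \<comment> \<open>This replaces continuity of an inverse of \<open>C\<close>, which need not be
    injective: on \<open>K\<close>, coordinatewise closeness to \<open>C f\<close> forces closeness
    in \<open>N\<close>. The first \<open>m\<close> coordinates are controlled by \<open>W\<close>,
    the others by the shrinking axes.\<close>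
  have nbhd: "\<exists>W. open W \<and> C f \<in> W \<and> (\<forall>g\<in>K. C g \<in> W \<longrightarrow> N (g - f) < r)"
    if f: "f \<in> K" and r: "r > 0" for f r
  proof -
    define s where "s = r / 4"
    have "s > 0" using r by (simp add: s_def)
    \<comment> \<open>After division by \<open>d\<close> two points of the ellipsoid differ by at
      most \<open>2 * M\<close>, so beyond \<open>m\<close> the factor \<open>d n\<close> reduces
      this to \<open>s\<close>; the \<open>+ 1\<close> keeps \<open>s / (2 * M + 1)\<close>
      meaningful when \<open>M = 0\<close>. Head and tail are at most \<open>s = r / 4\<close> each,
      in total \<open>2 * s < r\<close>.\<close>
    obtain m where m: "\<And>n. n \<ge> m \<Longrightarrow> d n * (2 * M + 1) < s"
    proof -
      have "(\<lambda>n. d n * (2 * M + 1)) \<longlonglongrightarrow> 0"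
        using tendsto_mult_right[OF d_lim, of "2 * M + 1"] by simp
      then have "eventually (\<lambda>n. d n * (2 * M + 1) < s) sequentially"
        using \<open>s > 0\<close> by (rule order_tendstoD)
      then show thesis using that by (auto simp: eventually_sequentially)
    qed
    define W where "W = {x. L2_set (\<lambda>n. x n - C f n) {..<m} < s}"
    have "open W"
      unfolding W_def L2_set_def
      by (intro open_Collect_less continuous_intros continuous_on_product_coordinates)
    moreover have "C f \<in> W"
      using \<open>s > 0\<close> by (simp add: W_def L2_set_def)
    moreover have "N (g - f) < r" if g: "g \<in> K" and gW: "C g \<in> W" for g
    proof -
      have V: "f \<in> V" "g \<in> V" "g - f \<in> V" using f g V_diff by (auto simp: K_def)
      have "L2_set (C (g - f)) {..<k} \<le> 2 * s" for k
      proof -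
        have "L2_set (C (g - f)) {..<k} \<le> L2_set (C (g - f)) ({..<m} \<union> {m..<k})"
          unfolding L2_set_def by (intro real_sqrt_le_mono sum_mono2) auto
        also have "\<dots> = sqrt ((L2_set (C (g - f)) {..<m})\<^sup>2 + (L2_set (C (g - f)) {m..<k})\<^sup>2)"
        proof -
          have "(\<Sum>n\<in>{..<m} \<union> {m..<k}. (C (g - f) n)\<^sup>2) =
              (\<Sum>n<m. (C (g - f) n)\<^sup>2) + (\<Sum>n=m..<k. (C (g - f) n)\<^sup>2)"
            by (rule sum.union_disjoint) auto
          then show ?thesis by (simp add: L2_set_def sum_nonneg)
        qed
        also have "\<dots> \<le> L2_set (C (g - f)) {..<m} + L2_set (C (g - f)) {m..<k}"
          by (rule sqrt_sum_squares_le_sum) (auto simp: L2_set_def sum_nonneg)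
        also have "L2_set (C (g - f)) {..<m} = L2_set (\<lambda>n. C g n - C f n) {..<m}"
          using V by (intro L2_set_cong) (auto simp: C_diff)
        also have "\<dots> \<le> s"
          using gW by (simp add: W_def)
        also have "L2_set (C (g - f)) {m..<k} \<le> s"
        proof -
          have "L2_set (\<lambda>n. C (g - f) n / d n) {m..<k} \<le> 2 * M"
          proof -
            have "L2_set (\<lambda>n. C (g - f) n / d n) {m..<k} = L2_set (\<lambda>n. C g n / d n + - (C f n / d n)) {m..<k}"
              using V by (simp add: C_diff diff_divide_distrib)
            also have "\<dots> \<le> L2_set (\<lambda>n. C g n / d n) {m..<k} + L2_set (\<lambda>n. - (C f n / d n)) {m..<k}"
              by (rule L2_set_triangle_ineq)
            also have "\<dots> = L2_set (\<lambda>n. C g n / d n) {m..<k} + L2_set (\<lambda>n. C f n / d n) {m..<k}"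
              by (simp add: L2_set_def)
            also have "L2_set (\<lambda>n. C g n / d n) {m..<k} \<le> L2_set (\<lambda>n. C g n / d n) {..<k}"
              unfolding L2_set_def by (intro real_sqrt_le_mono sum_mono2) auto
            also have "\<dots> \<le> M" using g by (auto simp: K_def E_def)
            also have "L2_set (\<lambda>n. C f n / d n) {m..<k} \<le> L2_set (\<lambda>n. C f n / d n) {..<k}"
              unfolding L2_set_def by (intro real_sqrt_le_mono sum_mono2) auto
            also have "\<dots> \<le> M" using f by (auto simp: K_def E_def)
            finally show ?thesis by simp
          qed
          moreover have "L2_set (C (g - f)) {m..<k} \<le>
              L2_set (\<lambda>n. s / (2 * M + 1) * (C (g - f) n / d n)) {m..<k}"
          proof -
            have "(C (g - f) n)\<^sup>2 \<le> (s / (2 * M + 1) * (C (g - f) n / d n))\<^sup>2" if "n \<in> {m..<k}" for n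
            proof -
              have "d n \<le> s / (2 * M + 1)"
                using m[of n] that M by (simp add: field_simps)
              then have "1 \<le> s / (2 * M + 1) / d n"
                using d_pos[of n] by (subst pos_le_divide_eq) auto
              then have "\<bar>C (g - f) n\<bar> \<le> s / (2 * M + 1) / d n * \<bar>C (g - f) n\<bar>"
                using mult_right_mono[of 1 "s / (2 * M + 1) / d n" "\<bar>C (g - f) n\<bar>"] by simp
              also have "\<dots> = \<bar>s / (2 * M + 1) * (C (g - f) n / d n)\<bar>"
                using d_pos[of n] \<open>s > 0\<close> M by (simp add: abs_mult abs_divide)
              finally show ?thesis unfolding abs_le_square_iff .
            qed
            then show ?thesis
              unfolding L2_set_def by (intro real_sqrt_le_mono sum_mono)
          qed
          moreover have "L2_set (\<lambda>n. s / (2 * M + 1) * (C (g - f) n / d n)) {m..<k} =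
              s / (2 * M + 1) * L2_set (\<lambda>n. C (g - f) n / d n) {m..<k}"
            using \<open>s > 0\<close> M by (subst L2_set_right_distrib) auto
          ultimately have "L2_set (C (g - f)) {m..<k} \<le> s / (2 * M + 1) * (2 * M)"
            using mult_left_mono[of _ "2 * M" "s / (2 * M + 1)"] \<open>s > 0\<close> M
            by (smt (verit) divide_nonneg_nonneg)
          also have "\<dots> \<le> s" using \<open>s > 0\<close> M by (simp add: field_simps)
          finally show ?thesis .
        qed
        finally show ?thesis by simp
      qed
      then have "N (g - f) \<le> 2 * s" using N_le_iff[OF V(3), of "2 * s"] \<open>s > 0\<close> by simp
      also have "\<dots> < r" using r by (simp add: s_def)
      finally show ?thesis .
    qed
    ultimately show ?thesis by blast
  qed
  \<comment> \<open>A cover of \<open>K\<close> is transported to a cover of \<open>E\<close> by the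
    sets \<open>W f\<close>, a finite subcover is taken there, and \<open>nbhd\<close> carries it
    back.\<close>
  have "compactin (topo) K"
    unfolding compactin_def topspace_norm_topology
  proof (intro conjI allI impI)
    show "K \<subseteq> V" by (auto simp: K_def)
    fix \<U> assume \<U>: "Ball \<U> (openin (topo)) \<and> K \<subseteq> \<Union> \<U>"
    have "\<exists>U W. U \<in> \<U> \<and> open W \<and> C f \<in> W \<and> (\<forall>g\<in>K. C g \<in> W \<longrightarrow> g \<in> U)" if f: "f \<in> K" for f
    proof -
      obtain U where U: "U \<in> \<U>" "f \<in> U" using \<U> f by blast
      then have "openin (topo) U" using \<U> by blast
      then obtain r where r: "r > 0" "\<forall>g\<in>V. N (g - f) < r \<longrightarrow> g \<in> U"
        using U(2) unfolding openin_norm_topology by blast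
      show ?thesis using nbhd[OF f r(1)] r(2) U(1) by (auto simp: K_def)
    qed
    then obtain U W where UW: "\<And>f. f \<in> K \<Longrightarrow> U f \<in> \<U> \<and> open (W f) \<and> C f \<in> W f \<and>
        (\<forall>g\<in>K. C g \<in> W f \<longrightarrow> g \<in> U f)" by metis
    have "E \<subseteq> \<Union> (W ` K)"
    proof
      fix x assume x: "x \<in> E"
      \<comment> \<open>Boundedness of \<open>d\<close> turns the ellipsoid condition into square
        summability, so that \<open>C_surj\<close> gives a point of \<open>K\<close> above
        \<open>x\<close>.\<close>
      have "summable (\<lambda>n. (x n)\<^sup>2)"
      proof -
        obtain D where D: "\<And>n. \<bar>d n\<bar> \<le> D"
          using convergent_imp_Bseq[of d] d_lim by (auto simp: convergent_def Bseq_def)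
        have "(\<Sum>n<k. (x n / d n)\<^sup>2) \<le> M\<^sup>2" for k
          using x sqrt_le_D by (auto simp: E_def L2_set_def)
        then have "summable (\<lambda>n. (x n / d n)\<^sup>2)"
          by (intro summableI_nonneg_bounded[of _ "M\<^sup>2"]) auto
        then have "summable (\<lambda>n. D\<^sup>2 * (x n / d n)\<^sup>2)" by (rule summable_mult)
        moreover have "norm ((x n)\<^sup>2) \<le> D\<^sup>2 * (x n / d n)\<^sup>2" for n
        proof -
          have "(d n)\<^sup>2 \<le> D\<^sup>2" using D[of n] by (rule abs_le_square_iff[THEN iffD1, OF order_trans]) simp
          then have "(d n)\<^sup>2 * (x n / d n)\<^sup>2 \<le> D\<^sup>2 * (x n / d n)\<^sup>2"
            by (rule mult_right_mono) simp
          then show ?thesis using d_pos[of n] by (simp add: power_divide)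
        qed
        ultimately show ?thesis by (rule summable_comparison_test'[where N=0])
      qed
      then obtain f where "f \<in> V" "C f = x" using C_surj by blast
      then show "x \<in> \<Union> (W ` K)" using UW[of f] x by (auto simp: K_def)
    qed
    then obtain F where F: "F \<subseteq> K" "finite F" "E \<subseteq> (\<Union>f\<in>F. W f)"
      using compactE_image[OF \<open>compact E\<close>, of K W] UW by blast
    show "\<exists>\<F>. finite \<F> \<and> \<F> \<subseteq> \<U> \<and> K \<subseteq> \<Union> \<F>"
    proof (intro exI[of _ "U ` F"] conjI)
      show "K \<subseteq> \<Union> (U ` F)"
      proof
        fix g assume g: "g \<in> K"
        then have "C g \<in> E" by (simp add: K_def)
        then obtain f where "f \<in> F" "C g \<in> W f" using F(3) by blast
        then show "g \<in> \<Union> (U ` F)" using UW[of f] F(1) g by blast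
      qed
    qed (use F UW in auto)
  qed
  then show ?thesis by (simp add: K_def E_def)
qed

text \<open>The image lies in the ellipsoid with semi-axes \<open>M * d n\<close>. Since
  \<open>N\<close> may vanish on nonzero vectors, \<open>topo\<close> need not be Hausdorff and a
  compact set need not be closed; therefore the closure itself is shown to stay in the ellipsoid, of
  which it is then a closed subset.\<close>

lemma compactin_closure_diagonal_image:
  fixes d :: "nat \<Rightarrow> real"
  assumes d_pos: "\<And>n. d n > 0" and d_lim: "d \<longlonglongrightarrow> 0"
    and S_V: "\<And>f. f \<in> V \<Longrightarrow> S f \<in> V" and S: "\<And>f n. f \<in> V \<Longrightarrow> C (S f) n = d n * C f n"
    and B: "B \<subseteq> V" "\<And>f. f \<in> B \<Longrightarrow> N f \<le> M"
  shows "compactin (topo) (topo closure_of (S ` B))"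
proof (cases "B = {}")
  case True
  then show ?thesis by (simp add: compactin_empty)
next
  case False
  then have M: "M \<ge> 0" using B N_nonneg by force
  define K where "K = {f \<in> V. \<forall>k. L2_set (\<lambda>n. C f n / d n) {..<k} \<le> M}"
  have "topo closure_of (S ` B) \<subseteq> K"
  proof
    fix g assume g: "g \<in> topo closure_of (S ` B)"
    then have gV: "g \<in> V" by (simp add: in_closure_of topspace_norm_topology)
    have "L2_set (\<lambda>n. C g n / d n) {..<k} \<le> M" for k
    proof (rule field_le_epsilon)
      fix e :: real assume e: "e > 0"
      \<comment> \<open>Only finitely many divisors \<open>d n\<close> occur for a fixed
        \<open>k\<close>, so \<open>L\<close> bounds all \<open>1 / d n\<close> at once;
        \<open>+ 1\<close> makes it positive even for \<open>k = 0\<close>. An approximation within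
        \<open>e / L\<close> then costs at most \<open>e\<close> in the scaled section.\<close>
      define L where "L = L2_set (\<lambda>n. 1 / d n) {..<k} + 1"
      have L: "L > 0" unfolding L_def by (rule add_nonneg_pos) auto
      have L_ge: "1 / d n \<le> L" if "n < k" for n
        using member_le_L2_set[of "{..<k}" n "\<lambda>n. 1 / d n"] that by (simp add: L_def)
      have ball: "openin (topo) {h \<in> V. N (h - g) < e / L}"
        by (rule openin_ball[OF gV])
      have "g \<in> {h \<in> V. N (h - g) < e / L}"
        using gV e L C_0 by (simp add: N_eq V_0)
      then have "\<exists>h. h \<in> S ` B \<and> h \<in> {h \<in> V. N (h - g) < e / L}"
        using conjunct2[OF g[unfolded in_closure_of], rule_format, of "{h \<in> V. N (h - g) < e / L}"] ball
        by blast
      then obtain f where f: "f \<in> B" "N (S f - g) < e / L" by auto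
      have V: "f \<in> V" "S f \<in> V" "g - S f \<in> V"
        using f(1) B(1) S_V[of f] V_diff[OF gV, of "S f"] by auto
      have "L2_set (\<lambda>n. C g n / d n) {..<k} = L2_set (\<lambda>n. C f n + C (g - S f) n / d n) {..<k}"
      proof (rule L2_set_cong)
        fix n
        have "C (S f) n = d n * C f n" "d n \<noteq> 0" using S[OF V(1)] d_pos[of n] by auto
        then show "C g n / d n = C f n + C (g - S f) n / d n"
          using C_diff[OF gV V(2), of n] by (simp add: field_simps)
      qed simp
      also have "\<dots> \<le> L2_set (C f) {..<k} + L2_set (\<lambda>n. C (g - S f) n / d n) {..<k}"
        by (rule L2_set_triangle_ineq)
      also have "L2_set (C f) {..<k} \<le> M"
        using N_le_iff[OF V(1) M] B(2)[OF f(1)] by blast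
      also have "L2_set (\<lambda>n. C (g - S f) n / d n) {..<k} \<le> L2_set (\<lambda>n. L * C (g - S f) n) {..<k}"
        unfolding L2_set_def
      proof (intro real_sqrt_le_mono sum_mono)
        fix n assume "n \<in> {..<k}"
        then have "\<bar>C (g - S f) n\<bar> * (1 / d n) \<le> \<bar>C (g - S f) n\<bar> * L"
          by (intro mult_left_mono L_ge) auto
        then show "(C (g - S f) n / d n)\<^sup>2 \<le> (L * C (g - S f) n)\<^sup>2"
          unfolding abs_le_square_iff[symmetric] using d_pos[of n] L
          by (simp add: abs_mult abs_divide mult.commute)
      qed
      also have "\<dots> = L * L2_set (C (g - S f)) {..<k}"
        using L by (simp add: L2_set_right_distrib)
      also have "\<dots> \<le> L * N (g - S f)"
        using N_le_iff[OF V(3) N_nonneg[OF V(3)]] L by (intro mult_left_mono) auto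
      also have "\<dots> \<le> e"
        using f(2) L N_diff_commute[OF gV V(2)] by (simp add: field_simps)
      finally show "L2_set (\<lambda>n. C g n / d n) {..<k} \<le> M + e" by simp
    qed
    then show "g \<in> K" using gV by (simp add: K_def)
  qed
  moreover have "compactin (topo) K"
    using compactin_ellipsoid[of d M] d_pos d_lim M unfolding K_def by blast
  ultimately show ?thesis
    using closed_compactin closedin_closure_of by metis
qed

section \<open>Completeness, uniform boundedness and strongly continuous semigroups\<close>

lemma Cauchy_limit:
  fixes x :: "nat \<Rightarrow> 'v"
  assumes xV: "\<And>k. x k \<in> V"
    and Cauchy: "\<And>e. e > 0 \<Longrightarrow> \<exists>k0. \<forall>k\<ge>k0. \<forall>l\<ge>k0. N (x k - x l) \<le> e"
  shows "\<exists>f\<in>V. \<forall>e>0. \<exists>k0. \<forall>k\<ge>k0. N (f - x k) \<le> e"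
proof -
  have "convergent (\<lambda>k. C (x k) n)" for n
  proof (rule Cauchy_convergent, rule metric_CauchyI)
    fix e :: real assume "e > 0"
    then obtain k0 where k0: "\<forall>k\<ge>k0. \<forall>l\<ge>k0. N (x k - x l) \<le> e / 2"
      using Cauchy[of "e / 2"] by auto
    have "dist (C (x k) n) (C (x l) n) < e" if kl: "k \<ge> k0" "l \<ge> k0" for k l
    proof -
      have "N (x k - x l) \<le> e / 2" using k0 kl by blast
      then show ?thesis
        using C_le_N[OF V_diff[OF xV xV], of k l n] \<open>e > 0\<close>
        by (simp add: dist_real_def C_diff[OF xV xV])
    qed
    then show "\<exists>M. \<forall>m\<ge>M. \<forall>l\<ge>M. dist (C (x m) n) (C (x l) n) < e" by blast
  qed
  then obtain y where y: "\<And>n. (\<lambda>k. C (x k) n) \<longlonglongrightarrow> y n"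
    unfolding convergent_def by metis
  have tail: "L2_set (\<lambda>n. y n - C (x k) n) {..<m} \<le> e"
    if k0: "\<forall>k\<ge>k0. \<forall>l\<ge>k0. N (x k - x l) \<le> e" and k: "k \<ge> k0" for k0 k m e
  proof (rule LIMSEQ_le_const2)
    show "(\<lambda>l. L2_set (\<lambda>n. C (x l) n - C (x k) n) {..<m}) \<longlonglongrightarrow> L2_set (\<lambda>n. y n - C (x k) n) {..<m}"
      unfolding L2_set_def by (intro tendsto_intros y)
    have "L2_set (\<lambda>n. C (x l) n - C (x k) n) {..<m} \<le> e" if l: "l \<ge> k0" for l
    proof -
      have "L2_set (\<lambda>n. C (x l) n - C (x k) n) {..<m} = L2_set (C (x l - x k)) {..<m}"
        by (intro L2_set_cong) (simp_all add: C_diff[OF xV xV])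
      also have "\<dots> \<le> N (x l - x k)"
        using N_le_iff[OF V_diff[OF xV xV] N_nonneg[OF V_diff[OF xV xV]]] by blast
      also have "\<dots> \<le> e" using k0 k l by blast
      finally show ?thesis .
    qed
    then show "\<exists>l0. \<forall>l\<ge>l0. L2_set (\<lambda>n. C (x l) n - C (x k) n) {..<m} \<le> e" by blast
  qed
  \<comment> \<open>The coordinatewise limit \<open>y\<close> is not yet known to be square
    summable, but its difference from \<open>C (x k1)\<close> is; lifting this difference by
    \<open>C_surj\<close> and adding \<open>x k1\<close> gives a vector with coefficients
    \<open>y\<close>.\<close>
  obtain k1 where k1: "\<forall>k\<ge>k1. \<forall>l\<ge>k1. N (x k - x l) \<le> 1"
    using Cauchy[of 1] by auto
  have "summable (\<lambda>n. (y n - C (x k1) n)\<^sup>2)"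
  proof (rule summableI_nonneg_bounded)
    show "(\<Sum>n<m. (y n - C (x k1) n)\<^sup>2) \<le> 1" for m
      using tail[OF k1 order_refl, of m] by (simp add: L2_set_def)
  qed auto
  then obtain g where g: "g \<in> V" "C g = (\<lambda>n. y n - C (x k1) n)"
    using C_surj[of "\<lambda>n. y n - C (x k1) n"] by auto
  define f where "f = g + x k1"
  have fV: "f \<in> V" and Cf: "C f n = y n" for n
    using g xV by (auto simp: f_def V_add C_add)
  have "\<exists>k0. \<forall>k\<ge>k0. N (f - x k) \<le> e" if e: "e > 0" for e
  proof -
    obtain k0 where k0: "\<forall>k\<ge>k0. \<forall>l\<ge>k0. N (x k - x l) \<le> e"
      using Cauchy[OF e] by blast
    have "N (f - x k) \<le> e" if k: "k \<ge> k0" for k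
    proof -
      have "L2_set (C (f - x k)) {..<m} = L2_set (\<lambda>n. y n - C (x k) n) {..<m}" for m
        by (intro L2_set_cong) (simp_all add: C_diff[OF fV xV] Cf)
      then show ?thesis
        using tail[OF k0 k] e N_le_iff[OF V_diff[OF fV xV], of e k] by simp
    qed
    then show ?thesis by blast
  qed
  then show ?thesis using fV by blast
qed

text \<open>\<open>M\<close> is the operator norm, the supremum of \<open>N (S y)\<close> over unit
  vectors; \<open>K >= 0\<close> makes it positive, so \<open>3 / 4 * M\<close> lies strictly below
  it. Normalising works because \<open>S\<close> maps vectors of seminorm \<open>0\<close> to
  vectors of seminorm \<open>0\<close>.\<close>

lemma operator_bound_attained_up_to_factor:
  assumes S: "bounded_operator_on V N S" and unbdd: "\<exists>f\<in>V. N (S f) > K * N f" and K: "K \<ge> 0"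
  shows "\<exists>M y. K < M \<and> (\<forall>f\<in>V. N (S f) \<le> M * N f) \<and> y \<in> V \<and> N y = 1 \<and> 3 / 4 * M \<le> N (S y)"
proof -
  obtain M0 where M0: "\<And>f. f \<in> V \<Longrightarrow> N (S f) \<le> M0 * N f"
    using S unfolding bounded_operator_on_def by blast
  have scale: "S (c *\<^sub>R f) = c *\<^sub>R S f" and SV: "S f \<in> V" if "f \<in> V" for c f
    using S that by (auto simp: bounded_operator_on_def)
  define Q where "Q = {N (S y) | y. y \<in> V \<and> N y = 1}"
  have unit: "N (S f) = N f * N (S ((1 / N f) *\<^sub>R f))" "N ((1 / N f) *\<^sub>R f) = 1"
    if "f \<in> V" "N f \<noteq> 0" for f
    using that N_nonneg[OF that(1)] by (auto simp: N_scale V_scale scale SV)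
  have null: "N (S f) = 0" if "f \<in> V" "N f = 0" for f
    using M0[OF that(1)] that N_nonneg[OF SV[OF that(1)]] by simp
  obtain f where f: "f \<in> V" "N (S f) > K * N f" using unbdd by blast
  have f0: "N f \<noteq> 0" using f null by auto
  then have fpos: "N f > 0" using N_nonneg[OF f(1)] by simp
  have bdd: "bdd_above Q"
    by (rule bdd_aboveI[of _ M0]) (auto simp: Q_def dest!: M0)
  define M where "M = Sup Q"
  have in_Q: "N (S ((1 / N h) *\<^sub>R h)) \<in> Q" if "h \<in> V" "N h \<noteq> 0" for h
    using unit[OF that] that V_scale unfolding Q_def by blast
  have "K < N (S ((1 / N f) *\<^sub>R f))"
    using f(2) unit(1)[OF f(1) f0] fpos by (simp add: mult.commute)
  also have le: "\<dots> \<le> M"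
    unfolding M_def by (rule cSup_upper[OF in_Q[OF f(1) f0] bdd])
  finally have "K < M" .
  moreover have "N (S h) \<le> M * N h" if "h \<in> V" for h
  proof (cases "N h = 0")
    case False
    have "N (S ((1 / N h) *\<^sub>R h)) \<le> M"
      unfolding M_def by (rule cSup_upper[OF in_Q[OF that False] bdd])
    then show ?thesis
      using unit(1)[OF that False] mult_left_mono[OF _ N_nonneg[OF that]]
      by (simp add: mult.commute[of M])
  qed (use null that in auto)
  moreover have "\<exists>y. y \<in> V \<and> N y = 1 \<and> 3 / 4 * M \<le> N (S y)"
  proof -
    have "3 / 4 * M < M" using \<open>K < M\<close> K by simp
    moreover have "Q \<noteq> {}" using in_Q[OF f(1) f0] by blast
    ultimately obtain z where "z \<in> Q" "3 / 4 * M < z"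
      unfolding M_def using less_cSupD by blast
    then show ?thesis unfolding Q_def by force
  qed
  ultimately show ?thesis by blast
qed

text \<open>Sokal's proof of the uniform boundedness principle: since one of \<open>S (x \<plusminus> r y)\<close> is at least as
  large as \<open>r S y\<close>, one finds a Cauchy sequence of points at which the operators grow.\<close>

lemma uniform_boundedness_sequence:
  assumes S: "\<And>k. bounded_operator_on V N (S k)"
    and large: "\<And>k. \<exists>f\<in>V. N (S k f) > 4 ^ k * N f"
  shows "\<exists>f\<in>V. \<forall>B. \<exists>k. N (S k f) > B"
proof -
  have "\<exists>M y. 4 ^ k < M \<and> (\<forall>f\<in>V. N (S k f) \<le> M * N f) \<and> y \<in> V \<and> N y = 1 \<and> 3 / 4 * M \<le> N (S k y)" for k
    using operator_bound_attained_up_to_factor[OF S large[of k]] by simp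
  then obtain M y where My: "\<And>k. 4 ^ k < M k" "\<And>k f. f \<in> V \<Longrightarrow> N (S k f) \<le> M k * N f"
    "\<And>k. y k \<in> V" "\<And>k. N (y k) = 1" "\<And>k. 3 / 4 * M k \<le> N (S k (y k))"
    by metis
  \<comment> \<open>Ratio \<open>1/3\<close> against growth \<open>4 ^ k\<close>: the steps after
    \<open>x (Suc k)\<close> move by at most \<open>3 / 2 * r (Suc k) = 1 / 2 * r k\<close> in
    total, so of the gain \<open>3 / 4 * (r k * M k)\<close> at step \<open>k\<close> at least
    \<open>1 / 4 * (r k * M k)\<close> survives in the limit, and \<open>r k * 4 ^ k\<close> tends
    to infinity.\<close>
  define r :: "nat \<Rightarrow> real" where "r k = (1/3) ^ k" for k
  have r0: "r k > 0" for k by (simp add: r_def)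
  have S_lin: "S k (f + g) = S k f + S k g" "S k (c *\<^sub>R f) = c *\<^sub>R S k f" "S k f \<in> V"
    if "f \<in> V" "g \<in> V" for k f g c
    using S[of k] that by (auto simp: bounded_operator_on_def)
  define step where "step k x = (if N (S k (x + r k *\<^sub>R y k)) \<ge> r k * N (S k (y k))
     then x + r k *\<^sub>R y k else x - r k *\<^sub>R y k)" for k x
  define x where "x = rec_nat 0 step"
  have x0: "x 0 = 0" and xS: "x (Suc k) = step k (x k)" for k by (simp_all add: x_def)
  have ry: "r k *\<^sub>R y k \<in> V" for k using My V_scale by blast
  have stepV: "step k z \<in> V" if "z \<in> V" for k z
    using that ry[of k] V_add V_diff by (simp add: step_def)
  have xV: "x k \<in> V" for k by (induction k) (simp_all add: x0 xS V_0 stepV)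
  have step_dist: "N (x (Suc k) - x k) = r k" for k
    using My(4)[of k] My(3)[of k] r0[of k] N_minus[OF ry, of k] by (simp add: xS step_def N_scale)
  have step_large: "N (S k (x (Suc k))) \<ge> r k * (3 / 4 * M k)" for k
  proof -
    \<comment> \<open>As \<open>?a - ?b\<close> is \<open>2 * r k\<close> times \<open>y k\<close>,
      the images of \<open>?a\<close> and \<open>?b\<close> cannot both be small; the case
      distinction in \<open>step\<close> picks a large one.\<close>
    let ?a = "x k + r k *\<^sub>R y k" and ?b = "x k - r k *\<^sub>R y k"
    have V: "?a \<in> V" "?b \<in> V" using xV ry V_add V_diff by auto
    have "?a - ?b = (2 * r k) *\<^sub>R y k" by (simp add: scaleR_2 flip: scaleR_scaleR)
    then have "2 * (r k * N (S k (y k))) = N (S k (?a - ?b))"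
      using S_lin[OF My(3)[of k] My(3)[of k]] r0[of k] by (simp add: N_scale)
    also have "S k (?a - ?b) = S k ?a - S k ?b"
      using S_lin(1)[OF V(1) V_scale[OF V(2)], of k "-1"] S_lin(2)[OF V(2) V(2), of k "-1"] by simp
    also have "N (S k ?a - S k ?b) \<le> N (S k ?a) + N (S k ?b)"
      using N_triangle_diff S_lin(3)[OF V(1) V(1)] S_lin(3)[OF V(2) V(2)] by blast
    finally have "N (S k (x (Suc k))) \<ge> r k * N (S k (y k))"
      unfolding xS step_def by auto
    then show ?thesis
      using mult_left_mono[OF My(5)[of k], of "r k"] r0[of k] by linarith
  qed
  have far: "N (x (k + j) - x k) \<le> 3 / 2 * r k" for k j
  proof -
    \<comment> \<open>The geometric sum is kept in telescoping form, which the induction on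
      \<open>j\<close> reproduces.\<close>
    have "N (x (k + j) - x k) \<le> 3 / 2 * (r k - r (k + j))"
    proof (induction j)
      case 0
      then show ?case using V_0 C_0 by (simp add: N_eq)
    next
      case (Suc j)
      have "N (x (k + Suc j) - x k) \<le> N (x (Suc (k + j)) - x (k + j)) + N (x (k + j) - x k)"
        using N_triangle_mid[OF xV xV xV] by simp
      also have "\<dots> \<le> r (k + j) + 3 / 2 * (r k - r (k + j))"
        using step_dist Suc by simp
      also have "\<dots> = 3 / 2 * (r k - r (k + Suc j))" by (simp add: r_def field_simps)
      finally show ?case .
    qed
    then show ?thesis using r0[of "k + j"] by (simp add: algebra_simps)
  qed
  have "\<exists>f\<in>V. \<forall>e>0. \<exists>k0. \<forall>k\<ge>k0. N (f - x k) \<le> e"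
  proof (rule Cauchy_limit[OF xV])
    fix e :: real assume "e > 0"
    then obtain k0 where k0: "3 * r k0 < e"
      using real_arch_pow_inv[of "e / 3" "1/3"] by (auto simp: r_def field_simps)
    have "N (x k - x l) \<le> e" if "k \<ge> k0" "l \<ge> k0" for k l
      using N_triangle_mid[OF xV[of k] xV[of k0] xV[of l]] N_diff_commute[OF xV[of k0] xV[of l]]
        far[of k0 "k - k0"] far[of k0 "l - k0"] that k0 by simp
    then show "\<exists>k0. \<forall>k\<ge>k0. \<forall>l\<ge>k0. N (x k - x l) \<le> e" by blast
  qed
  then obtain f where f: "f \<in> V" and lim: "\<And>e. e > 0 \<Longrightarrow> \<exists>k0. \<forall>k\<ge>k0. N (f - x k) \<le> e" by blast
  have near: "N (f - x k) \<le> 3 / 2 * r k" for k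
  proof (rule field_le_epsilon)
    fix e :: real assume "e > 0"
    then obtain k0 where "\<forall>l\<ge>k0. N (f - x l) \<le> e" using lim by blast
    then have "N (f - x (k + k0)) \<le> e" by simp
    then show "N (f - x k) \<le> 3 / 2 * r k + e"
      using N_triangle_mid[OF f xV[of "k + k0"] xV[of k]] far[of k k0] by simp
  qed
  have grow: "N (S k f) \<ge> 1 / 4 * (4 / 3) ^ k" for k
  proof -
    have V: "x (Suc k) - f \<in> V" using V_diff xV f by blast
    have "r k * (3 / 4 * M k) \<le> N (S k (f + (x (Suc k) - f)))"
      using step_large by simp
    also have "\<dots> = N (S k f + S k (x (Suc k) - f))"
      using S_lin(1)[OF f V] by simp
    also have "\<dots> \<le> N (S k f) + N (S k (x (Suc k) - f))"
      using N_triangle S_lin(3)[OF f f] S_lin(3)[OF V V] by blast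
    also have "N (S k (x (Suc k) - f)) \<le> M k * N (x (Suc k) - f)"
      by (rule My(2)[OF V])
    also have "\<dots> \<le> M k * (1 / 2 * r k)"
    proof (rule mult_left_mono)
      show "N (x (Suc k) - f) \<le> 1 / 2 * r k"
        using near[of "Suc k"] N_diff_commute[OF f xV] by (simp add: r_def)
      show "0 \<le> M k" using My(1)[of k] zero_le_power[of "4::real" k] by linarith
    qed
    finally have "1 / 4 * (r k * M k) \<le> N (S k f)" by (simp add: mult.commute)
    moreover have "r k * 4 ^ k \<le> r k * M k"
      using My(1)[of k] r0[of k] by simp
    moreover have "r k * 4 ^ k = (4 / 3) ^ k"
      unfolding r_def power_mult_distrib[symmetric] by simp
    ultimately show ?thesis by linarith
  qed
  have "\<exists>k. N (S k f) > B" for B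
  proof -
    obtain k where "4 * B < (4 / 3 :: real) ^ k"
      using real_arch_pow[of "4/3" "4 * B"] by auto
    then show ?thesis using grow[of k] by (intro exI[of _ k]) linarith
  qed
  then show ?thesis using f by blast
qed

text \<open>Each \<open>T h\<close> comes with its own bound. If no common one existed near
  \<open>0\<close>, times \<open>h k <= 1 / Suc k\<close> with operator norms beyond
  \<open>4 ^ k\<close> would give, by uniform boundedness, one vector with unbounded orbit along
  \<open>h k\<close>, contradicting strong continuity at \<open>0\<close>.\<close>

lemma C0_semigroup_locally_bounded:
  assumes T: "C0_semigroup_on V N T"
  shows "\<exists>M\<ge>1. \<exists>\<delta>>0. \<forall>h. 0 \<le> h \<and> h \<le> \<delta> \<longrightarrow> (\<forall>f\<in>V. N (T h f) \<le> M * N f)"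
proof (rule ccontr)
  assume contra: "\<not> ?thesis"
  have bounded: "bounded_operator_on V N (T t)" if "t \<ge> 0" for t
    using T that by (simp add: C0_semigroup_on_def)
  have "\<exists>h. 0 \<le> h \<and> h \<le> 1 / Suc k \<and> (\<exists>f\<in>V. N (T h f) > 4 ^ k * N f)" for k
  proof (rule ccontr)
    assume "\<not> ?thesis"
    then have "\<forall>h. 0 \<le> h \<and> h \<le> 1 / Suc k \<longrightarrow> (\<forall>f\<in>V. N (T h f) \<le> 4 ^ k * N f)"
      by (auto simp: not_less)
    moreover have "(1::real) \<le> 4 ^ k" by simp
    moreover have "0 < 1 / real (Suc k)" by simp
    ultimately show False using contra by blast
  qed
  then obtain h where h: "\<And>k. 0 \<le> h k" "\<And>k. h k \<le> 1 / Suc k" "\<And>k. \<exists>f\<in>V. N (T (h k) f) > 4 ^ k * N f"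
    by metis
  obtain f where f: "f \<in> V" and unb: "\<And>B. \<exists>k. N (T (h k) f) > B"
    using uniform_boundedness_sequence[of "\<lambda>k. T (h k)"] bounded h by blast
  have TV: "T t f \<in> V" if "t \<ge> 0" for t
    using bounded[OF that] f by (simp add: bounded_operator_on_def)
  have "((\<lambda>t. N (T t f - f)) \<longlongrightarrow> 0) (at_right 0)"
    using T f by (simp add: C0_semigroup_on_def)
  then have "eventually (\<lambda>t. N (T t f - f) < 1) (at_right 0)"
    by (rule order_tendstoD) simp
  then obtain d where d: "d > 0" "\<And>t. 0 < t \<Longrightarrow> t < d \<Longrightarrow> N (T t f - f) < 1"
    unfolding eventually_at_right_field by blast
  obtain k0 where k0: "1 / real (Suc k0) < d"
    using reals_Archimedean[OF d(1)] by (auto simp: inverse_eq_divide)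
  \<comment> \<open>The limit in \<open>at_right 0\<close> says nothing about time \<open>0\<close>
    itself, which \<open>h k\<close> may equal; there \<open>T 0 f = f\<close> is used.\<close>
  have small: "N (T (h k) f) \<le> 1 + N f" if "k \<ge> k0" for k
  proof (cases "h k = 0")
    case True
    then show ?thesis using T f by (simp add: C0_semigroup_on_def)
  next
    case False
    have "1 / real (Suc k) \<le> 1 / real (Suc k0)" using that by (simp add: frac_le)
    then have "N (T (h k) f - f) < 1"
      using d(2)[of "h k"] h(1,2)[of k] False k0 by linarith
    then show ?thesis
      using N_triangle[OF V_diff[OF TV f] f, of "h k"] h(1) by simp
  qed
  define B where "B = Max ((\<lambda>k. N (T (h k) f)) ` {..k0}) + (1 + N f)"
  have "N (T (h k) f) \<le> B" for k
  proof (cases "k \<le> k0")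
    case True
    then have "N (T (h k) f) \<le> Max ((\<lambda>k. N (T (h k) f)) ` {..k0})" by auto
    then show ?thesis using N_nonneg[OF f] by (simp add: B_def)
  next
    case False
    have "0 \<le> N (T (h 0) f)" using TV h(1) N_nonneg by blast
    also have "\<dots> \<le> Max ((\<lambda>k. N (T (h k) f)) ` {..k0})" by auto
    finally show ?thesis using small[of k] False by (simp add: B_def)
  qed
  then show False using unb[of B] by (meson not_le)
qed

text \<open>The defect \<open>D t = T t e - exp (l * t) *\<^sub>R e\<close> obeys a cocycle identity
  and is \<open>o(t)\<close> at \<open>0\<close>. Splitting a time \<open>h\<close> into
  \<open>m\<close> steps bounds \<open>D h\<close> by a constant times \<open>m\<close> times the
  defect at \<open>h / m\<close>, which tends to \<open>0\<close>. The constant involves a common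
  bound for \<open>T\<close> on the times used, so this is done on \<open>[0, \<delta>]\<close> and
  then extended by the cocycle identity.\<close>

lemma semigroup_eigenvector:
  assumes T: "C0_semigroup_on V N T" and e: "e \<in> V"
    and gen: "((\<lambda>t. N ((1 / t) *\<^sub>R (T t e - e) - l *\<^sub>R e)) \<longlongrightarrow> 0) (at_right 0)"
    and t: "t \<ge> 0"
  shows "N (T t e - exp (l * t) *\<^sub>R e) = 0"
proof -
  have bounded: "bounded_operator_on V N (T t)" if "t \<ge> 0" for t
    using T that by (simp add: C0_semigroup_on_def)
  have T_add: "T t (f + g) = T t f + T t g" and T_scale: "T t (c *\<^sub>R f) = c *\<^sub>R T t f"
    and TV: "T t f \<in> V"
    if "t \<ge> 0" "f \<in> V" "g \<in> V" for t f g c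
    using bounded[OF that(1)] that by (auto simp: bounded_operator_on_def)
  have T_diff: "T t (f - c *\<^sub>R g) = T t f - c *\<^sub>R T t g" if "t \<ge> 0" "f \<in> V" "g \<in> V" for t f g c
    using T_add[OF that(1,2) V_scale[OF that(3)], of "- c"] T_scale[OF that(1,3,3), of "- c"] by simp
  have T_plus: "T (s + t) f = T s (T t f)" if "s \<ge> 0" "t \<ge> 0" "f \<in> V" for s t f
    using T that by (simp add: C0_semigroup_on_def)
  have T_0: "T 0 f = f" if "f \<in> V" for f
    using T that by (simp add: C0_semigroup_on_def)
  obtain M \<delta> where M: "M \<ge> 1" "\<delta> > 0" "\<And>h f. 0 \<le> h \<Longrightarrow> h \<le> \<delta> \<Longrightarrow> f \<in> V \<Longrightarrow> N (T h f) \<le> M * N f"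
    using C0_semigroup_locally_bounded[OF T] by metis
  define D where "D t = T t e - exp (l * t) *\<^sub>R e" for t
  have D_0: "N (D 0) = 0" using T_0[OF e] V_0 C_0 by (simp add: D_def N_eq)
  have DV: "D t \<in> V" if "t \<ge> 0" for t
    using TV[OF that e e] V_scale[OF e] V_diff by (simp add: D_def)
  have rec: "D (s + h) = T s (D h) + exp (l * h) *\<^sub>R D s" if "s \<ge> 0" "h \<ge> 0" for s h
  proof -
    have "T s (D h) = T (s + h) e - exp (l * h) *\<^sub>R T s e"
      unfolding D_def using T_diff[OF that(1) TV[OF that(2) e e] e] T_plus[OF that e] by simp
    then show ?thesis
      by (simp add: D_def scaleR_diff_right distrib_left exp_add mult.commute)
  qed
  \<comment> \<open>\<open>D h / h\<close> is the error of the generator quotient minus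
    \<open>e\<close> times the error of the difference quotient of \<open>exp\<close>; both vanish
    in the limit.\<close>
  have D_lim: "((\<lambda>h. N (D h) / h) \<longlongrightarrow> 0) (at_right 0)"
  proof (rule Lim_null_comparison)
    have exp_lim: "((\<lambda>h. (exp (l * h) - 1) / h) \<longlongrightarrow> l) (at_right 0)"
    proof -
      have "((\<lambda>h. exp (l * h)) has_real_derivative l) (at 0)"
        by (auto intro!: derivative_eq_intros)
      then have "((\<lambda>h. (exp (l * h) - 1) / h) \<longlongrightarrow> l) (at 0)"
        by (simp add: DERIV_def)
      then show ?thesis by (rule tendsto_within_subset) simp
    qed
    let ?bound = "\<lambda>h. N ((1 / h) *\<^sub>R (T h e - e) - l *\<^sub>R e) + \<bar>(exp (l * h) - 1) / h - l\<bar> * N e"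
    have "(?bound \<longlongrightarrow> 0 + \<bar>l - l\<bar> * N e) (at_right 0)"
      by (intro tendsto_intros gen exp_lim)
    then show "(?bound \<longlongrightarrow> 0) (at_right 0)" by simp
    show "eventually (\<lambda>h. norm (N (D h) / h) \<le> ?bound h) (at_right 0)"
      unfolding eventually_at_right_field
    proof (intro exI[of _ 1] conjI allI impI)
      fix h :: real assume h: "0 < h"
      let ?u = "(1 / h) *\<^sub>R (T h e - e) - l *\<^sub>R e" and ?c = "(exp (l * h) - 1) / h - l"
      have V: "?u \<in> V" "?c *\<^sub>R e \<in> V"
        using TV[of h e e] h e V_diff V_scale by auto
      have "(1 / h) *\<^sub>R D h = ?u - ?c *\<^sub>R e"
        using h by (simp add: D_def algebra_simps diff_divide_distrib)
      then have "N (D h) / h = N (?u - ?c *\<^sub>R e)"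
        using N_scale[OF DV, of h "1 / h"] h by simp
      also have "\<dots> \<le> N ?u + N (?c *\<^sub>R e)"
        by (rule N_triangle_diff[OF V])
      finally show "norm (N (D h) / h) \<le> N ?u + \<bar>?c\<bar> * N e"
        using h N_nonneg[OF DV, of h] N_scale[OF e] by simp
    qed simp
  qed
  have small: "N (D h) = 0" if h: "0 < h" "h \<le> \<delta>" for h
  proof -
    \<comment> \<open>Chosen so that \<open>m\<close> steps of length \<open>s = h / m\<close> give
      \<open>N (D h) <= K * (N (D s) / s)\<close>: the factor \<open>h\<close> in \<open>K\<close>
      is \<open>m * s\<close>.\<close>
    define K where "K = exp (\<bar>l\<bar> * h) * M * h"
    have K: "K > 0" using h M by (simp add: K_def)
    have bound: "N (D (real j * s)) \<le> real j * (exp (\<bar>l\<bar> * (real j * s)) * M * N (D s))"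
      if s: "s > 0" and j: "real j * s \<le> h" for j s
      using j
    proof (induction j)
      case 0
      then show ?case using D_0 by simp
    next
      case (Suc j)
      have js: "0 \<le> real j * s" "real j * s \<le> h" using Suc.prems s by (auto simp: algebra_simps)
      have "N (D (real (Suc j) * s)) = N (T (real j * s) (D s) + exp (l * s) *\<^sub>R D (real j * s))"
        using rec[OF js(1), of s] s by (simp add: algebra_simps)
      also have "\<dots> \<le> N (T (real j * s) (D s)) + exp (l * s) * N (D (real j * s))"
        using N_triangle[OF TV[OF js(1) DV DV] V_scale[OF DV[OF js(1)]], of s s "exp (l * s)"] s
        by (simp add: N_scale[OF DV[OF js(1)]])
      also have "N (T (real j * s) (D s)) \<le> M * N (D s)"
        using js h s by (intro M(3) DV) auto
      also have "M * N (D s) \<le> exp (\<bar>l\<bar> * (real (Suc j) * s)) * (M * N (D s))"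
        using s M(1) N_nonneg[OF DV, of s] mult_right_mono[of 1 "exp (\<bar>l\<bar> * (real (Suc j) * s))" "M * N (D s)"]
        by (simp del: of_nat_Suc)
      also have "exp (l * s) * N (D (real j * s)) \<le>
          exp (\<bar>l\<bar> * s) * (real j * (exp (\<bar>l\<bar> * (real j * s)) * M * N (D s)))"
        using s Suc.IH[OF js(2)] N_nonneg[OF DV[OF js(1)]] mult_right_mono[of l "\<bar>l\<bar>" s]
        by (intro mult_mono) auto
      also have "exp (\<bar>l\<bar> * s) * (real j * (exp (\<bar>l\<bar> * (real j * s)) * M * N (D s))) =
          real j * (exp (\<bar>l\<bar> * (real (Suc j) * s)) * (M * N (D s)))"
        by (simp add: algebra_simps exp_add)
      finally show ?case by (simp add: algebra_simps)
    qed
    show ?thesis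
    proof (rule ccontr)
      assume "N (D h) \<noteq> 0"
      then have pos: "N (D h) > 0" using N_nonneg[OF DV, of h] h by simp
      have "eventually (\<lambda>s. N (D s) / s < N (D h) / K) (at_right 0)"
        using D_lim pos K by (intro order_tendstoD) auto
      then obtain d where d: "d > 0" "\<And>s. 0 < s \<Longrightarrow> s < d \<Longrightarrow> N (D s) / s < N (D h) / K"
        unfolding eventually_at_right_field by blast
      obtain m where "h / d < real m" using reals_Archimedean2 by blast
      moreover have "0 < h / d" using h d by simp
      ultimately have "m > 0" by (auto intro: gr0I)
      with \<open>h / d < real m\<close> have m: "m > 0" "h / real m < d"
        using d(1) by (auto simp: pos_divide_less_eq mult.commute)
      define s where "s = h / real m"
      have s: "s > 0" "s < d" "real m * s = h" using m h by (auto simp: s_def)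
      have "N (D h) \<le> real m * (exp (\<bar>l\<bar> * h) * M * N (D s))"
        using bound[OF s(1), of m] s(3) by simp
      also have "\<dots> = K * (N (D s) / s)"
        using m h by (simp add: K_def s_def)
      also have "\<dots> < K * (N (D h) / K)"
        using d(2)[OF s(1,2)] K by (rule mult_strict_left_mono)
      finally show False using K by simp
    qed
  qed
  obtain m where m: "t / \<delta> < real m" using reals_Archimedean2 by blast
  moreover have "0 \<le> t / \<delta>" using t M by simp
  ultimately have "m > 0" by (auto intro: gr0I)
  define h where "h = t / real m"
  have h: "0 \<le> h" "h \<le> \<delta>" "real m * h = t"
    using m M(2) t \<open>m > 0\<close> by (auto simp: h_def field_simps)
  have Dh: "N (D h) = 0"
  proof (cases "h = 0")
    case True
    then show ?thesis using D_0 by simp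
  qed (use small h in auto)
  \<comment> \<open>Beyond \<open>\<delta>\<close> the individual bound of each operator suffices:
    since \<open>N (D h) = 0\<close>, it makes the seminorm of \<open>T (real j * h) (D h)\<close>
    vanish.\<close>
  have "N (D (real j * h)) = 0" for j
  proof (induction j)
    case 0
    then show ?case using D_0 by simp
  next
    case (Suc j)
    have jh: "0 \<le> real j * h" using h by simp
    obtain K where K: "\<And>f. f \<in> V \<Longrightarrow> N (T (real j * h) f) \<le> K * N f"
      using bounded[OF jh] unfolding bounded_operator_on_def by blast
    have "N (D (real (Suc j) * h)) = N (T (real j * h) (D h) + exp (l * h) *\<^sub>R D (real j * h))"
      using rec[OF jh h(1)] by (simp add: algebra_simps)
    also have "\<dots> \<le> N (T (real j * h) (D h)) + exp (l * h) * N (D (real j * h))"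
      using N_triangle[OF TV[OF jh DV DV] V_scale[OF DV[OF jh]], of h h "exp (l * h)"] h
      by (simp add: N_scale[OF DV[OF jh]])
    also have "\<dots> \<le> 0" using K[OF DV[OF h(1)]] Suc Dh by simp
    finally show ?case using N_nonneg[OF DV, of "real (Suc j) * h"] h by simp
  qed
  from this[of m] show ?thesis by (simp add: h(3) D_def)
qed

text \<open>Each \<open>T t (e n)\<close> is known up to seminorm \<open>0\<close>, hence its
  coefficients are known exactly. Finite combinations of the \<open>e n\<close> are dense for
  \<open>N\<close> and \<open>T t\<close> is continuous, so \<open>T t\<close> is diagonal on the
  coefficients of every vector, with entries \<open>exp (l n * t)\<close> that tend to
  \<open>0\<close> for \<open>t > 0\<close>.\<close>

theorem diagonal_semigroup_compact:
  assumes T: "C0_semigroup_on V N T"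
    and e: "\<And>n. e n \<in> V" "\<And>n m. C (e n) m = (if m = n then s n else 0)" "\<And>n. s n \<noteq> 0"
    and gen: "\<And>n. ((\<lambda>t. N ((1 / t) *\<^sub>R (T t (e n) - e n) - l n *\<^sub>R e n)) \<longlongrightarrow> 0) (at_right 0)"
    and l: "filterlim l at_bot sequentially"
    and t: "t > 0"
  shows "compact_operator_on V N (T t)"
proof -
  have bounded: "bounded_operator_on V N (T t)"
    using T t by (simp add: C0_semigroup_on_def)
  obtain K where K: "\<And>f. f \<in> V \<Longrightarrow> N (T t f) \<le> K * N f"
    using bounded unfolding bounded_operator_on_def by blast
  have T_add: "T t (f + g) = T t f + T t g" and T_scale: "T t (c *\<^sub>R f) = c *\<^sub>R T t f"
    and TV: "T t f \<in> V"
    if "f \<in> V" "g \<in> V" for f g c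
    using bounded that by (auto simp: bounded_operator_on_def)
  have T_e: "C (T t (e n)) m = exp (l n * t) * C (e n) m" for n m
  proof -
    have V: "T t (e n) \<in> V" "exp (l n * t) *\<^sub>R e n \<in> V" using TV e(1) V_scale by auto
    have "N (T t (e n) - exp (l n * t) *\<^sub>R e n) = 0"
      using semigroup_eigenvector[OF T e(1) gen] t by simp
    then show ?thesis
      using N_eq_0_iff[OF V_diff[OF V]] C_diff[OF V] C_scale[OF e(1)] by simp
  qed
  have diag: "C (T t f) m = exp (l m * t) * C f m" if f: "f \<in> V" for f m
  proof -
    \<comment> \<open>Truncation of \<open>f\<close> to its first \<open>k\<close> coefficients; the
      division compensates that \<open>e n\<close> has coefficient \<open>s n\<close> at
      \<open>n\<close>.\<close>
    define u where "u k = (\<Sum>n<k. (C f n / s n) *\<^sub>R e n)" for k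
    have uV: "u k \<in> V" for k
      unfolding u_def by (intro subspace_sum[OF subspace_V] V_scale e(1))
    have Cu: "C (u k) j = (if j < k then C f j else 0)" for k j
    proof -
      have "C (u k) j = (\<Sum>n<k. (C f n / s n) * C (e n) j)"
        unfolding u_def
      proof (induction k)
        case (Suc k)
        have "(\<Sum>n<k. (C f n / s n) *\<^sub>R e n) \<in> V" using uV[of k] by (simp add: u_def)
        then show ?case using Suc C_add V_scale[OF e(1)] C_scale[OF e(1)] by simp
      qed (simp add: C_0)
      also have "\<dots> = (\<Sum>n<k. if n = j then C f j else 0)"
        by (intro sum.cong) (auto simp: e(2,3))
      finally show ?thesis by simp
    qed
    have Tu: "C (T t (u k)) m = exp (l m * t) * C (u k) m" for k
      unfolding u_def
    proof (induction k)
      case 0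
      have "T t 0 = 0" using T_scale[OF V_0 V_0, of 0] by simp
      then show ?case by (simp add: C_0)
    next
      case (Suc k)
      have V: "(\<Sum>n<k. (C f n / s n) *\<^sub>R e n) \<in> V" using uV[of k] by (simp add: u_def)
      have W: "(C f k / s k) *\<^sub>R e k \<in> V" by (rule V_scale[OF e(1)])
      have "C (T t ((C f k / s k) *\<^sub>R e k)) m = exp (l m * t) * C ((C f k / s k) *\<^sub>R e k) m"
        unfolding T_scale[OF e(1) e(1)] C_scale[OF TV[OF e(1) e(1)]] C_scale[OF e(1)] T_e e(2) by simp
      then show ?case
        using Suc by (simp add: C_add[OF V W] T_add[OF V W] C_add[OF TV[OF V V] TV[OF W W]] distrib_left)
    qed
    have Nu: "(\<lambda>k. N (f - u k)) \<longlonglongrightarrow> 0"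
    proof -
      have "N (f - u k) = sqrt ((\<Sum>n. (C f n)\<^sup>2) - (\<Sum>n<k. (C f n)\<^sup>2))" for k
      proof -
        have "(\<Sum>n. (C (f - u k) n)\<^sup>2) = (\<Sum>n. (C (f - u k) (n + k))\<^sup>2) + (\<Sum>n<k. (C (f - u k) n)\<^sup>2)"
          using suminf_split_initial_segment[OF C_summable[OF V_diff[OF f uV]]] .
        also have "(\<Sum>n. (C (f - u k) (n + k))\<^sup>2) = (\<Sum>n. (C f (n + k))\<^sup>2)"
          by (simp add: C_diff[OF f uV] Cu)
        also have "\<dots> = (\<Sum>n. (C f n)\<^sup>2) - (\<Sum>n<k. (C f n)\<^sup>2)"
          using suminf_split_initial_segment[OF C_summable[OF f], of k] by simp
        also have "(\<Sum>n<k. (C (f - u k) n)\<^sup>2) = 0"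
          by (simp add: C_diff[OF f uV] Cu)
        finally show ?thesis by (simp add: N_eq[OF V_diff[OF f uV]])
      qed
      moreover have "(\<lambda>k. sqrt ((\<Sum>n. (C f n)\<^sup>2) - (\<Sum>n<k. (C f n)\<^sup>2)))
          \<longlonglongrightarrow> sqrt ((\<Sum>n. (C f n)\<^sup>2) - (\<Sum>n. (C f n)\<^sup>2))"
        by (intro tendsto_intros summable_LIMSEQ C_summable f)
      ultimately show ?thesis by simp
    qed
    have "(\<lambda>k. C (T t f) m - C (T t (u k)) m) \<longlonglongrightarrow> 0"
    proof (rule Lim_null_comparison)
      show "(\<lambda>k. K * N (f - u k)) \<longlonglongrightarrow> 0" using tendsto_mult_left[OF Nu, of K] by simp
      have "norm (C (T t f) m - C (T t (u k)) m) \<le> K * N (f - u k)" for k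
      proof -
        have V: "f - u k \<in> V" by (rule V_diff[OF f uV])
        have "T t (f - u k) = T t f - T t (u k)"
          using T_add[OF V uV, of k] by simp
        then have "C (T t f) m - C (T t (u k)) m = C (T t (f - u k)) m"
          by (simp add: C_diff TV[OF f f] TV[OF uV uV])
        then show ?thesis
          using C_le_N[OF TV[OF V V], of m] K[OF V] by simp
      qed
      then show "\<forall>\<^sub>F k in sequentially. norm (C (T t f) m - C (T t (u k)) m) \<le> K * N (f - u k)"
        by simp
    qed
    \<comment> \<open>For \<open>k > m\<close> the truncation no longer changes coefficient
      \<open>m\<close>, so the null sequence is eventually equal to the constant that is to be shown
      \<open>0\<close>.\<close>
    moreover have "eventually (\<lambda>k. C (T t f) m - C (T t (u k)) m = C (T t f) m - exp (l m * t) * C f m) sequentially"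
      unfolding eventually_sequentially by (intro exI[of _ "Suc m"]) (auto simp: Tu Cu)
    ultimately have "(\<lambda>k::nat. C (T t f) m - exp (l m * t) * C f m) \<longlonglongrightarrow> 0"
      by (rule Lim_transform_eventually)
    then show ?thesis by (simp add: LIMSEQ_const_iff)
  qed
  have TV': "T t f \<in> V" if "f \<in> V" for f using TV[OF that that] .
  have d_lim: "(\<lambda>n. exp (l n * t)) \<longlonglongrightarrow> 0"
  proof -
    have "filterlim (\<lambda>n. t * l n) at_bot sequentially"
      using filterlim_tendsto_pos_mult_at_bot[OF tendsto_const t l] .
    then have "filterlim (\<lambda>n. l n * t) at_bot sequentially" by (simp only: mult.commute)
    then show ?thesis
      using filterlim_compose[OF exp_at_bot, of "\<lambda>n. l n * t"] by blast
  qed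
  show ?thesis
    unfolding compact_operator_on_def
  proof (intro conjI allI impI)
    fix B assume "B \<subseteq> V" "\<exists>M. \<forall>f\<in>B. N f \<le> M"
    then obtain M where B: "B \<subseteq> V" "\<And>f. f \<in> B \<Longrightarrow> N f \<le> M" by blast
    show "compactin (topo) (topo closure_of (T t ` B))"
    proof (rule compactin_closure_diagonal_image[of "\<lambda>n. exp (l n * t)" "T t" B M])
      show "exp (l n * t) > 0" for n by simp
      show "C (T t f) n = exp (l n * t) * C f n" if "f \<in> V" for f n using that by (rule diag)
      show "(\<lambda>n. exp (l n * t)) \<longlonglongrightarrow> 0" by (rule d_lim)
      show "T t f \<in> V" if "f \<in> V" for f using that by (rule TV')
      show "B \<subseteq> V" by (rule B(1))
      show "N f \<le> M" if "f \<in> B" for f using that by (rule B(2))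
    qed
  qed (rule bounded)
qed

end

subsection \<open>Fractional powers in a Hilbert space\<close>

text \<open>Carrier and inner product are parameters because \<open>X\<close> is a subset of the one
  vector space of all classes and its inner product varies with the weight. Completeness is stated
  for squared norms, which keeps square roots out of the expansions.\<close>

locale hilbert_subspace =
  fixes X :: "'v::real_vector set" and ip :: "'v \<Rightarrow> 'v \<Rightarrow> real"
  assumes subspace_X: "subspace X"
    and ip_commute: "f \<in> X \<Longrightarrow> g \<in> X \<Longrightarrow> ip f g = ip g f"
    and ip_add_left: "f \<in> X \<Longrightarrow> g \<in> X \<Longrightarrow> h \<in> X \<Longrightarrow> ip (f + g) h = ip f h + ip g h"
    and ip_scale_left: "f \<in> X \<Longrightarrow> g \<in> X \<Longrightarrow> ip (c *\<^sub>R f) g = c * ip f g"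
    and ip_nonneg: "f \<in> X \<Longrightarrow> 0 \<le> ip f f"
    and ip_eq_0D: "f \<in> X \<Longrightarrow> ip f f = 0 \<Longrightarrow> f = 0"
    and complete: "(\<And>k. x k \<in> X) \<Longrightarrow>
      (\<And>e. e > 0 \<Longrightarrow> \<exists>k0. \<forall>k\<ge>k0. \<forall>l\<ge>k0. ip (x k - x l) (x k - x l) \<le> e) \<Longrightarrow>
      \<exists>g\<in>X. (\<lambda>k. ip (x k - g) (x k - g)) \<longlonglongrightarrow> 0"
begin

abbreviation sqnorm :: "'v \<Rightarrow> real" where "sqnorm f \<equiv> ip f f"

lemma X_add: "f \<in> X \<Longrightarrow> g \<in> X \<Longrightarrow> f + g \<in> X"
  and X_diff: "f \<in> X \<Longrightarrow> g \<in> X \<Longrightarrow> f - g \<in> X"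
  and X_scale: "f \<in> X \<Longrightarrow> c *\<^sub>R f \<in> X"
  and X_0: "0 \<in> X"
  using subspace_X by (auto simp: subspace_add subspace_diff subspace_scale subspace_0)

lemma ip_add_right: "f \<in> X \<Longrightarrow> g \<in> X \<Longrightarrow> h \<in> X \<Longrightarrow> ip h (f + g) = ip h f + ip h g"
  by (simp add: ip_commute[of h] ip_add_left X_add)

lemma ip_scale_right: "f \<in> X \<Longrightarrow> g \<in> X \<Longrightarrow> ip g (c *\<^sub>R f) = c * ip g f"
  by (simp add: ip_commute[of g] ip_scale_left X_scale)

lemma ip_diff_left: "f \<in> X \<Longrightarrow> g \<in> X \<Longrightarrow> h \<in> X \<Longrightarrow> ip (f - g) h = ip f h - ip g h"
  using ip_add_left[of f "(-1) *\<^sub>R g" h] ip_scale_left[of g h "-1"] X_scale[of g "-1"] by simp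

lemma ip_diff_right: "f \<in> X \<Longrightarrow> g \<in> X \<Longrightarrow> h \<in> X \<Longrightarrow> ip h (f - g) = ip h f - ip h g"
  by (simp add: ip_commute[of h] ip_diff_left X_diff)

lemma ip_0: "f \<in> X \<Longrightarrow> ip 0 f = 0"
  using ip_scale_left[of f f 0] by simp

lemma ip_sum_left:
  "finite I \<Longrightarrow> (\<And>i. i \<in> I \<Longrightarrow> x i \<in> X) \<Longrightarrow> h \<in> X \<Longrightarrow> ip (\<Sum>i\<in>I. x i) h = (\<Sum>i\<in>I. ip (x i) h)"
  by (induction I rule: finite_induct) (simp_all add: ip_0 ip_add_left subspace_sum[OF subspace_X])

text \<open>From \<open>sqnorm (a + b) >= 0\<close> follows
  \<open>sqnorm (a - b) <= 2 * sqnorm a + 2 * sqnorm b\<close>. Uniqueness makes the definite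
  description in \<open>frac_power\<close> well defined.\<close>

lemma limit_unique:
  assumes x: "\<And>k. x k \<in> X" and gh: "g \<in> X" "h \<in> X"
    and lim: "(\<lambda>k::nat. sqnorm (x k - g)) \<longlonglongrightarrow> 0" "(\<lambda>k. sqnorm (x k - h)) \<longlonglongrightarrow> 0"
  shows "g = h"
proof -
  have le: "sqnorm (g - h) \<le> 2 * sqnorm (x k - g) + 2 * sqnorm (x k - h)" for k
  proof -
    define a b where "a = x k - h" and "b = x k - g"
    have V: "a \<in> X" "b \<in> X" using x gh X_diff by (auto simp: a_def b_def)
    have "g - h = a - b" by (simp add: a_def b_def)
    then have "sqnorm (g - h) = ip a a - 2 * ip a b + ip b b"
      using V by (simp add: ip_diff_left ip_diff_right X_diff ip_commute[of b a])
    moreover have "0 \<le> sqnorm (a + b)" by (intro ip_nonneg X_add V)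
    moreover have "sqnorm (a + b) = ip a a + 2 * ip a b + ip b b"
      using V by (simp add: ip_add_left ip_add_right X_add ip_commute[of b a])
    ultimately show ?thesis by (simp add: a_def b_def)
  qed
  have "(\<lambda>k. 2 * sqnorm (x k - g) + 2 * sqnorm (x k - h)) \<longlonglongrightarrow> 2 * 0 + 2 * 0"
    by (intro tendsto_intros lim)
  then have "sqnorm (g - h) \<le> 2 * 0 + 2 * 0"
    using le by (intro LIMSEQ_le_const) auto
  then have "sqnorm (g - h) = 0"
    using ip_nonneg[OF X_diff[OF gh]] by simp
  then show ?thesis using ip_eq_0D[OF X_diff[OF gh]] by simp
qed

end

section \<open>Expansions along an orthonormal sequence\<close>

locale orthonormal_sequence = hilbert_subspace X ip
  for X :: "'v::real_vector set" and ip :: "'v \<Rightarrow> 'v \<Rightarrow> real" +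
  fixes phi :: "nat \<Rightarrow> 'v"
  assumes phi_X: "phi n \<in> X" and orthonormal: "ip (phi m) (phi n) = (if m = n then 1 else 0)"
begin

definition partial :: "(nat \<Rightarrow> real) \<Rightarrow> nat \<Rightarrow> 'v" where
  "partial x k = (\<Sum>n<k. x n *\<^sub>R phi n)"

lemma partial_X: "partial x k \<in> X"
  unfolding partial_def by (intro subspace_sum[OF subspace_X] X_scale phi_X)

lemma ip_partial_left: "h \<in> X \<Longrightarrow> ip (partial x k) h = (\<Sum>n<k. x n * ip (phi n) h)"
  unfolding partial_def by (subst ip_sum_left) (auto simp: X_scale phi_X ip_scale_left)

lemma ip_partial_phi: "ip (partial x k) (phi m) = (if m < k then x m else 0)"
  by (simp add: ip_partial_left phi_X orthonormal if_distrib[of "\<lambda>y. _ * y"] cong: if_cong)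

text \<open>Completing the square in each coefficient. Taking \<open>x n = ip g (phi n)\<close>
  yields Bessel's inequality, taking for \<open>g\<close> another partial sum yields the Cauchy
  property, and taking for \<open>g\<close> the limit yields Parseval's identity for it.\<close>

lemma norm_diff_partial:
  assumes "g \<in> X"
  shows "sqnorm (partial x k - g) =
    ip g g - (\<Sum>n<k. (ip g (phi n))\<^sup>2) + (\<Sum>n<k. (x n - ip g (phi n))\<^sup>2)"
proof -
  have "sqnorm (partial x k) = (\<Sum>n<k. (x n)\<^sup>2)"
    by (simp add: ip_partial_left partial_X ip_commute[of "phi _"] phi_X ip_partial_phi power2_eq_square)
  moreover have "ip (partial x k) g = (\<Sum>n<k. x n * ip g (phi n))"
    using assms by (simp add: ip_partial_left ip_commute[of "phi _"] phi_X)
  ultimately have "sqnorm (partial x k - g) =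
      (\<Sum>n<k. (x n)\<^sup>2) - 2 * (\<Sum>n<k. x n * ip g (phi n)) + ip g g"
    using assms by (simp add: ip_diff_left ip_diff_right X_diff partial_X ip_commute[of g "partial x k"])
  then show ?thesis
    by (simp add: power2_diff sum.distrib sum_subtractf sum_distrib_left algebra_simps)
qed

lemma coefficient_le: "g \<in> X \<Longrightarrow> (ip g (phi m))\<^sup>2 \<le> ip g g"
proof -
  assume g: "g \<in> X"
  have "(ip g (phi m))\<^sup>2 \<le> (\<Sum>n<Suc m. (ip g (phi n))\<^sup>2)"
    by (rule member_le_sum) auto
  also have "\<dots> \<le> ip g g"
    using norm_diff_partial[OF g, of "\<lambda>n. ip g (phi n)" "Suc m"]
      ip_nonneg[OF X_diff[OF partial_X g], of "\<lambda>n. ip g (phi n)" "Suc m"] by simp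
  finally show ?thesis .
qed

lemma riesz_fischer:
  assumes "summable (\<lambda>n. (x n)\<^sup>2)"
  shows "\<exists>g\<in>X. (\<lambda>k. sqnorm (partial x k - g)) \<longlonglongrightarrow> 0"
proof (rule complete[OF partial_X])
  fix e :: real assume "e > 0"
  have dist: "sqnorm (partial x k - partial x l) = (\<Sum>n=l..<k. (x n)\<^sup>2)" if "l \<le> k" for k l
  proof -
    have sub: "{..<l} \<subseteq> {..<k}" "{..<k} - {..<l} = {l..<k}" using that by auto
    have "(\<Sum>n<k. (x n - ip (partial x l) (phi n))\<^sup>2) = (\<Sum>n\<in>{..<k} - {..<l}. (x n)\<^sup>2)"
      by (rule sum.mono_neutral_cong_right) (auto simp: ip_partial_phi)
    moreover have "(\<Sum>n<k. (ip (partial x l) (phi n))\<^sup>2) = (\<Sum>n<l. (x n)\<^sup>2)"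
      using sub by (intro sum.mono_neutral_cong_right) (auto simp: ip_partial_phi)
    moreover have "sqnorm (partial x l) = (\<Sum>n<l. (x n)\<^sup>2)"
      by (simp add: ip_partial_left partial_X ip_commute[of "phi _"] phi_X ip_partial_phi power2_eq_square)
    ultimately show ?thesis
      using norm_diff_partial[OF partial_X, of x k x l] sub by simp
  qed
  obtain k0 where k0: "\<And>m n. m \<ge> k0 \<Longrightarrow> norm (\<Sum>i=m..<n. (x i)\<^sup>2) < e"
    using assms \<open>e > 0\<close> unfolding summable_Cauchy by blast
  have "sqnorm (partial x k - partial x l) \<le> e" if "k \<ge> k0" "l \<ge> k0" for k l
  proof (cases "l \<le> k")
    case True
    then show ?thesis using dist[OF True] k0[of l k] that by simp
  next
    case False
    have "partial x k - partial x l = (-1) *\<^sub>R (partial x l - partial x k)" by simp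
    then have "sqnorm (partial x k - partial x l) =
        sqnorm (partial x l - partial x k)"
      by (simp only: ip_scale_left ip_scale_right X_scale X_diff partial_X)
    then show ?thesis using dist[of k l] k0[of k l] that False by simp
  qed
  then show "\<exists>k0. \<forall>k\<ge>k0. \<forall>l\<ge>k0. sqnorm (partial x k - partial x l) \<le> e"
    by blast
qed

lemma limit_coefficients:
  assumes g: "g \<in> X" and lim: "(\<lambda>k. sqnorm (partial x k - g)) \<longlonglongrightarrow> 0"
  shows "ip g (phi m) = x m"
proof -
  have "(\<lambda>k. (ip (partial x k - g) (phi m))\<^sup>2) \<longlonglongrightarrow> 0"
    by (rule tendsto_sandwich[OF _ _ tendsto_const lim])
      (auto simp: coefficient_le X_diff partial_X g)
  moreover have "eventually (\<lambda>k. (ip (partial x k - g) (phi m))\<^sup>2 = (x m - ip g (phi m))\<^sup>2) sequentially"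
    unfolding eventually_sequentially
    by (intro exI[of _ "Suc m"]) (auto simp: ip_diff_left partial_X phi_X g ip_partial_phi)
  ultimately have "(\<lambda>k::nat. (x m - ip g (phi m))\<^sup>2) \<longlonglongrightarrow> 0"
    by (rule Lim_transform_eventually)
  then show ?thesis by (simp add: LIMSEQ_const_iff)
qed

text \<open>Parseval's identity holds because \<open>g\<close> is a limit of combinations of the
  \<open>phi n\<close>; for general elements of \<open>X\<close> only Bessel's inequality is
  available in this locale.\<close>

lemma limit_norm:
  assumes g: "g \<in> X" and lim: "(\<lambda>k. sqnorm (partial x k - g)) \<longlonglongrightarrow> 0"
  shows "(\<lambda>n. (x n)\<^sup>2) sums ip g g"
proof -
  have "(\<lambda>k. ip g g - (\<Sum>n<k. (x n)\<^sup>2)) \<longlonglongrightarrow> 0"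
    using lim by (simp add: norm_diff_partial[OF g] limit_coefficients[OF g lim])
  then have "(\<lambda>k. ip g g - (ip g g - (\<Sum>n<k. (x n)\<^sup>2))) \<longlonglongrightarrow> ip g g - 0"
    by (intro tendsto_intros)
  then show ?thesis by (simp add: sums_def)
qed

end

section \<open>Fractional powers as weighted expansions\<close>

locale spectral_sequence = orthonormal_sequence X ip phi
  for X :: "'v::real_vector set" and ip :: "'v \<Rightarrow> 'v \<Rightarrow> real" and phi :: "nat \<Rightarrow> 'v" +
  fixes lam :: "nat \<Rightarrow> real" and mu eps alpha :: real
  assumes eps_pos: "eps > 0" and gap: "mu - lam n \<ge> eps" and alpha_pos: "alpha > 0"
begin

abbreviation weight :: "nat \<Rightarrow> real" where "weight n \<equiv> (mu - lam n) powr alpha"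

abbreviation Xa :: "'v set" where "Xa \<equiv> frac_domain X ip lam phi mu alpha"

abbreviation ipa :: "'v \<Rightarrow> 'v \<Rightarrow> real" where "ipa \<equiv> frac_inner X ip lam phi mu alpha"

abbreviation fpow :: "'v \<Rightarrow> 'v" where "fpow \<equiv> frac_power X ip lam phi mu alpha"

definition wcoeff :: "'v \<Rightarrow> nat \<Rightarrow> real" where "wcoeff f n = weight n * ip f (phi n)"

text \<open>Here the distance \<open>eps\<close> of \<open>mu\<close> from the eigenvalues counts:
  with weights bounded below, division by them preserves square summability, which makes
  \<open>wcoeff\<close> surjective onto square summable sequences.\<close>

lemma weight_ge: "weight n \<ge> eps powr alpha"
  using gap eps_pos alpha_pos by (intro powr_mono2) auto

lemma weight_pos: "weight n > 0"
  using weight_ge[of n] eps_pos by (smt (verit) powr_gt_zero)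

lemma mem_Xa_iff: "f \<in> Xa \<longleftrightarrow> f \<in> X \<and> summable (\<lambda>n. (wcoeff f n)\<^sup>2)"
proof -
  have "(mu - lam n) powr (2 * alpha) = (weight n)\<^sup>2" for n
    by (simp add: power2_eq_square flip: powr_add)
  then show ?thesis by (simp add: frac_domain_def wcoeff_def power_mult_distrib)
qed

text \<open>\<open>frac_power\<close> is a definite description in terms of
  \<open>norm_of ip\<close>: the assumptions give existence and \<open>limit_unique\<close> gives
  uniqueness, after passing from norms to their squares.\<close>

lemma frac_power_eqI:
  assumes "g \<in> X" "(\<lambda>k. sqnorm (partial (wcoeff f) k - g)) \<longlonglongrightarrow> 0"
  shows "fpow f = g"
proof -
  have lim_iff: "(\<lambda>k. norm_of ip ((\<Sum>n<k. (weight n * ip f (phi n)) *\<^sub>R phi n) - h)) \<longlonglongrightarrow> 0 \<longleftrightarrow>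
      (\<lambda>k. sqnorm (partial (wcoeff f) k - h)) \<longlonglongrightarrow> 0" for h
  proof -
    have "norm_of ip ((\<Sum>n<k. (weight n * ip f (phi n)) *\<^sub>R phi n) - h) =
        sqrt (sqnorm (partial (wcoeff f) k - h))" for k
      by (simp add: norm_of_def partial_def wcoeff_def)
    moreover have "(\<lambda>k. sqrt (u k)) \<longlonglongrightarrow> 0 \<longleftrightarrow> u \<longlonglongrightarrow> 0" for u :: "nat \<Rightarrow> real"
      using tendsto_real_sqrt[of u 0 sequentially] tendsto_mult_zero[of "\<lambda>k. sqrt (u k)" sequentially "\<lambda>k. sqrt (u k)"]
      by (auto simp: tendsto_rabs_zero_iff)
    ultimately show ?thesis by simp
  qed
  show ?thesis
    unfolding frac_power_def lim_iff
  proof (rule the_equality)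
    show "h = g" if "h \<in> X \<and>
        (\<lambda>k. sqnorm (partial (wcoeff f) k - h)) \<longlonglongrightarrow> 0" for h
      by (rule limit_unique[of "partial (wcoeff f)"]) (use assms that partial_X in auto)
  qed (use assms in auto)
qed

lemma frac_power:
  assumes "f \<in> Xa"
  shows frac_power_X: "fpow f \<in> X"
    and frac_power_lim: "(\<lambda>k. sqnorm (partial (wcoeff f) k - fpow f)) \<longlonglongrightarrow> 0"
proof -
  obtain g where g: "g \<in> X" "(\<lambda>k. sqnorm (partial (wcoeff f) k - g)) \<longlonglongrightarrow> 0"
    using riesz_fischer[of "wcoeff f"] assms by (auto simp: mem_Xa_iff)
  then show "fpow f \<in> X"
    "(\<lambda>k. sqnorm (partial (wcoeff f) k - fpow f)) \<longlonglongrightarrow> 0"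
    using frac_power_eqI[OF g] by simp_all
qed

lemma wcoeff_add: "f \<in> X \<Longrightarrow> g \<in> X \<Longrightarrow> wcoeff (f + g) n = wcoeff f n + wcoeff g n"
  by (simp add: wcoeff_def ip_add_left phi_X distrib_left)

lemma wcoeff_scale: "f \<in> X \<Longrightarrow> wcoeff (c *\<^sub>R f) n = c * wcoeff f n"
  by (simp add: wcoeff_def ip_scale_left phi_X)

lemma wcoeff_phi: "wcoeff (phi n) m = (if m = n then weight n else 0)"
  by (simp add: wcoeff_def orthonormal)

lemma summable_finite_coeff: "summable (\<lambda>m. (wcoeff (phi n) m)\<^sup>2)"
  by (rule summable_finite[of "{n}"]) (auto simp: wcoeff_phi)

lemma subspace_Xa: "subspace Xa"
proof (rule subspaceI)
  show "0 \<in> Xa"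
    by (simp add: mem_Xa_iff X_0 wcoeff_def ip_0 phi_X)
  show "f + g \<in> Xa" if "f \<in> Xa" "g \<in> Xa" for f g
  proof -
    have fg: "f \<in> X" "g \<in> X" using that by (auto simp: mem_Xa_iff)
    have "summable (\<lambda>n. 2 * (wcoeff f n)\<^sup>2 + 2 * (wcoeff g n)\<^sup>2)"
      using that by (intro summable_add summable_mult) (auto simp: mem_Xa_iff)
    moreover have "norm ((wcoeff (f + g) n)\<^sup>2) \<le> 2 * (wcoeff f n)\<^sup>2 + 2 * (wcoeff g n)\<^sup>2" for n
    proof -
      have "(wcoeff f n + wcoeff g n)\<^sup>2 \<le> 2 * (wcoeff f n)\<^sup>2 + 2 * (wcoeff g n)\<^sup>2"
        using sum_squares_bound[of "wcoeff f n" "wcoeff g n"] by (simp add: power2_sum)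
      then show ?thesis by (simp only: wcoeff_add[OF fg] real_norm_def abs_power2)
    qed
    ultimately have "summable (\<lambda>n. (wcoeff (f + g) n)\<^sup>2)"
      by (rule summable_comparison_test'[where N=0])
    then show ?thesis using fg by (simp add: mem_Xa_iff X_add)
  qed
  show "c *\<^sub>R f \<in> Xa" if "f \<in> Xa" for c f
    using that by (auto simp: mem_Xa_iff X_scale wcoeff_scale power_mult_distrib intro: summable_mult)
qed

lemma phi_Xa: "phi n \<in> Xa"
  by (simp add: mem_Xa_iff phi_X summable_finite_coeff)

lemma frac_power_scaled_phi: "fpow (c *\<^sub>R phi n) = (c * weight n) *\<^sub>R phi n"
proof -
  have "c *\<^sub>R phi n \<in> Xa" by (rule subspace_scale[OF subspace_Xa phi_Xa])
  have "fpow (c *\<^sub>R phi n) = (c * weight n) *\<^sub>R phi n"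
  proof (rule frac_power_eqI)
    show "(c * weight n) *\<^sub>R phi n \<in> X" by (intro X_scale phi_X)
    have "partial (wcoeff (c *\<^sub>R phi n)) k = (c * weight n) *\<^sub>R phi n" if "k > n" for k
    proof -
      have "partial (wcoeff (c *\<^sub>R phi n)) k = (\<Sum>m<k. if m = n then (c * weight n) *\<^sub>R phi n else 0)"
        unfolding partial_def by (intro sum.cong) (auto simp: wcoeff_scale phi_X wcoeff_phi)
      then show ?thesis using that by simp
    qed
    then show "(\<lambda>k. sqnorm (partial (wcoeff (c *\<^sub>R phi n)) k - (c * weight n) *\<^sub>R phi n)) \<longlonglongrightarrow> 0"
      by (intro tendsto_eventually) (auto simp: eventually_sequentially ip_0 X_0 intro!: exI[of _ "Suc n"])
  qed
  then show ?thesis .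
qed

text \<open>By orthogonality at most the term \<open>m = n\<close> of the series is nonzero.
  Membership is what allows the generator hypothesis to be evaluated at
  \<open>phi n\<close>.\<close>

lemma phi_in_generator_domain: "phi n \<in> frac_generator_domain X ip lam phi mu alpha"
proof -
  have "ipa (phi n) (c *\<^sub>R phi m) = 0" if "m \<noteq> n" for m c
    using frac_power_scaled_phi[of 1 n] that
    by (simp add: frac_inner_def frac_power_scaled_phi ip_scale_left ip_scale_right phi_X X_scale orthonormal)
  then have "summable (\<lambda>m. (lam m)\<^sup>2 *
      (ipa (phi n) ((mu - lam m) powr (- alpha) *\<^sub>R phi m))\<^sup>2)"
    by (intro summable_finite[of "{n}"]) auto
  then show ?thesis by (simp add: frac_generator_domain_def phi_Xa)
qed

text \<open>The weighted coefficients are the coefficients of \<open>fpow f\<close>, and Parseval's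
  identity for this limit gives the norm. A square summable \<open>x\<close> is realised by the
  Riesz-Fischer limit with coefficients \<open>x n / weight n\<close>.\<close>

sublocale pseudo_ell2 Xa wcoeff "norm_of ipa"
proof
  show "subspace Xa" by (rule subspace_Xa)
  show "wcoeff (f + g) n = wcoeff f n + wcoeff g n" if "f \<in> Xa" "g \<in> Xa" for f g n
    using that by (simp add: mem_Xa_iff wcoeff_add)
  show "wcoeff (c *\<^sub>R f) n = c * wcoeff f n" if "f \<in> Xa" for c f n
    using that by (simp add: mem_Xa_iff wcoeff_scale)
  show "summable (\<lambda>n. (wcoeff f n)\<^sup>2)" if "f \<in> Xa" for f
    using that by (simp add: mem_Xa_iff)
  show "norm_of ipa f = sqrt (\<Sum>n. (wcoeff f n)\<^sup>2)" if "f \<in> Xa" for f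
    using limit_norm[OF frac_power_X frac_power_lim, OF that that]
    by (simp add: norm_of_def frac_inner_def sums_iff)
  show "\<exists>f\<in>Xa. wcoeff f = x" if x: "summable (\<lambda>n. (x n)\<^sup>2)" for x
  proof -
    have "summable (\<lambda>n. (1 / eps powr alpha)\<^sup>2 * (x n)\<^sup>2)" by (rule summable_mult[OF x])
    moreover have "norm ((x n / weight n)\<^sup>2) \<le> (1 / eps powr alpha)\<^sup>2 * (x n)\<^sup>2" for n
    proof -
      have "1 / weight n \<le> 1 / eps powr alpha"
        using weight_ge[of n] eps_pos by (intro frac_le) auto
      then have "(1 / weight n)\<^sup>2 * (x n)\<^sup>2 \<le> (1 / eps powr alpha)\<^sup>2 * (x n)\<^sup>2"
        using weight_pos[of n] by (intro mult_right_mono power_mono) auto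
      then show ?thesis by (simp add: power_divide)
    qed
    ultimately have summ: "summable (\<lambda>n. (x n / weight n)\<^sup>2)"
      by (rule summable_comparison_test'[where N=0])
    obtain g where g: "g \<in> X"
      and lim: "(\<lambda>k. sqnorm (partial (\<lambda>n. x n / weight n) k - g)) \<longlonglongrightarrow> 0"
      using riesz_fischer[OF summ] by (elim bexE)
    have "wcoeff g = x"
    proof
      fix n
      show "wcoeff g n = x n" using weight_pos[of n] limit_coefficients[OF g lim, of n] by (simp add: wcoeff_def)
    qed
    then show ?thesis using g x by (intro bexI[of _ g]) (simp_all add: mem_Xa_iff)
  qed
qed

end

subsection \<open>The weighted \<open>L\<^sup>2\<close> space\<close>

text \<open>The limit is built pointwise from a subsequence whose increments have squared norm at
  most \<open>(1/8) ^ j\<close>: weighting by \<open>4 ^ j\<close> keeps the series of squared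
  increments integrable, so almost everywhere the increments are eventually below
  \<open>(1/2) ^ j\<close>. The subsequence is part of the conclusion so that vanishing outside an
  interval passes to the limit.\<close>

lemma L2_complete:
  fixes f :: "nat \<Rightarrow> 'a \<Rightarrow> real"
  assumes [measurable]: "\<And>k. f k \<in> borel_measurable M"
    and int: "\<And>k. integrable M (\<lambda>x. (f k x)\<^sup>2)"
    and Cauchy: "\<And>e. e > 0 \<Longrightarrow> \<exists>k0. \<forall>k\<ge>k0. \<forall>l\<ge>k0. (\<integral>x. (f k x - f l x)\<^sup>2 \<partial>M) \<le> e"
  shows "\<exists>g \<in> borel_measurable M. integrable M (\<lambda>x. (g x)\<^sup>2) \<and>
    (\<lambda>k. \<integral>x. (f k x - g x)\<^sup>2 \<partial>M) \<longlonglongrightarrow> 0 \<and> (\<exists>r. AE x in M. (\<lambda>j. f (r j) x) \<longlonglongrightarrow> g x)"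
proof -
  have int_diff: "integrable M (\<lambda>x. (u x - v x)\<^sup>2)"
    if "integrable M (\<lambda>x. (u x)\<^sup>2)" "integrable M (\<lambda>x. (v x)\<^sup>2)"
      and [measurable]: "u \<in> borel_measurable M" "v \<in> borel_measurable M" for u v :: "'a \<Rightarrow> real"
  proof (rule Bochner_Integration.integrable_bound)
    show "integrable M (\<lambda>x. 2 * (u x)\<^sup>2 + 2 * (v x)\<^sup>2)" using that by auto
    have "(u x - v x)\<^sup>2 \<le> 2 * (u x)\<^sup>2 + 2 * (v x)\<^sup>2" for x
      using sum_squares_bound[of "u x" "- v x"] by (simp add: power2_diff)
    then show "AE x in M. norm ((u x - v x)\<^sup>2) \<le> norm (2 * (u x)\<^sup>2 + 2 * (v x)\<^sup>2)" by simp
  qed measurable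
  have nn: "(\<integral>\<^sup>+x. ennreal ((f k x - f l x)\<^sup>2) \<partial>M) = ennreal (\<integral>x. (f k x - f l x)\<^sup>2 \<partial>M)" for k l
    by (rule nn_integral_eq_integral) (auto intro: int_diff int)
  have "\<exists>k0. \<forall>k\<ge>k0. \<forall>l\<ge>k0. (\<integral>x. (f k x - f l x)\<^sup>2 \<partial>M) \<le> (1/8) ^ j" for j :: nat
    by (rule Cauchy) simp
  then obtain K where K: "\<And>j k l. k \<ge> K j \<Longrightarrow> l \<ge> K j \<Longrightarrow> (\<integral>x. (f k x - f l x)\<^sup>2 \<partial>M) \<le> (1/8) ^ j"
    by metis
  \<comment> \<open>Summing the thresholds, each increased by one, makes \<open>r\<close> monotone
    and at least \<open>K j\<close> and \<open>j\<close> at once.\<close>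
  define r where "r j = (\<Sum>i\<le>j. K i + 1)" for j
  have r_ge: "K j \<le> r j" "r j \<le> r (Suc j)" "j \<le> r j" for j
  proof -
    show "K j \<le> r j" unfolding r_def using member_le_sum[of j "{..j}" "\<lambda>i. K i + 1"] by simp
    show "r j \<le> r (Suc j)" by (simp add: r_def)
    show "j \<le> r j" by (induction j) (simp_all add: r_def)
  qed
  define d where "d j x = f (r (Suc j)) x - f (r j) x" for j x
  have [measurable]: "d j \<in> borel_measurable M" for j unfolding d_def by measurable
  have d_le: "(\<integral>\<^sup>+x. ennreal (4 ^ j * (d j x)\<^sup>2) \<partial>M) \<le> ennreal ((1/2) ^ j)" for j
  proof -
    have "(\<integral>\<^sup>+x. ennreal (4 ^ j * (d j x)\<^sup>2) \<partial>M) = ennreal (4 ^ j) * (\<integral>\<^sup>+x. ennreal ((d j x)\<^sup>2) \<partial>M)"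
      by (simp add: ennreal_mult' nn_integral_cmult)
    also have "\<dots> \<le> ennreal (4 ^ j) * ennreal ((1/8) ^ j)"
      unfolding d_def nn using K[of j "r (Suc j)" "r j"] r_ge[of j]
      by (intro mult_left_mono ennreal_leI) auto
    also have "\<dots> = ennreal (4 ^ j * (1/8) ^ j)"
      by (rule ennreal_mult'[symmetric]) simp
    also have "4 ^ j * (1/8 :: real) ^ j = (1/2) ^ j"
      by (simp flip: power_mult_distrib)
    finally show ?thesis .
  qed
  have "(\<integral>\<^sup>+x. (\<Sum>j. ennreal (4 ^ j * (d j x)\<^sup>2)) \<partial>M) = (\<Sum>j. \<integral>\<^sup>+x. ennreal (4 ^ j * (d j x)\<^sup>2) \<partial>M)"
    by (rule nn_integral_suminf) measurable
  also have "\<dots> \<le> (\<Sum>j. ennreal ((1/2) ^ j))"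
    by (intro suminf_le d_le) auto
  also have "\<dots> = ennreal (\<Sum>j. (1/2) ^ j)"
    by (rule suminf_ennreal2) (auto intro: summable_geometric)
  finally have "(\<integral>\<^sup>+x. (\<Sum>j. ennreal (4 ^ j * (d j x)\<^sup>2)) \<partial>M) < \<infinity>"
    by (rule order.strict_trans1) simp
  then have "AE x in M. (\<Sum>j. ennreal (4 ^ j * (d j x)\<^sup>2)) \<noteq> \<infinity>"
    by (intro nn_integral_PInf_AE) auto
  then have conv: "AE x in M. convergent (\<lambda>j. f (r j) x)"
  proof eventually_elim
    case (elim x)
    then have "summable (\<lambda>j. 4 ^ j * (d j x)\<^sup>2)"
      by (intro summable_suminf_not_top) auto
    then have "(\<lambda>j. 4 ^ j * (d j x)\<^sup>2) \<longlonglongrightarrow> 0" by (rule summable_LIMSEQ_zero)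
    then have "eventually (\<lambda>j. 4 ^ j * (d j x)\<^sup>2 < 1) sequentially"
      by (rule order_tendstoD) simp
    then obtain j0 where j0: "\<And>j. j \<ge> j0 \<Longrightarrow> 4 ^ j * (d j x)\<^sup>2 < 1"
      unfolding eventually_sequentially by blast
    have "summable (\<lambda>j. d j x)"
    proof (rule summable_comparison_test'[where N=j0])
      show "summable (\<lambda>j. (1/2 :: real) ^ j)" by (rule summable_geometric) simp
      fix j assume "j \<ge> j0"
      have "(2 ^ j * d j x)\<^sup>2 = 4 ^ j * (d j x)\<^sup>2"
        by (simp add: power_mult_distrib power2_eq_square flip: power_mult_distrib)
      then have "(2 ^ j * d j x)\<^sup>2 < 1\<^sup>2" using j0[OF \<open>j \<ge> j0\<close>] by simp
      then have "\<bar>2 ^ j * d j x\<bar> < 1" using abs_square_less_1 by fastforce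
      then have "2 ^ j * \<bar>d j x\<bar> < 1" by (simp add: abs_mult)
      then show "norm (d j x) \<le> (1/2) ^ j"
        by (simp add: power_one_over field_simps)
    qed
    then have "convergent (\<lambda>m. \<Sum>j<m. d j x)" by (simp add: summable_iff_convergent)
    moreover have "(\<Sum>j<m. d j x) = f (r m) x - f (r 0) x" for m
      unfolding d_def by (induction m) auto
    ultimately have "convergent (\<lambda>m. f (r m) x - f (r 0) x)" by simp
    then have "convergent (\<lambda>m. f (r m) x - f (r 0) x + f (r 0) x)"
      by (intro convergent_add convergent_const)
    then show ?case by simp
  qed
  define g where "g x = lim (\<lambda>j. f (r j) x)" for x
  have g_meas [measurable]: "g \<in> borel_measurable M"
    unfolding g_def by measurable
  have g_lim: "AE x in M. (\<lambda>j. f (r j) x) \<longlonglongrightarrow> g x"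
    using conv by eventually_elim (simp add: g_def convergent_LIMSEQ_iff)
  \<comment> \<open>Fatou's lemma along the subsequence replaces \<open>f l\<close> by
    \<open>g\<close> in the Cauchy estimate; it also shows that \<open>f k1 - g\<close>, hence
    \<open>g\<close>, is square integrable.\<close>
  have fatou: "(\<integral>\<^sup>+x. ennreal ((f k x - g x)\<^sup>2) \<partial>M) \<le> ennreal e"
    if k0: "\<forall>k\<ge>k0. \<forall>l\<ge>k0. (\<integral>x. (f k x - f l x)\<^sup>2 \<partial>M) \<le> e" and k: "k \<ge> k0" for k k0 e
  proof -
    have "(\<integral>\<^sup>+x. ennreal ((f k x - g x)\<^sup>2) \<partial>M) = (\<integral>\<^sup>+x. liminf (\<lambda>j. ennreal ((f k x - f (r j) x)\<^sup>2)) \<partial>M)"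
    proof (rule nn_integral_cong_AE, use g_lim in eventually_elim)
      case (elim x)
      have "(\<lambda>j. ennreal ((f k x - f (r j) x)\<^sup>2)) \<longlonglongrightarrow> ennreal ((f k x - g x)\<^sup>2)"
        by (intro tendsto_intros tendsto_ennrealI elim)
      then show ?case by (rule lim_imp_Liminf[OF sequentially_bot, symmetric])
    qed
    also have "\<dots> \<le> liminf (\<lambda>j. \<integral>\<^sup>+x. ennreal ((f k x - f (r j) x)\<^sup>2) \<partial>M)"
      by (rule nn_integral_liminf) measurable
    also have "\<dots> \<le> limsup (\<lambda>j. \<integral>\<^sup>+x. ennreal ((f k x - f (r j) x)\<^sup>2) \<partial>M)"
      by (rule Liminf_le_Limsup) simp
    also have "\<dots> \<le> ennreal e"
    proof (rule Limsup_bounded)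
      have "(\<integral>\<^sup>+x. ennreal ((f k x - f (r j) x)\<^sup>2) \<partial>M) \<le> ennreal e" if "j \<ge> k0" for j
        unfolding nn using k0 k that r_ge(3)[of j] by (intro ennreal_leI) auto
      then show "\<forall>\<^sub>F j in sequentially. (\<integral>\<^sup>+x. ennreal ((f k x - f (r j) x)\<^sup>2) \<partial>M) \<le> ennreal e"
        unfolding eventually_sequentially by blast
    qed
    finally show ?thesis .
  qed
  obtain k1 where k1: "\<forall>k\<ge>k1. \<forall>l\<ge>k1. (\<integral>x. (f k x - f l x)\<^sup>2 \<partial>M) \<le> 1"
    using Cauchy[of 1] by auto
  have "integrable M (\<lambda>x. (f k1 x - g x)\<^sup>2)"
    using fatou[OF k1 order_refl] by (intro integrableI_bounded) (auto intro: order.strict_trans1)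
  from int_diff[OF int[of k1] this] have g_int: "integrable M (\<lambda>x. (g x)\<^sup>2)" by simp
  have "(\<lambda>k. \<integral>x. (f k x - g x)\<^sup>2 \<partial>M) \<longlonglongrightarrow> 0"
  proof (rule LIMSEQ_I)
    fix e :: real assume "e > 0"
    then obtain k0 where k0: "\<forall>k\<ge>k0. \<forall>l\<ge>k0. (\<integral>x. (f k x - f l x)\<^sup>2 \<partial>M) \<le> e / 2"
      using Cauchy[of "e / 2"] by auto
    have "norm ((\<integral>x. (f k x - g x)\<^sup>2 \<partial>M) - 0) < e" if "k \<ge> k0" for k
    proof -
      have "ennreal (\<integral>x. (f k x - g x)\<^sup>2 \<partial>M) = (\<integral>\<^sup>+x. ennreal ((f k x - g x)\<^sup>2) \<partial>M)"
        by (rule nn_integral_eq_integral[symmetric]) (auto intro: int_diff int g_int)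
      also have "\<dots> \<le> ennreal (e / 2)" by (rule fatou[OF k0 that])
      finally have "(\<integral>x. (f k x - g x)\<^sup>2 \<partial>M) \<le> e / 2" using \<open>e > 0\<close> by simp
      then show ?thesis using \<open>e > 0\<close> by simp
    qed
    then show "\<exists>k0. \<forall>k\<ge>k0. norm ((\<integral>x. (f k x - g x)\<^sup>2 \<partial>M) - 0) < e" by blast
  qed
  then show ?thesis using g_meas g_int g_lim by blast
qed

section \<open>Representatives of classes and the weighted inner product on
  \<open>L2\<close>\<close>

abbreviation rep :: "ae_fun \<Rightarrow> real \<Rightarrow> real" where "rep \<equiv> rep_ae_fun"

lemma rep_measurable [measurable]: "rep f \<in> borel_measurable lebesgue"
  using Quotient3_rep_reflp[OF Quotient3_ae_fun, of f] by (simp add: ae_eq_def)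

lemma rep_abs_AE:
  "f \<in> borel_measurable lebesgue \<Longrightarrow> AE x in lebesgue. rep (abs_ae_fun f) x = f x"
  using rep_abs_rsp_left[OF Quotient3_ae_fun, of f f] by (simp add: ae_eq_def)

lemma ae_fun_eq_iff: "f = g \<longleftrightarrow> (AE x in lebesgue. rep f x = rep g x)"
  using Quotient3_rel_rep[OF Quotient3_ae_fun, of f g] by (simp add: ae_eq_def)

lemma rep_plus: "AE x in lebesgue. rep (f + g) x = rep f x + rep g x"
  unfolding plus_ae_fun_def map_fun_apply by (rule rep_abs_AE) measurable

lemma rep_minus: "AE x in lebesgue. rep (f - g) x = rep f x - rep g x"
  unfolding minus_ae_fun_def map_fun_apply by (rule rep_abs_AE) measurable

lemma rep_uminus: "AE x in lebesgue. rep (- f) x = - rep f x"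
  unfolding uminus_ae_fun_def map_fun_apply by (rule rep_abs_AE) measurable

lemma rep_scale: "AE x in lebesgue. rep (c *\<^sub>R f) x = c * rep f x"
  unfolding scaleR_ae_fun_def map_fun_apply id_apply by (rule rep_abs_AE) measurable

lemma rep_zero: "AE x in lebesgue. rep 0 x = 0"
  unfolding zero_ae_fun_def by (rule rep_abs_AE) measurable

lemma continuous_on_measurable_if:
  fixes u :: "real \<Rightarrow> real"
  assumes "continuous_on {a..b} u"
  shows "(\<lambda>z. if z \<in> {a..b} then u z else 0) \<in> borel_measurable lebesgue"
proof -
  have "(\<lambda>z. if z \<in> {a..b} then u z else 0) \<in> borel_measurable borel"
    by (rule borel_measurable_continuous_on_if) (auto intro: assms)
  then show ?thesis by (intro measurable_completion) simp
qed

lemma rep_class_on_AE: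
  assumes "(\<lambda>z. if z \<in> {a..b} then u z else 0) \<in> borel_measurable lebesgue"
  shows "AE z in lebesgue. rep (class_on a b u) z = (if z \<in> {a..b} then u z else 0)"
  unfolding class_on_def by (rule rep_abs_AE[OF assms])

lemma AE_lebesgue_neq: "AE z in lebesgue. z \<noteq> (c :: real)"
  by (rule AE_completion) (rule AE_lborel_singleton)

lemma AE_outside_iff:
  "(AE z in lebesgue. z \<notin> {a<..<b} \<longrightarrow> rep f z = 0) \<longleftrightarrow>
   (AE z in lebesgue. z \<notin> {a..b} \<longrightarrow> rep f z = 0)"
proof
  assume "AE z in lebesgue. z \<notin> {a..b} \<longrightarrow> rep f z = 0"
  then show "AE z in lebesgue. z \<notin> {a<..<b} \<longrightarrow> rep f z = 0"
    using AE_lebesgue_neq[of a] AE_lebesgue_neq[of b] by eventually_elim force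
qed (auto elim: eventually_mono)

lemma L2_iff: "f \<in> L2 a b \<longleftrightarrow> integrable lebesgue (\<lambda>z. (rep f z)\<^sup>2) \<and>
   (AE z in lebesgue. z \<notin> {a..b} \<longrightarrow> rep f z = 0)"
  unfolding L2_def AE_outside_iff by simp

lemma abs_mult_le_sum_squares: "\<bar>x * y\<bar> \<le> x\<^sup>2 + y\<^sup>2" for x y :: real
  using sum_squares_bound[of x y] sum_squares_bound[of x "- y"] zero_le_power2[of x] zero_le_power2[of y]
  by (simp add: abs_le_iff)

lemma L2_mult_integrable:
  assumes "f \<in> L2 a b" "g \<in> L2 a b"
  shows "integrable lebesgue (\<lambda>z. rep f z * rep g z)"
proof (rule Bochner_Integration.integrable_bound)
  show "integrable lebesgue (\<lambda>z. (rep f z)\<^sup>2 + (rep g z)\<^sup>2)"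
    using assms by (auto simp: L2_def)
qed (use abs_mult_le_sum_squares in auto)

lemma L2_bounded_mult_integrable:
  assumes f: "f \<in> L2 a b" and [measurable]: "v \<in> borel_measurable lebesgue"
    and bound: "\<And>z. z \<in> {a..b} \<Longrightarrow> \<bar>v z\<bar> \<le> B"
  shows "integrable lebesgue (\<lambda>z. rep f z * v z)"
proof (rule Bochner_Integration.integrable_bound)
  have "integrable lebesgue (\<lambda>z. indicator {a..b} z * B\<^sup>2)"
    by (intro integrable_mult_left integrable_real_indicator) (auto simp: emeasure_lborel_Icc_eq)
  then show "integrable lebesgue (\<lambda>z. (rep f z)\<^sup>2 + indicator {a..b} z * B\<^sup>2)"
    using f by (auto simp: L2_def)
  have out: "AE z in lebesgue. z \<notin> {a..b} \<longrightarrow> rep f z = 0" using f by (simp add: L2_iff)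
  show "AE z in lebesgue. norm (rep f z * v z) \<le> norm ((rep f z)\<^sup>2 + indicator {a..b} z * B\<^sup>2)"
    using out
  proof eventually_elim
    case (elim z)
    show ?case
    proof (cases "z \<in> {a..b}")
      case True
      have "\<bar>rep f z * v z\<bar> \<le> (rep f z)\<^sup>2 + (v z)\<^sup>2"
        by (rule abs_mult_le_sum_squares)
      also have "(v z)\<^sup>2 \<le> B\<^sup>2"
        using bound[OF True] power_mono[of "\<bar>v z\<bar>" B 2] by simp
      finally show ?thesis using True by simp
    qed (use elim in auto)
  qed
qed measurable

lemma subspace_L2: "subspace (L2 a b)"
proof (rule subspaceI)
  show "0 \<in> L2 a b"
  proof -
    have "integrable lebesgue (\<lambda>z. (rep 0 z)\<^sup>2) = integrable lebesgue (\<lambda>z::real. 0::real)"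
      using rep_zero by (intro integrable_cong_AE) (auto elim: eventually_mono)
    then show ?thesis using rep_zero by (auto simp: L2_def elim: eventually_mono)
  qed
  show "f + g \<in> L2 a b" if f: "f \<in> L2 a b" and g: "g \<in> L2 a b" for f g
  proof -
    have "integrable lebesgue (\<lambda>z. (rep f z)\<^sup>2 + 2 * (rep f z * rep g z) + (rep g z)\<^sup>2)"
      using f g L2_mult_integrable[OF f g] by (auto simp: L2_def)
    then have "integrable lebesgue (\<lambda>z. (rep (f + g) z)\<^sup>2)"
      by (rule integrable_cong_AE_imp) (use rep_plus[of f g] in \<open>auto elim!: eventually_mono simp: power2_sum\<close>)
    moreover have "AE z in lebesgue. z \<notin> {a<..<b} \<longrightarrow> rep (f + g) z = 0"
    proof -
      have "AE z in lebesgue. z \<notin> {a<..<b} \<longrightarrow> rep f z = 0"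
        "AE z in lebesgue. z \<notin> {a<..<b} \<longrightarrow> rep g z = 0"
        using f g by (auto simp: L2_def)
      then show ?thesis using rep_plus[of f g] by eventually_elim auto
    qed
    ultimately show ?thesis by (simp add: L2_def)
  qed
  show "c *\<^sub>R f \<in> L2 a b" if f: "f \<in> L2 a b" for c f
  proof -
    have "integrable lebesgue (\<lambda>z. c\<^sup>2 * (rep f z)\<^sup>2)"
      using f by (auto simp: L2_def)
    then have "integrable lebesgue (\<lambda>z. (rep (c *\<^sub>R f) z)\<^sup>2)"
      by (rule integrable_cong_AE_imp)
        (use rep_scale[of c f] in \<open>auto elim!: eventually_mono simp: power_mult_distrib\<close>)
    moreover have "AE z in lebesgue. z \<notin> {a<..<b} \<longrightarrow> rep (c *\<^sub>R f) z = 0"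
    proof -
      have "AE z in lebesgue. z \<notin> {a<..<b} \<longrightarrow> rep f z = 0"
        using f by (auto simp: L2_def)
      then show ?thesis using rep_scale[of c f] by eventually_elim auto
    qed
    ultimately show ?thesis by (simp add: L2_def)
  qed
qed

text \<open>On the compact interval \<open>rho\<close> lies between positive constants
  \<open>c\<close> and \<open>R\<close>, so the weighted and the plain squared norm are equivalent,
  and both definiteness and completeness come from the plain one.\<close>

lemma hilbert_subspace_L2:
  fixes rho :: "real \<Rightarrow> real"
  assumes rho: "continuous_on {a..b} rho" "\<And>z. z \<in> {a..b} \<Longrightarrow> rho z > 0" and ab: "a < b"
  shows "hilbert_subspace (L2 a b) (inner_weight a b rho)"
proof -
  let ?ip = "inner_weight a b rho"
  \<comment> \<open>\<open>rho\<close> is constrained only on \<open>[a,b]\<close>; extending it by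
    \<open>0\<close> gives a weight measurable on the line.\<close>
  define W where "W z = (if z \<in> {a..b} then rho z else 0)" for z
  have [measurable]: "W \<in> borel_measurable lebesgue"
    unfolding W_def by (rule continuous_on_measurable_if[OF rho(1)])
  have ne: "{a..b} \<noteq> {}" using ab by simp
  obtain x where x: "x \<in> {a..b}" "\<forall>y\<in>{a..b}. rho x \<le> rho y"
    using continuous_attains_inf[OF compact_Icc ne rho(1)] by blast
  define c where "c = rho x"
  have c: "c > 0" "\<And>z. z \<in> {a..b} \<Longrightarrow> c \<le> rho z" using x rho(2) by (auto simp: c_def)
  obtain y where y: "y \<in> {a..b}" "\<forall>z\<in>{a..b}. rho z \<le> rho y"
    using continuous_attains_sup[OF compact_Icc ne rho(1)] by blast
  define R where "R = rho y"
  have R: "\<And>z. z \<in> {a..b} \<Longrightarrow> rho z \<le> R" using y by (auto simp: R_def)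
  have W_nonneg: "0 \<le> W z" and W_le: "W z \<le> R" for z
    using c(1) c(2)[of z] R[of z] R[of a] c(2)[of a] ab by (auto simp: W_def)
  have ip_eq: "?ip f g = (\<integral>z. rep f z * rep g z * W z \<partial>lebesgue)" for f g
    unfolding inner_weight_def set_lebesgue_integral_def
    by (intro Bochner_Integration.integral_cong) (auto simp: W_def indicator_def)
  have int: "integrable lebesgue (\<lambda>z. rep f z * rep g z * W z)"
    if "f \<in> L2 a b" "g \<in> L2 a b" for f g
  proof (rule Bochner_Integration.integrable_bound)
    show "integrable lebesgue (\<lambda>z. R * (rep f z * rep g z))"
      by (intro integrable_mult_right L2_mult_integrable[OF that])
    show "AE z in lebesgue. norm (rep f z * rep g z * W z) \<le>
        norm (R * (rep f z * rep g z))"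
      using W_nonneg W_le by (auto simp: abs_mult mult.commute[of R] intro!: mult_left_mono order_trans[OF _ abs_ge_self])
  qed measurable
  have sq_int: "integrable lebesgue (\<lambda>z. (rep f z)\<^sup>2)" if "f \<in> L2 a b" for f
    using that by (simp add: L2_def)
  have sq_le: "c * (\<integral>z. (rep f z)\<^sup>2 \<partial>lebesgue) \<le> ?ip f f" if f: "f \<in> L2 a b" for f
  proof -
    have "AE z in lebesgue. z \<notin> {a..b} \<longrightarrow> rep f z = 0" using f by (simp add: L2_iff)
    then have "AE z in lebesgue. c * (rep f z)\<^sup>2 \<le> rep f z * rep f z * W z"
    proof eventually_elim
      case (elim z)
      then show ?case
        using c(2)[of z] mult_right_mono[of c "rho z" "(rep f z)\<^sup>2"]
        by (cases "z \<in> {a..b}") (auto simp: W_def power2_eq_square mult.commute)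
    qed
    then have "(\<integral>z. c * (rep f z)\<^sup>2 \<partial>lebesgue) \<le> (\<integral>z. rep f z * rep f z * W z \<partial>lebesgue)"
      using sq_int[OF f] int[OF f f] by (intro integral_mono_AE) auto
    then show ?thesis by (simp add: ip_eq)
  qed
  have sq_ge: "?ip f f \<le> R * (\<integral>z. (rep f z)\<^sup>2 \<partial>lebesgue)" if f: "f \<in> L2 a b" for f
  proof -
    have "(\<integral>z. rep f z * rep f z * W z \<partial>lebesgue) \<le> (\<integral>z. R * (rep f z)\<^sup>2 \<partial>lebesgue)"
      using sq_int[OF f] int[OF f f] W_le
      by (intro integral_mono) (auto simp: power2_eq_square mult.commute[of R] intro!: mult_left_mono)
    then show ?thesis by (simp add: ip_eq)
  qed
  show ?thesis
  proof
    show "subspace (L2 a b)" by (rule subspace_L2)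
    show "?ip f g = ?ip g f" for f g
      by (simp add: inner_weight_def mult.commute)
    show "?ip (f + g) h = ?ip f h + ?ip g h"
      if fgh: "f \<in> L2 a b" "g \<in> L2 a b" "h \<in> L2 a b" for f g h
    proof -
      have "?ip (f + g) h =
          (\<integral>z. rep f z * rep h z * W z + rep g z * rep h z * W z \<partial>lebesgue)"
        unfolding ip_eq using rep_plus[of f g]
        by (intro integral_cong_AE) (auto elim!: eventually_mono simp: ring_distribs)
      then show ?thesis by (simp add: ip_eq int fgh)
    qed
    show "?ip (s *\<^sub>R f) h = s * ?ip f h" for s f h
    proof -
      have "?ip (s *\<^sub>R f) h = (\<integral>z. s * (rep f z * rep h z * W z) \<partial>lebesgue)"
        unfolding ip_eq using rep_scale[of s f]
        by (intro integral_cong_AE) (auto elim!: eventually_mono simp: ring_distribs)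
      then show ?thesis by (simp add: ip_eq)
    qed
    show "0 \<le> ?ip f f" for f
      unfolding ip_eq using W_nonneg by (intro Bochner_Integration.integral_nonneg) auto
    show "f = 0" if f: "f \<in> L2 a b" "?ip f f = 0" for f
    proof -
      have "c * (\<integral>z. (rep f z)\<^sup>2 \<partial>lebesgue) \<le> 0" using sq_le[OF f(1)] f(2) by simp
      moreover have "(\<integral>z. (rep f z)\<^sup>2 \<partial>lebesgue) \<ge> 0"
        by (intro Bochner_Integration.integral_nonneg) auto
      ultimately have "(\<integral>z. (rep f z)\<^sup>2 \<partial>lebesgue) = 0"
        using c(1) by (simp add: mult_le_0_iff)
      then have "AE z in lebesgue. (rep f z)\<^sup>2 = 0"
        using integral_nonneg_eq_0_iff_AE[OF sq_int[OF f(1)]] by simp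
      then show "f = 0"
        unfolding ae_fun_eq_iff using rep_zero by eventually_elim auto
    qed
    fix x :: "nat \<Rightarrow> ae_fun"
    assume x: "\<And>k. x k \<in> L2 a b"
      and Cauchy: "\<And>e. e > 0 \<Longrightarrow> \<exists>k0. \<forall>k\<ge>k0. \<forall>l\<ge>k0. ?ip (x k - x l) (x k - x l) \<le> e"
    have L2_diff: "f - g \<in> L2 a b" if "f \<in> L2 a b" "g \<in> L2 a b" for f g
      using subspace_diff[OF subspace_L2] that .
    have diff: "(\<integral>z. (rep (f - g) z)\<^sup>2 \<partial>lebesgue) = (\<integral>z. (rep f z - rep g z)\<^sup>2 \<partial>lebesgue)" for f g
      using rep_minus[of f g] by (intro integral_cong_AE) (auto elim!: eventually_mono)
    have Cauchy': "\<exists>k0. \<forall>k\<ge>k0. \<forall>l\<ge>k0. (\<integral>z. (rep (x k) z - rep (x l) z)\<^sup>2 \<partial>lebesgue) \<le> e"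
      if e: "e > 0" for e
    proof -
      have "c * e > 0" using e c(1) by simp
      then obtain k0 where k0: "\<forall>k\<ge>k0. \<forall>l\<ge>k0. ?ip (x k - x l) (x k - x l) \<le> c * e"
        using Cauchy[of "c * e"] by blast
      have "(\<integral>z. (rep (x k) z - rep (x l) z)\<^sup>2 \<partial>lebesgue) \<le> e" if "k \<ge> k0" "l \<ge> k0" for k l
      proof -
        have "?ip (x k - x l) (x k - x l) \<le> c * e" using k0 that by blast
        then have "c * (\<integral>z. (rep (x k - x l) z)\<^sup>2 \<partial>lebesgue) \<le> c * e"
          using sq_le[OF L2_diff[OF x x], of k l] by linarith
        then show ?thesis using c(1) by (simp add: diff)
      qed
      then show ?thesis by blast
    qed
    obtain g r where g [measurable]: "g \<in> borel_measurable lebesgue" and g2: "integrable lebesgue (\<lambda>z. (g z)\<^sup>2)"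
      and lim: "(\<lambda>k. \<integral>z. (rep (x k) z - g z)\<^sup>2 \<partial>lebesgue) \<longlonglongrightarrow> 0"
      and AE_lim: "AE z in lebesgue. (\<lambda>j. rep (x (r j)) z) \<longlonglongrightarrow> g z"
      using L2_complete[of "\<lambda>k. rep (x k)" lebesgue, OF rep_measurable sq_int[OF x] Cauchy'] by blast
    define G where "G = abs_ae_fun g"
    have G: "AE z in lebesgue. rep G z = g z" unfolding G_def by (rule rep_abs_AE) measurable
    have G_L2: "G \<in> L2 a b"
    proof -
      have "integrable lebesgue (\<lambda>z. (rep G z)\<^sup>2)"
        using g2 by (rule integrable_cong_AE_imp) (use G in \<open>auto elim!: eventually_mono\<close>)
      moreover have "AE z in lebesgue. z \<notin> {a..b} \<longrightarrow> rep G z = 0"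
      proof -
        \<comment> \<open>Countably many null sets are combined, after which the convergent
          subsequence is identically \<open>0\<close> at almost every point outside the
          interval.\<close>
        have "AE z in lebesgue. \<forall>k. z \<notin> {a..b} \<longrightarrow> rep (x k) z = 0"
          unfolding AE_all_countable using x L2_iff by blast
        then show ?thesis using G AE_lim
        proof eventually_elim
          case (elim z)
          show ?case
          proof
            assume "z \<notin> {a..b}"
            then have "(\<lambda>j. 0) \<longlonglongrightarrow> g z" using elim by simp
            then show "rep G z = 0" using elim by (simp add: LIMSEQ_const_iff)
          qed
        qed
      qed
      ultimately show ?thesis by (simp add: L2_iff)
    qed
    have up: "(\<lambda>k. R * (\<integral>z. (rep (x k) z - g z)\<^sup>2 \<partial>lebesgue)) \<longlonglongrightarrow> 0"
      using tendsto_mult_left[OF lim, of R] by simp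
    have nonneg: "0 \<le> ?ip (x k - G) (x k - G)" for k
      unfolding ip_eq using W_nonneg by (intro Bochner_Integration.integral_nonneg) auto
    have le: "?ip (x k - G) (x k - G) \<le> R * (\<integral>z. (rep (x k) z - g z)\<^sup>2 \<partial>lebesgue)" for k
    proof -
      have "(\<integral>z. (rep (x k) z - rep G z)\<^sup>2 \<partial>lebesgue) = (\<integral>z. (rep (x k) z - g z)\<^sup>2 \<partial>lebesgue)"
        using G by (intro integral_cong_AE) (auto elim!: eventually_mono)
      then show ?thesis using sq_ge[OF L2_diff[OF x[of k] G_L2]] by (simp add: diff)
    qed
    have "(\<lambda>k. ?ip (x k - G) (x k - G)) \<longlonglongrightarrow> 0"
      by (rule tendsto_sandwich[OF always_eventually always_eventually tendsto_const up]) (use nonneg le in blast)+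
    then show "\<exists>g\<in>L2 a b. (\<lambda>k. ?ip (x k - g) (x k - g)) \<longlonglongrightarrow> 0"
      using G_L2 by blast
  qed
qed

subsection \<open>Test functions and weak derivatives\<close>

text \<open>The measures whose densities are the positive and the negative part of a Borel version
  \<open>h\<close> of \<open>g\<close> agree on all half-lines and hence coincide. Uniqueness of
  densities makes the two parts equal almost everywhere; as one of them is always \<open>0\<close>,
  so is \<open>h\<close>.\<close>

lemma AE_eq_0_if_integral_greaterThan_eq_0:
  fixes g :: "real \<Rightarrow> real"
  assumes g: "integrable lebesgue g"
    and zero: "\<And>x. (\<integral>z. indicator {x<..} z * g z \<partial>lebesgue) = 0"
  shows "AE z in lebesgue. g z = 0"
proof -
  obtain h where h [measurable]: "h \<in> borel_measurable borel" and gh: "AE z in lborel. g z = h z"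
    using completion_ex_borel_measurable_real[of g lborel] g by auto
  have gh': "AE z in lebesgue. g z = h z" using gh by (rule AE_completion)
  have [measurable]: "h \<in> borel_measurable lebesgue" "g \<in> borel_measurable lebesgue"
    using g by (auto intro: measurable_completion)
  have "integrable lebesgue h"
    using g by (rule integrable_cong_AE_imp) (use gh' in \<open>auto elim: eventually_mono\<close>)
  then have h_int: "integrable lborel h" by (simp add: integrable_completion)
  have ind_int: "integrable lborel (\<lambda>z. indicator {x<..} z * h z)" for x
    using integrable_real_mult_indicator[OF _ h_int, of "{x<..}"] by (simp add: mult.commute)
  have h_zero: "(\<integral>z. indicator {x<..} z * h z \<partial>lborel) = 0" for x
  proof -
    have "(\<integral>z. indicator {x<..} z * h z \<partial>lborel) = (\<integral>z. indicator {x<..} z * h z \<partial>lebesgue)"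
      by (rule integral_completion[symmetric]) measurable
    also have "\<dots> = (\<integral>z. indicator {x<..} z * g z \<partial>lebesgue)"
      using gh' by (intro integral_cong_AE borel_measurable_times borel_measurable_indicator)
        (auto elim: eventually_mono)
    finally show ?thesis using zero by simp
  qed
  have density: "emeasure (density lborel (\<lambda>z. ennreal (f z))) {x<..} =
      (\<integral>\<^sup>+z. ennreal (indicator {x<..} z * f z) \<partial>lborel)"
    if [measurable]: "f \<in> borel_measurable borel" for f :: "real \<Rightarrow> real" and x
    by (subst emeasure_density) (auto intro!: nn_integral_cong borel_open simp: indicator_def)
  have fin: "(\<integral>\<^sup>+z. ennreal (indicator {x<..} z * h z) \<partial>lborel) < \<infinity>"
      "(\<integral>\<^sup>+z. ennreal (indicator {x<..} z * - h z) \<partial>lborel) < \<infinity>" for x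
    using ind_int[of x] by (auto simp: real_integrable_def less_top)
  have "density lborel (\<lambda>z. ennreal (h z)) = density lborel (\<lambda>z. ennreal (- h z))"
  proof (rule measure_eqI_lessThan)
    fix x
    show "emeasure (density lborel (\<lambda>z. ennreal (h z))) {x<..} < \<infinity>"
      using fin(1) by (simp add: density)
    have "enn2real (\<integral>\<^sup>+z. ennreal (indicator {x<..} z * h z) \<partial>lborel) =
        enn2real (\<integral>\<^sup>+z. ennreal (indicator {x<..} z * - h z) \<partial>lborel)"
      using h_zero[of x] real_lebesgue_integral_def[OF ind_int[of x]] by simp
    then have "(\<integral>\<^sup>+z. ennreal (indicator {x<..} z * h z) \<partial>lborel) =
        (\<integral>\<^sup>+z. ennreal (indicator {x<..} z * - h z) \<partial>lborel)"
      using fin[of x] by (metis ennreal_enn2real infinity_ennreal_def)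
    then show "emeasure (density lborel (\<lambda>z. ennreal (h z))) {x<..} =
        emeasure (density lborel (\<lambda>z. ennreal (- h z))) {x<..}"
      by (simp add: density)
  qed auto
  then have "AE z in lborel. ennreal (h z) = ennreal (- h z)"
    by (intro sigma_finite_measure.density_unique[OF lborel.sigma_finite_measure_axioms]) auto
  then have "AE z in lborel. h z = 0"
  proof eventually_elim
    case (elim z)
    then show ?case
      by (cases "h z \<ge> 0") (auto simp: ennreal_neg ennreal_eq_0_iff dest: sym)
  qed
  then have "AE z in lebesgue. h z = 0" by (rule AE_completion)
  then show ?thesis using gh' by eventually_elim simp
qed

section \<open>Test functions and how they separate the elements of \<open>L2\<close>\<close>

lemma test_functionI:
  assumes deriv: "\<And>z. (v has_real_derivative v' z) (at z)" and cont: "continuous_on UNIV v'"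
    and supp: "closure {z. v z \<noteq> 0} \<subseteq> {a<..<b}"
  shows "test_function a b v"
  unfolding test_function_def
proof (intro conjI supp)
  show "v C1_differentiable_on UNIV"
    unfolding C1_differentiable_on_def
    using deriv cont by (auto simp: has_real_derivative_iff_has_vector_derivative)
  have "bounded (closure {z. v z \<noteq> 0})"
    by (rule bounded_subset[OF bounded_closed_interval[of a b]]) (use supp in force)
  then show "compact (closure {z. v z \<noteq> 0})" by (simp add: compact_eq_bounded_closed)
qed

lemma closure_support_subset:
  fixes v :: "real \<Rightarrow> real"
  assumes "\<And>z. v z \<noteq> 0 \<Longrightarrow> z \<in> {c..d}" "a < c" "d < b"
  shows "closure {z. v z \<noteq> 0} \<subseteq> {a<..<b}"
proof -
  have "closure {z. v z \<noteq> 0} \<subseteq> {c..d}"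
    by (rule closure_minimal) (use assms in auto)
  then show ?thesis using assms by force
qed

lemma test_function_deriv:
  assumes "test_function a b v"
  shows "(v has_real_derivative deriv v z) (at z)" and "continuous_on UNIV (deriv v)"
proof -
  obtain D where D: "\<And>z. (v has_real_derivative D z) (at z)" "continuous_on UNIV D"
    using assms unfolding test_function_def C1_differentiable_on_def
    by (auto simp: has_real_derivative_iff_has_vector_derivative)
  then have "deriv v = D" by (auto intro: DERIV_imp_deriv)
  then show "(v has_real_derivative deriv v z) (at z)" "continuous_on UNIV (deriv v)"
    using D by auto
qed

lemma test_function_eq_0:
  assumes "test_function a b v" "z \<notin> closure {z. v z \<noteq> 0}"
  shows "v z = 0" and "deriv v z = 0"
proof -
  show "v z = 0" using assms(2) closure_subset[of "{z. v z \<noteq> 0}"] by blast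
  have "((\<lambda>z. 0) has_real_derivative 0) (at z)" by simp
  then have "(v has_real_derivative 0) (at z)"
  proof (rule has_field_derivative_transform_within_open)
    show "open (- closure {z. v z \<noteq> 0})" by auto
    show "z \<in> - closure {z. v z \<noteq> 0}" using assms(2) by simp
    show "0 = v y" if "y \<in> - closure {z. v z \<noteq> 0}" for y
      using that closure_subset[of "{z. v z \<noteq> 0}"] by auto
  qed
  then show "deriv v z = 0" by (rule DERIV_imp_deriv)
qed

lemma test_function_outside:
  assumes "test_function a b v" "z \<notin> {a<..<b}"
  shows "v z = 0" and "deriv v z = 0"
proof -
  have "closure {z. v z \<noteq> 0} \<subseteq> {a<..<b}" using assms(1) by (simp add: test_function_def)
  then have *: "z \<notin> closure {z. v z \<noteq> 0}" using assms(2) by blast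
  show "v z = 0" "deriv v z = 0" by (fact test_function_eq_0[OF assms(1) *])+
qed

lemma test_function_continuous:
  assumes "test_function a b v" shows "continuous_on S v" and "continuous_on S (deriv v)"
proof -
  show "continuous_on S v"
    by (intro continuous_at_imp_continuous_on ballI DERIV_isCont[OF test_function_deriv(1)[OF assms]])
  show "continuous_on S (deriv v)"
    by (rule continuous_on_subset[OF test_function_deriv(2)[OF assms]]) simp
qed

lemma continuous_UNIV_measurable_lebesgue:
  fixes v :: "real \<Rightarrow> real" shows "continuous_on UNIV v \<Longrightarrow> v \<in> borel_measurable lebesgue"
  by (intro measurable_completion) (simp add: borel_measurable_continuous_onI)

lemma test_function_measurable:
  assumes "test_function a b v"
  shows "v \<in> borel_measurable lebesgue" "deriv v \<in> borel_measurable lebesgue"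
  by (intro continuous_UNIV_measurable_lebesgue test_function_continuous[OF assms])+

lemma continuous_on_Icc_bounded:
  fixes u :: "real \<Rightarrow> real" assumes "continuous_on {a..b} u"
  obtains B where "B \<ge> 0" "\<And>z. z \<in> {a..b} \<Longrightarrow> \<bar>u z\<bar> \<le> B"
proof -
  have "bounded (u ` {a..b})" by (intro compact_imp_bounded compact_continuous_image assms) auto
  then obtain B where B: "\<forall>y\<in>u ` {a..b}. norm y \<le> B" unfolding bounded_iff by blast
  show thesis
  proof (rule that[of "max B 0"])
    fix z assume "z \<in> {a..b}"
    then have "norm (u z) \<le> B" using B by blast
    then show "\<bar>u z\<bar> \<le> max B 0" by simp
  qed simp
qed

lemma L2_continuous_mult_integrable:
  assumes f: "f \<in> L2 a b" and w: "continuous_on {a..b} w"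
  shows "set_integrable lebesgue {a..b} (\<lambda>z. rep f z * w z)"
proof -
  obtain B where B: "\<And>z. z \<in> {a..b} \<Longrightarrow> \<bar>w z\<bar> \<le> B"
    using continuous_on_Icc_bounded[OF w] by metis
  have "integrable lebesgue (\<lambda>z. rep f z * (if z \<in> {a..b} then w z else 0))"
    by (rule L2_bounded_mult_integrable[OF f continuous_on_measurable_if[OF w], of B]) (use B in auto)
  also have "(\<lambda>z. rep f z * (if z \<in> {a..b} then w z else 0)) =
      (\<lambda>z. indicator {a..b} z *\<^sub>R (rep f z * w z))"
    by (auto simp: indicator_def)
  finally show ?thesis unfolding set_integrable_def .
qed

text \<open>Test functions are required to be of class C1, which the square of the positive part
  already is; the quotient keeps the values in \<open>[0,1)\<close> and lets them tend to
  \<open>1\<close> at infinity. Rescaled products of such steps approximate indicators of intervals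
  pointwise.\<close>

definition smooth_step :: "real \<Rightarrow> real" where
  "smooth_step x = (max 0 x)\<^sup>2 / (1 + (max 0 x)\<^sup>2)"

lemma max_0_square_has_derivative: "((\<lambda>x::real. (max 0 x)\<^sup>2) has_real_derivative 2 * max 0 x) (at x)"
proof -
  consider "x > 0" | "x < 0" | "x = 0" by linarith
  then show ?thesis
  proof cases
    case 1
    have "((\<lambda>x. x\<^sup>2) has_real_derivative 2 * max 0 x) (at x)"
      using 1 by (auto intro!: derivative_eq_intros)
    then show ?thesis
      by (rule has_field_derivative_transform_within_open[where S="{0<..}"]) (use 1 in auto)
  next
    case 2
    have "((\<lambda>x. 0) has_real_derivative 2 * max 0 x) (at x)"
      using 2 by (auto intro!: derivative_eq_intros)
    then show ?thesis
      by (rule has_field_derivative_transform_within_open[where S="{..<0}"]) (use 2 in auto)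
  next
    case 3
    have "((\<lambda>h::real. (max 0 h)\<^sup>2 / h) \<longlongrightarrow> 0) (at 0)"
    proof (rule Lim_null_comparison)
      show "\<forall>\<^sub>F h in at 0. norm ((max 0 h)\<^sup>2 / h) \<le> \<bar>h\<bar>"
        by (intro always_eventually allI) (auto simp: max_def power2_eq_square)
      show "((\<lambda>h::real. \<bar>h\<bar>) \<longlongrightarrow> 0) (at 0)"
        using tendsto_rabs[OF tendsto_ident_at[of "0::real"]] by simp
    qed
    then show ?thesis using 3 by (simp add: DERIV_def)
  qed
qed

lemma smooth_step_has_derivative:
  "(smooth_step has_real_derivative 2 * max 0 x / (1 + (max 0 x)\<^sup>2)\<^sup>2) (at x)"
proof -
  have nz: "1 + (max 0 x)\<^sup>2 \<noteq> 0" using zero_le_power2[of "max 0 x"] by linarith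
  have "((\<lambda>x. (max 0 x)\<^sup>2 / (1 + (max 0 x)\<^sup>2)) has_real_derivative
      (2 * max 0 x * (1 + (max 0 x)\<^sup>2) - (max 0 x)\<^sup>2 * (0 + 2 * max 0 x)) /
      ((1 + (max 0 x)\<^sup>2) * (1 + (max 0 x)\<^sup>2))) (at x)"
    by (intro DERIV_divide DERIV_add DERIV_const max_0_square_has_derivative nz)
  moreover have "2 * max 0 x * (1 + (max 0 x)\<^sup>2) - (max 0 x)\<^sup>2 * (0 + 2 * max 0 x) = 2 * max 0 x"
    by (simp add: algebra_simps)
  moreover have "smooth_step = (\<lambda>x. (max 0 x)\<^sup>2 / (1 + (max 0 x)\<^sup>2))"
    by (simp add: smooth_step_def fun_eq_iff)
  ultimately show ?thesis by (simp add: power2_eq_square)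
qed

lemma smooth_step_bounds: "0 \<le> smooth_step x" "smooth_step x \<le> 1" "x \<le> 0 \<Longrightarrow> smooth_step x = 0"
proof -
  have q: "0 \<le> (max 0 x)\<^sup>2" by (rule zero_le_power2)
  show "0 \<le> smooth_step x" unfolding smooth_step_def using q by (intro divide_nonneg_nonneg) auto
  have "1 + (max 0 x)\<^sup>2 > 0" using q by linarith
  then show "smooth_step x \<le> 1" unfolding smooth_step_def by (subst divide_le_eq_1_pos) auto
  show "smooth_step x = 0" if "x \<le> 0" using that by (simp add: smooth_step_def)
qed

lemma smooth_step_tendsto:
  assumes "filterlim u at_top F" shows "((\<lambda>k. smooth_step (u k)) \<longlongrightarrow> 1) F"
proof -
  have "((\<lambda>y::real. 1 - 1 / (1 + y\<^sup>2)) \<longlongrightarrow> 1 - 0) at_top"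
  proof (intro tendsto_intros)
    have "filterlim (\<lambda>y::real. 1 + y\<^sup>2) at_infinity at_top"
      by (intro filterlim_at_top_imp_at_infinity filterlim_tendsto_add_at_top[OF tendsto_const]
          filterlim_pow_at_top filterlim_ident) simp
    then show "((\<lambda>y::real. 1 / (1 + y\<^sup>2)) \<longlongrightarrow> 0) at_top"
      by (rule tendsto_divide_0[OF tendsto_const])
  qed
  then have lim: "((\<lambda>y::real. 1 - 1 / (1 + y\<^sup>2)) \<longlongrightarrow> 1) at_top" by simp
  have "(smooth_step \<longlongrightarrow> 1) at_top"
  proof (rule Lim_transform_eventually[OF lim])
    show "\<forall>\<^sub>F y in at_top. 1 - 1 / (1 + y\<^sup>2) = smooth_step y"
      using eventually_ge_at_top[of 0]
    proof eventually_elim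
      case (elim y)
      have "1 + y\<^sup>2 \<noteq> 0" using zero_le_power2[of y] by linarith
      then show ?case using elim by (simp add: smooth_step_def field_simps)
    qed
  qed
  then show ?thesis using assms by (rule filterlim_compose)
qed

lemma test_function_smooth_step:
  assumes "a < c" "d < b" "k > 0"
  shows "test_function a b (\<lambda>z. smooth_step (k * (z - c)) * smooth_step (k * (d - z)))"
proof (rule test_functionI)
  let ?s' = "\<lambda>x. 2 * max 0 x / (1 + (max 0 x)\<^sup>2)\<^sup>2 :: real"
  show "((\<lambda>z. smooth_step (k * (z - c)) * smooth_step (k * (d - z))) has_real_derivative
      ?s' (k * (z - c)) * k * smooth_step (k * (d - z)) + ?s' (k * (d - z)) * (- k) * smooth_step (k * (z - c))) (at z)" for z
    by (auto intro!: derivative_eq_intros DERIV_chain2[OF smooth_step_has_derivative])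
  have nz: "(1 + (max 0 x)\<^sup>2)\<^sup>2 \<noteq> 0" for x :: real
    using zero_le_power2[of "max 0 x"] by (simp add: add_nonneg_eq_0_iff)
  have [continuous_intros]: "continuous_on UNIV (\<lambda>z. smooth_step (f z))" if "continuous_on UNIV f" for f :: "real \<Rightarrow> real"
    using that continuous_on_compose2[of UNIV smooth_step UNIV f] DERIV_isCont[OF smooth_step_has_derivative]
    by (auto simp: continuous_on_eq_continuous_at)
  show "continuous_on UNIV (\<lambda>z. ?s' (k * (z - c)) * k * smooth_step (k * (d - z)) + ?s' (k * (d - z)) * (- k) * smooth_step (k * (z - c)))"
    by (intro continuous_intros) (use nz in auto)
  have "z \<in> {c..d}" if "smooth_step (k * (z - c)) * smooth_step (k * (d - z)) \<noteq> 0" for z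
  proof -
    have "\<not> k * (z - c) \<le> 0" "\<not> k * (d - z) \<le> 0" using that smooth_step_bounds(3) by fastforce+
    then have "k * (z - c) > 0" "k * (d - z) > 0" by auto
    then show ?thesis using \<open>k > 0\<close> by (auto simp: zero_less_mult_iff)
  qed
  then show "closure {z. smooth_step (k * (z - c)) * smooth_step (k * (d - z)) \<noteq> 0} \<subseteq> {a<..<b}"
    using assms(1,2) by (rule closure_support_subset)
qed

text \<open>Test functions \<open>v k\<close> bounded by \<open>1\<close> converge pointwise to the
  indicator of \<open>(max a x, b)\<close>. Dominated convergence turns orthogonality into vanishing
  integrals over all half-lines.\<close>

lemma L2_eq_0_if_orthogonal_to_test_functions:
  assumes g: "g \<in> L2 a b"
    and zero: "\<And>v. test_function a b v \<Longrightarrow> (LINT z:{a..b}|lebesgue. rep g z * v z) = 0"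
  shows "g = 0"
proof -
  have out: "AE z in lebesgue. z \<notin> {a<..<b} \<longrightarrow> rep g z = 0" using g by (simp add: L2_def)
  have g_int: "integrable lebesgue (rep g)"
    using L2_bounded_mult_integrable[OF g, of "\<lambda>_. 1" 1] by simp
  have "(\<integral>z. indicator {x<..} z * rep g z \<partial>lebesgue) = 0" for x
  proof -
    define c where "c = max a x"
    \<comment> \<open>Moving the edges inwards by \<open>1 / Suc k\<close> keeps the support compact
      in \<open>(a,b)\<close>; scaling by \<open>Suc k\<close> turns the arguments into
      \<open>Suc k\<close> times the distance to the edge, minus \<open>1\<close>, which tends to
      infinity at interior points.\<close>
    define v where "v k z = smooth_step (real (Suc k) * (z - (c + 1 / Suc k))) *
      smooth_step (real (Suc k) * (b - 1 / Suc k - z))" for k z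
    have v: "test_function a b (v k)" for k
    proof -
      have "0 < 1 / real (Suc k)" "a \<le> c" by (simp_all add: c_def)
      then have "a < c + 1 / real (Suc k)" by linarith
      then show ?thesis
        unfolding v_def by (intro test_function_smooth_step) auto
    qed
    have v_meas [measurable]: "v k \<in> borel_measurable lebesgue" for k
      by (rule test_function_measurable(1)[OF v])
    have v_bounds: "\<bar>v k z\<bar> \<le> 1" for k z
      using smooth_step_bounds by (simp add: v_def abs_mult mult_le_one)
    have lim: "AE z in lebesgue. (\<lambda>k. rep g z * v k z) \<longlonglongrightarrow> indicator {x<..} z * rep g z"
      using out
    proof eventually_elim
      case (elim z)
      show ?case
      proof (cases "z \<in> {a<..<b}")
        case True
        show ?thesis
        proof (cases "x < z")
          case xz: True
          have lin: "filterlim (\<lambda>k. real (Suc k) * t - 1) at_top sequentially" if "t > 0" for t :: real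
          proof -
            have "filterlim (\<lambda>k. - 1 + t * real (Suc k)) at_top sequentially"
              by (intro filterlim_tendsto_add_at_top[OF tendsto_const] filterlim_tendsto_pos_mult_at_top[OF tendsto_const that]
                  filterlim_compose[OF filterlim_real_sequentially filterlim_Suc])
            then show ?thesis by (simp add: algebra_simps)
          qed
          have eqs: "real (Suc k) * (z - (c + 1 / Suc k)) = real (Suc k) * (z - c) - 1"
            "real (Suc k) * (b - 1 / Suc k - z) = real (Suc k) * (b - z) - 1" for k
            by (simp_all add: field_simps)
          have "(\<lambda>k. v k z) \<longlonglongrightarrow> 1 * 1"
            unfolding v_def eqs
            by (intro tendsto_mult smooth_step_tendsto lin) (use True xz in \<open>auto simp: c_def\<close>)
          then have "(\<lambda>k. rep g z * v k z) \<longlonglongrightarrow> rep g z * (1 * 1)"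
            by (intro tendsto_intros)
          then show ?thesis using xz by simp
        next
          case False
          have "v k z = 0" for k
          proof -
            have "z \<le> c" "0 < 1 / real (Suc k)" using False by (auto simp: c_def)
            then have "z - (c + 1 / Suc k) \<le> 0" by linarith
            then have "real (Suc k) * (z - (c + 1 / Suc k)) \<le> 0" by (intro mult_nonneg_nonpos) auto
            then show ?thesis unfolding v_def by (simp only: smooth_step_bounds(3) mult_zero_left)
          qed
          then show ?thesis using False by simp
        qed
      qed (use elim in simp)
    qed
    have "(\<lambda>k. \<integral>z. rep g z * v k z \<partial>lebesgue) \<longlonglongrightarrow> (\<integral>z. indicator {x<..} z * rep g z \<partial>lebesgue)"
    proof (rule integral_dominated_convergence)
      show "integrable lebesgue (\<lambda>z. \<bar>rep g z\<bar>)" using g_int by simp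
      show "AE z in lebesgue. (\<lambda>k. rep g z * v k z) \<longlonglongrightarrow> indicator {x<..} z * rep g z"
        by (rule lim)
      show "AE z in lebesgue. norm (rep g z * v k z) \<le> \<bar>rep g z\<bar>" for k
        using v_bounds by (auto simp: abs_mult intro!: mult_left_le)
      show "(\<lambda>z. indicator {x<..} z * rep g z) \<in> borel_measurable lebesgue"
        by (intro borel_measurable_times borel_measurable_indicator) auto
    qed measurable
    moreover have "(\<integral>z. rep g z * v k z \<partial>lebesgue) = 0" for k
    proof -
      have "(\<integral>z. rep g z * v k z \<partial>lebesgue) = (LINT z:{a..b}|lebesgue. rep g z * v k z)"
        unfolding set_lebesgue_integral_def
      proof (rule Bochner_Integration.integral_cong)
        fix z
        show "rep g z * v k z = indicator {a..b} z *\<^sub>R (rep g z * v k z)"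
          using test_function_outside(1)[OF v[of k], of z] by (cases "z \<in> {a..b}") auto
      qed simp
      then show ?thesis using zero[OF v] by simp
    qed
    ultimately show ?thesis by (simp add: LIMSEQ_const_iff)
  qed
  from AE_eq_0_if_integral_greaterThan_eq_0[OF g_int this] show ?thesis
    unfolding ae_fun_eq_iff using rep_zero by eventually_elim simp
qed

section \<open>Integration by parts and the du Bois-Reymond lemma\<close>

lemma continuous_set_integral:
  fixes h :: "real \<Rightarrow> real"
  assumes "continuous_on {a..b} h"
  shows "set_integrable lebesgue {a..b} h" "(LINT z:{a..b}|lebesgue. h z) = integral {a..b} h"
  using absolutely_integrable_continuous_real[OF assms] set_lebesgue_integral_eq_integral by blast+

lemma integral_by_parts_test_function:
  assumes v: "test_function a b v" and ab: "a \<le> b"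
    and deriv: "\<And>z. z \<in> {a..b} \<Longrightarrow> (u has_real_derivative u' z) (at z within {a..b})"
    and cont: "continuous_on {a..b} u'"
  shows "(LINT z:{a..b}|lebesgue. u z * deriv v z) = - (LINT z:{a..b}|lebesgue. u' z * v z)"
proof -
  have u_cont: "continuous_on {a..b} u"
    using deriv DERIV_continuous continuous_on_eq_continuous_within by blast
  note cv = test_function_continuous[OF v, of "{a..b}"]
  have "((\<lambda>z. u' z * v z + u z * deriv v z) has_integral u b * v b - u a * v a) {a..b}"
  proof (rule fundamental_theorem_of_calculus[OF ab])
    fix z assume z: "z \<in> {a..b}"
    have "((\<lambda>z. u z * v z) has_real_derivative u' z * v z + u z * deriv v z) (at z within {a..b})"
      using DERIV_mult[OF deriv[OF z] has_field_derivative_at_within[OF test_function_deriv(1)[OF v]]]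
      by (simp add: mult.commute)
    then show "((\<lambda>z. u z * v z) has_vector_derivative u' z * v z + u z * deriv v z) (at z within {a..b})"
      by (simp add: has_real_derivative_iff_has_vector_derivative)
  qed
  moreover have "v a = 0" "v b = 0" using test_function_outside(1)[OF v] by auto
  ultimately have "integral {a..b} (\<lambda>z. u' z * v z + u z * deriv v z) = 0"
    by (simp add: integral_unique)
  moreover have "integral {a..b} (\<lambda>z. u' z * v z + u z * deriv v z) =
      integral {a..b} (\<lambda>z. u' z * v z) + integral {a..b} (\<lambda>z. u z * deriv v z)"
    by (intro Henstock_Kurzweil_Integration.integral_add integrable_continuous_real continuous_intros
        cont cv u_cont)
  ultimately show ?thesis
    using cont cv u_cont by (simp add: continuous_set_integral(2) continuous_intros)
qed

text \<open>Du Bois-Reymond's argument with a bump \<open>X\<close> positive exactly on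
  \<open>(c,d)\<close>: for the \<open>X\<close>-weighted mean \<open>m\<close> of \<open>W\<close>
  the function \<open>X * (W - m)\<close> has integral \<open>0\<close>, so its primitive is a test
  function. Testing with it shows that the integral of \<open>X * (W - m)^2\<close> is
  \<open>0\<close>.\<close>

lemma constant_on_open_subinterval_if_orthogonal_to_derivatives:
  assumes W: "continuous_on {a..b} W"
    and orth: "\<And>v. test_function a b v \<Longrightarrow> (LINT z:{a..b}|lebesgue. W z * deriv v z) = 0"
    and cd: "a < c" "c < d" "d < b"
  shows "\<exists>m. \<forall>z\<in>{c<..<d}. W z = m"
proof -
  \<comment> \<open>Clamping the argument to \<open>[a,b]\<close> extends \<open>W\<close>, known to
    be continuous only there, to a continuous function on the line.\<close>
  define cl where "cl z = max a (min b z)" for z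
  define X where "X z = max 0 ((z - c) * (d - z))" for z
  have cl: "cl z \<in> {a..b}" "z \<in> {a..b} \<Longrightarrow> cl z = z" for z using cd by (auto simp: cl_def)
  have cont_cl: "continuous_on UNIV (\<lambda>z. W (cl z))"
    by (rule continuous_on_compose2[OF W]) (use cl in \<open>auto simp: cl_def intro!: continuous_intros\<close>)
  have cont_X: "continuous_on UNIV X" unfolding X_def by (intro continuous_intros)
  have X_out: "X z = 0" if "z \<notin> {c<..<d}" for z
    using that cd unfolding X_def by (auto simp: max_def mult_le_0_iff not_less zero_le_mult_iff)
  have X_in: "X z > 0" if "z \<in> {c<..<d}" for z
    using that by (auto simp: X_def zero_less_mult_iff max_def not_le)
  have X_nonneg: "X z \<ge> 0" for z by (simp add: X_def)
  have int[simp]: "continuous_on {p..q} (\<lambda>z. X z)" "continuous_on {p..q} (\<lambda>z. X z * W (cl z))" for p q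
    by (intro continuous_intros continuous_on_subset[OF cont_X] continuous_on_subset[OF cont_cl] subset_UNIV)+
  have X_pos: "integral {a..b} X > 0"
  proof -
    have "integral {a..b} X \<ge> 0" using X_nonneg by (intro integral_nonneg integrable_continuous_real int) auto
    moreover have "integral {a..b} X \<noteq> 0"
    proof
      assume "integral {a..b} X = 0"
      then have "(X has_integral 0) (cbox a b)"
        using integrable_integral[OF integrable_continuous_real[OF int(1)[of a b]]] by simp
      then have "X ((c + d) / 2) = 0"
        using cd by (intro has_integral_0_cbox_imp_0[of a b X]) (auto simp: X_nonneg)
      then show False using X_in[of "(c + d) / 2"] cd by simp
    qed
    ultimately show ?thesis by simp
  qed
  define m where "m = integral {a..b} (\<lambda>z. X z * W (cl z)) / integral {a..b} X"
  define h where "h z = X z * (W (cl z) - m)" for z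
  have cont_h: "continuous_on UNIV h" unfolding h_def by (intro continuous_intros cont_X cont_cl)
  have h_out: "h z = 0" if "z \<notin> {c<..<d}" for z using X_out[OF that] by (simp add: h_def)
  have h_int: "h integrable_on {p..q}" for p q
    by (intro integrable_continuous_real continuous_on_subset[OF cont_h]) auto
  have h_zero: "integral {a..b} h = 0"
  proof -
    have "h = (\<lambda>z. X z * W (cl z) - m * X z)"
      by (simp add: h_def fun_eq_iff algebra_simps)
    then have "integral {a..b} h = integral {a..b} (\<lambda>z. X z * W (cl z) - m * X z)"
      by simp
    also have "\<dots> = integral {a..b} (\<lambda>z. X z * W (cl z)) - integral {a..b} (\<lambda>z. m * X z)"
      by (intro Henstock_Kurzweil_Integration.integral_diff integrable_continuous_real continuous_intros int)
    finally show ?thesis using X_pos by (simp add: m_def)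
  qed
  define v where "v z = integral {a - 1..z} h" for z
  have v_left: "v z = 0" if "z \<le> c" for z
  proof -
    have "integral {a - 1..z} h = integral {a - 1..z} (\<lambda>_. 0)"
      using that by (intro Henstock_Kurzweil_Integration.integral_cong) (auto intro: h_out)
    then show ?thesis by (simp add: v_def)
  qed
  have v_eq: "v z = integral {a..z} h" if "a \<le> z" for z
    using Henstock_Kurzweil_Integration.integral_combine[of "a - 1" a z h] h_int[of "a - 1" z] that v_left[of a] cd
    by (simp add: v_def)
  \<comment> \<open>Right of \<open>d\<close> the primitive equals the full integral of
    \<open>h\<close>, which the choice of \<open>m\<close> made \<open>0\<close>; this gives compact
    support.\<close>
  have v_right: "v z = 0" if "d \<le> z" for z
  proof -
    have tail: "integral {d..y} h = 0" for y
    proof -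
      have "integral {d..y} h = integral {d..y} (\<lambda>_. 0)"
        by (intro Henstock_Kurzweil_Integration.integral_cong) (auto intro: h_out)
      then show ?thesis by simp
    qed
    have split: "integral {a..y} h = integral {a..d} h" if "d \<le> y" for y
      using Henstock_Kurzweil_Integration.integral_combine[of a d y h] h_int[of a y] that cd tail[of y] by simp
    have "v z = integral {a..z} h" using that cd by (intro v_eq) simp
    also have "\<dots> = integral {a..b} h" using split[OF that] split[of b] cd by simp
    finally show ?thesis using h_zero by simp
  qed
  have v_deriv: "(v has_real_derivative h z) (at z)" for z
  proof (cases "z < c")
    case True
    have "((\<lambda>z. 0) has_real_derivative h z) (at z)" using h_out[of z] True by simp
    then show ?thesis
      by (rule has_field_derivative_transform_within_open[where S="{..<c}"]) (use True v_left in auto)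
  next
    case False
    have "((\<lambda>z. integral {a - 1..z} h) has_real_derivative h z) (at z within {a - 1..z + 1})"
      by (rule integral_has_real_derivative[OF continuous_on_subset[OF cont_h subset_UNIV]]) (use False cd in simp)
    moreover have "at z within {a - 1..z + 1} = at z"
      using False cd by (intro at_within_Icc_at) auto
    moreover have "v = (\<lambda>z. integral {a - 1..z} h)" by (rule ext) (rule v_def)
    ultimately show ?thesis by simp
  qed
  have v_test: "test_function a b v"
  proof (rule test_functionI[OF v_deriv cont_h])
    have "z \<in> {c..d}" if "v z \<noteq> 0" for z using that v_left[of z] v_right[of z] by force
    then show "closure {z. v z \<noteq> 0} \<subseteq> {a<..<b}" using cd by (intro closure_support_subset) auto
  qed
  have deriv_v: "deriv v z = h z" for z using v_deriv by (rule DERIV_imp_deriv)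
  have "integral {a..b} (\<lambda>z. W z * h z) = 0"
  proof -
    have "continuous_on {a..b} (\<lambda>z. W z * h z)"
      by (intro continuous_intros W continuous_on_subset[OF cont_h]) auto
    then show ?thesis using orth[OF v_test] by (simp add: deriv_v continuous_set_integral(2))
  qed
  then have WX_zero: "integral {a..b} (\<lambda>z. X z * (W z - m)\<^sup>2) = 0"
  proof -
    have "integral {a..b} (\<lambda>z. X z * (W z - m)\<^sup>2) = integral {a..b} (\<lambda>z. W z * h z - m * h z)"
      by (intro Henstock_Kurzweil_Integration.integral_cong)
        (simp add: h_def cl power2_eq_square algebra_simps)
    also have "\<dots> = integral {a..b} (\<lambda>z. W z * h z) - integral {a..b} (\<lambda>z. m * h z)"
      by (intro Henstock_Kurzweil_Integration.integral_diff integrable_continuous_real continuous_intros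
          W continuous_on_subset[OF cont_h]) auto
    also have "\<dots> = 0" using \<open>integral {a..b} (\<lambda>z. W z * h z) = 0\<close> h_zero by simp
    finally show ?thesis .
  qed
  have cont_sq: "continuous_on {a..b} (\<lambda>z. X z * (W z - m)\<^sup>2)"
    by (intro continuous_intros W int)
  have XW: "X z * (W z - m)\<^sup>2 = 0" if "z \<in> {a..b}" for z
  proof (rule has_integral_0_cbox_imp_0[of a b "\<lambda>z. X z * (W z - m)\<^sup>2"])
    show "((\<lambda>z. X z * (W z - m)\<^sup>2) has_integral 0) (cbox a b)"
      using integrable_integral[OF integrable_continuous_real[OF cont_sq]] WX_zero by simp
  qed (use cont_sq X_nonneg that cd in auto)
  have "W z = m" if z: "z \<in> {c<..<d}" for z
    using X_in[OF z] XW[of z] z cd by simp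
  then show ?thesis by blast
qed

text \<open>Any interior point and the midpoint lie in a common interval \<open>(c,d)\<close>
  compactly inside \<open>(a,b)\<close>, so the constant is the same throughout; continuity carries
  it to the endpoints.\<close>

lemma constant_if_orthogonal_to_derivatives:
  assumes ab: "a < b" and W: "continuous_on {a..b} W"
    and orth: "\<And>v. test_function a b v \<Longrightarrow> (LINT z:{a..b}|lebesgue. W z * deriv v z) = 0"
    and z: "z \<in> {a..b}"
  shows "W z = W a"
proof -
  have *: "W y = W ((a + b) / 2)" if y: "y \<in> {a<..<b}" for y
  proof -
    define c where "c = (a + min y ((a + b) / 2)) / 2"
    define d where "d = (b + max y ((a + b) / 2)) / 2"
    have cd: "a < c" "c < d" "d < b" and "y \<in> {c<..<d}" "(a + b) / 2 \<in> {c<..<d}"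
      using y ab by (auto simp: c_def d_def min_def max_def field_simps)
    then show ?thesis
      using constant_on_open_subinterval_if_orthogonal_to_derivatives[OF W orth cd] by metis
  qed
  have clos: "closure {a<..<b} = {a..b}" using ab by (rule closure_greaterThanLessThan)
  have const: "W y = W ((a + b) / 2)" if "y \<in> {a..b}" for y
  proof (rule continuous_constant_on_closure[of "{a<..<b}" W])
    show "W x = W ((a + b) / 2)" if "x \<in> {a<..<b}" for x using that by (rule *)
  qed (use W clos that in simp_all)
  have "W z = W ((a + b) / 2)" by (rule const[OF z])
  also have "\<dots> = W a" by (rule const[symmetric]) (use ab in simp)
  finally show ?thesis .
qed

text \<open>The difference of two weak derivatives in \<open>L2\<close> is orthogonal to every test
  function, hence \<open>0\<close>. This evaluates the definite description in
  \<open>weak_deriv\<close>.\<close>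

lemma weak_deriv_eqI:
  assumes g: "g \<in> L2 a b" "has_weak_deriv a b f g"
  shows "weak_deriv a b f = g"
  unfolding weak_deriv_def
proof (rule the_equality)
  fix h assume h: "h \<in> L2 a b \<and> has_weak_deriv a b f h"
  have "h - g = 0"
  proof (rule L2_eq_0_if_orthogonal_to_test_functions)
    show "h - g \<in> L2 a b" using h g subspace_diff[OF subspace_L2] by blast
    fix v assume v: "test_function a b v"
    have "(LINT z:{a..b}|lebesgue. rep (h - g) z * v z) =
        (LINT z:{a..b}|lebesgue. rep h z * v z - rep g z * v z)"
    proof (rule set_lebesgue_integral_cong_AE)
      note [measurable] = test_function_measurable[OF v]
      show "(\<lambda>z. rep (h - g) z * v z) \<in> borel_measurable lebesgue"
        "(\<lambda>z. rep h z * v z - rep g z * v z) \<in> borel_measurable lebesgue"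
        by measurable
      show "AE z\<in>{a..b} in lebesgue. rep (h - g) z * v z = rep h z * v z - rep g z * v z"
        using rep_minus[of h g] by eventually_elim (simp add: left_diff_distrib)
    qed auto
    also have "\<dots> = 0"
      using h g v L2_continuous_mult_integrable[OF _ test_function_continuous(1)[OF v]]
      unfolding has_weak_deriv_def by (subst set_integral_diff(2)) auto
    finally show "(LINT z:{a..b}|lebesgue. rep (h - g) z * v z) = 0" .
  qed
  then show "h = g" by simp
qed (use g in simp)

section \<open>Product rule for weak derivatives and regularity of eigenfunctions\<close>

lemma rep_class_on:
  assumes "continuous_on {a..b} u"
  shows "AE z in lebesgue. rep (class_on a b u) z = (if z \<in> {a..b} then u z else 0)"
  by (rule rep_class_on_AE[OF continuous_on_measurable_if[OF assms]])

lemma rep_mult_on: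
  assumes "continuous_on {a..b} h"
  shows "AE z in lebesgue. rep (mult_on a b h f) z = (if z \<in> {a..b} then h z * rep f z else 0)"
  unfolding mult_on_def
proof (rule rep_class_on_AE)
  have "(\<lambda>z. (if z \<in> {a..b} then h z else 0) * rep f z) \<in> borel_measurable lebesgue"
    by (intro borel_measurable_times continuous_on_measurable_if[OF assms] rep_measurable)
  moreover have "(\<lambda>z. (if z \<in> {a..b} then h z else 0) * rep f z) =
      (\<lambda>z. if z \<in> {a..b} then h z * rep f z else 0)" by auto
  ultimately show "(\<lambda>z. if z \<in> {a..b} then h z * rep f z else 0) \<in> borel_measurable lebesgue"
    by simp
qed

lemma class_on_L2:
  assumes u: "continuous_on {a..b} u" shows "class_on a b u \<in> L2 a b"
proof -
  have rep: "AE z in lebesgue. rep (class_on a b u) z = (if z \<in> {a..b} then u z else 0)"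
    by (rule rep_class_on[OF u])
  have "integrable lebesgue (\<lambda>z. indicator {a..b} z * (u z)\<^sup>2)"
    using continuous_set_integral(1)[of a b "\<lambda>z. (u z)\<^sup>2"] u
    by (simp add: set_integrable_def continuous_intros)
  then have "integrable lebesgue (\<lambda>z. (rep (class_on a b u) z)\<^sup>2)"
    by (rule integrable_cong_AE_imp) (use rep in \<open>auto elim!: eventually_mono\<close>)
  then show ?thesis using rep by (auto simp: L2_iff elim: eventually_mono)
qed

lemma mult_on_L2:
  assumes h: "continuous_on {a..b} h" and f: "f \<in> L2 a b" shows "mult_on a b h f \<in> L2 a b"
proof -
  have rep: "AE z in lebesgue. rep (mult_on a b h f) z = (if z \<in> {a..b} then h z * rep f z else 0)"
    by (rule rep_mult_on[OF h])
  obtain B where B: "B \<ge> 0" "\<And>z. z \<in> {a..b} \<Longrightarrow> \<bar>h z\<bar> \<le> B"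
    using continuous_on_Icc_bounded[OF h] by metis
  have "integrable lebesgue (\<lambda>z. (rep (mult_on a b h f) z)\<^sup>2)"
  proof (rule Bochner_Integration.integrable_bound)
    show "integrable lebesgue (\<lambda>z. B\<^sup>2 * (rep f z)\<^sup>2)" using f by (simp add: L2_def)
    show "AE z in lebesgue. norm ((rep (mult_on a b h f) z)\<^sup>2) \<le> norm (B\<^sup>2 * (rep f z)\<^sup>2)"
      using rep
    proof eventually_elim
      case (elim z)
      have "(h z)\<^sup>2 \<le> B\<^sup>2" if "z \<in> {a..b}" using B(2)[OF that] power_mono[of "\<bar>h z\<bar>" B 2] by simp
      then show ?case using elim by (auto simp: power_mult_distrib intro!: mult_right_mono)
    qed
  qed measurable
  then show ?thesis using rep by (auto simp: L2_iff elim: eventually_mono)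
qed

lemma set_integral_cong_AE_Icc:
  fixes F G :: "real \<Rightarrow> real"
  assumes "F \<in> borel_measurable lebesgue" "set_integrable lebesgue {a..b} G"
    and "AE z in lebesgue. z \<in> {a..b} \<longrightarrow> F z = G z"
  shows "(LINT z:{a..b}|lebesgue. F z) = (LINT z:{a..b}|lebesgue. G z)"
  unfolding set_lebesgue_integral_def
proof (rule integral_cong_AE)
  show "(\<lambda>z. indicator {a..b} z *\<^sub>R F z) \<in> borel_measurable lebesgue"
    using assms(1) by (intro borel_measurable_scaleR borel_measurable_indicator) auto
  show "(\<lambda>z. indicator {a..b} z *\<^sub>R G z) \<in> borel_measurable lebesgue"
    using assms(2) unfolding set_integrable_def by (rule borel_measurable_integrable)
  show "AE z in lebesgue. indicator {a..b} z *\<^sub>R F z = indicator {a..b} z *\<^sub>R G z"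
    using assms(3) by eventually_elim (auto simp: indicator_def)
qed

text \<open>\<open>p\<close> is differentiable only within \<open>[a,b]\<close> and arbitrary
  outside, but \<open>v\<close> vanishes near the endpoints. The open sets \<open>(a,b)\<close> and
  the complement of the support cover the line: on the first the product rule applies, on the second
  the product is \<open>0\<close>.\<close>

lemma test_function_mult:
  assumes v: "test_function a b v"
    and p: "\<And>z. z \<in> {a..b} \<Longrightarrow> (p has_real_derivative p' z) (at z within {a..b})" "continuous_on {a..b} p'"
  shows "test_function a b (\<lambda>z. v z * p z)"
    and "z \<in> {a..b} \<Longrightarrow> deriv (\<lambda>z. v z * p z) z = deriv v z * p z + v z * p' z"
proof -
  define D where "D z = (if z \<in> {a<..<b} then deriv v z * p z + v z * p' z else 0)" for z
  let ?S = "closure {z. v z \<noteq> 0}"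
  have sub: "?S \<subseteq> {a<..<b}" using v by (simp add: test_function_def)
  have p_cont: "continuous_on {a..b} p"
    using p(1) DERIV_continuous continuous_on_eq_continuous_within by blast
  have deriv: "((\<lambda>z. v z * p z) has_real_derivative D z) (at z)" for z
  proof (cases "z \<in> {a<..<b}")
    case True
    have "(p has_real_derivative p' z) (at z)"
      using p(1)[of z] True by (simp add: at_within_Icc_at)
    from DERIV_mult[OF test_function_deriv(1)[OF v] this] show ?thesis
      using True by (simp add: D_def mult.commute)
  next
    case False
    have "D z = 0" using False unfolding D_def by (rule if_not_P)
    then have "((\<lambda>z. 0) has_real_derivative D z) (at z)" by simp
    then show ?thesis
    proof (rule has_field_derivative_transform_within_open[where S="- ?S"])
      show "0 = v y * p y" if "y \<in> - ?S" for y
      proof -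
        have "v y = 0" by (rule test_function_eq_0(1)[OF v]) (use that in blast)
        then show ?thesis by simp
      qed
    qed (use False sub in auto)
  qed
  have "continuous_on ({a<..<b} \<union> - ?S) D"
  proof (rule continuous_on_open_Un)
    have "continuous_on {a<..<b} (\<lambda>z. deriv v z * p z + v z * p' z)"
      by (intro continuous_intros test_function_continuous[OF v] continuous_on_subset[OF p_cont]
          continuous_on_subset[OF p(2)]) auto
    then show "continuous_on {a<..<b} D"
      by (rule continuous_on_cong[THEN iffD1, OF refl, rotated]) (auto simp: D_def)
    have "D z = 0" if "z \<in> - ?S" for z
    proof -
      have "v z = 0" "deriv v z = 0" by (rule test_function_eq_0[OF v], use that in blast)+
      then show ?thesis by (simp add: D_def)
    qed
    then show "continuous_on (- ?S) D"
      using continuous_on_cong[of "- ?S" "- ?S" D "\<lambda>_. 0"] by simp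
  qed auto
  moreover have "{a<..<b} \<union> - ?S = UNIV" using sub by blast
  ultimately have cont: "continuous_on UNIV D" by simp
  show "test_function a b (\<lambda>z. v z * p z)"
  proof (rule test_functionI[OF deriv cont])
    have "closure {z. v z * p z \<noteq> 0} \<subseteq> ?S" by (rule closure_mono) auto
    then show "closure {z. v z * p z \<noteq> 0} \<subseteq> {a<..<b}" using sub by blast
  qed
  show "deriv (\<lambda>z. v z * p z) z = deriv v z * p z + v z * p' z" if "z \<in> {a..b}"
  proof -
    have "deriv (\<lambda>z. v z * p z) z = D z" by (rule DERIV_imp_deriv[OF deriv])
    also have "\<dots> = deriv v z * p z + v z * p' z"
      using test_function_outside[OF v, of z] unfolding D_def by (cases "z \<in> {a<..<b}") simp_all
    finally show ?thesis .
  qed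
qed

text \<open>The Leibniz rule, obtained by testing the weak derivative of \<open>f\<close> with
  \<open>v * p\<close>, which is again a test function.\<close>

lemma has_weak_deriv_mult_on:
  assumes f: "f \<in> L2 a b" and g: "g \<in> L2 a b" and fg: "has_weak_deriv a b f g"
    and p: "\<And>z. z \<in> {a..b} \<Longrightarrow> (p has_real_derivative p' z) (at z within {a..b})" "continuous_on {a..b} p'"
  shows "has_weak_deriv a b (mult_on a b p f) (mult_on a b p g + mult_on a b p' f)"
  unfolding has_weak_deriv_def
proof (intro allI impI)
  fix v assume v: "test_function a b v"
  have p_cont: "continuous_on {a..b} p"
    using p(1) DERIV_continuous continuous_on_eq_continuous_within by blast
  note cv = test_function_continuous[OF v, of "{a..b}"]
  note [measurable] = test_function_measurable[OF v]
  note vp = test_function_mult[OF v p]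
  have int: "set_integrable lebesgue {a..b} (\<lambda>z. rep f z * (deriv v z * p z))"
    "set_integrable lebesgue {a..b} (\<lambda>z. rep f z * (v z * p' z))"
    "set_integrable lebesgue {a..b} (\<lambda>z. rep g z * (v z * p z))"
    by (intro L2_continuous_mult_integrable f g continuous_intros cv p_cont p)+
  have "(LINT z:{a..b}|lebesgue. rep f z * (deriv v z * p z)) +
      (LINT z:{a..b}|lebesgue. rep f z * (v z * p' z)) =
      (LINT z:{a..b}|lebesgue. rep f z * (deriv v z * p z) + rep f z * (v z * p' z))"
    by (rule set_integral_add(2)[symmetric]) (fact int)+
  also have "\<dots> = (LINT z:{a..b}|lebesgue. rep f z * deriv (\<lambda>z. v z * p z) z)"
  proof (rule set_lebesgue_integral_cong)
    show "\<forall>z. z \<in> {a..b} \<longrightarrow> rep f z * (deriv v z * p z) + rep f z * (v z * p' z) =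
        rep f z * deriv (\<lambda>z. v z * p z) z"
      unfolding distrib_left[symmetric] using vp(2) by metis
  qed auto
  also have "\<dots> = - (LINT z:{a..b}|lebesgue. rep g z * (v z * p z))"
    using fg vp(1) by (simp add: has_weak_deriv_def)
  finally have parts: "(LINT z:{a..b}|lebesgue. rep f z * (deriv v z * p z)) =
      - ((LINT z:{a..b}|lebesgue. rep g z * (v z * p z)) +
         (LINT z:{a..b}|lebesgue. rep f z * (v z * p' z)))" by simp
  have "(LINT z:{a..b}|lebesgue. rep (mult_on a b p f) z * deriv v z) =
      (LINT z:{a..b}|lebesgue. rep f z * (deriv v z * p z))"
    by (rule set_integral_cong_AE_Icc[OF _ int(1)])
      (measurable, use rep_mult_on[OF p_cont, of f] in \<open>auto elim!: eventually_mono\<close>)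
  moreover have "(LINT z:{a..b}|lebesgue. rep (mult_on a b p g + mult_on a b p' f) z * v z) =
      (LINT z:{a..b}|lebesgue. rep g z * (v z * p z) + rep f z * (v z * p' z))"
  proof (rule set_integral_cong_AE_Icc)
    show "set_integrable lebesgue {a..b} (\<lambda>z. rep g z * (v z * p z) + rep f z * (v z * p' z))"
      by (intro set_integral_add(1) int)
    show "AE z in lebesgue. z \<in> {a..b} \<longrightarrow> rep (mult_on a b p g + mult_on a b p' f) z * v z =
        rep g z * (v z * p z) + rep f z * (v z * p' z)"
      using rep_plus[of "mult_on a b p g" "mult_on a b p' f"] rep_mult_on[OF p_cont, of g] rep_mult_on[OF p(2), of f]
      by eventually_elim (auto simp: algebra_simps)
  qed measurable
  moreover have "(LINT z:{a..b}|lebesgue. rep g z * (v z * p z) + rep f z * (v z * p' z)) =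
      (LINT z:{a..b}|lebesgue. rep g z * (v z * p z)) + (LINT z:{a..b}|lebesgue. rep f z * (v z * p' z))"
    by (rule set_integral_add(2)) (fact int)+
  ultimately show "(LINT z:{a..b}|lebesgue. rep (mult_on a b p f) z * deriv v z) =
      - (LINT z:{a..b}|lebesgue. rep (mult_on a b p g + mult_on a b p' f) z * v z)"
    using parts by simp
qed

lemma has_weak_deriv_class_on:
  assumes ab: "a \<le> b"
    and deriv: "\<And>z. z \<in> {a..b} \<Longrightarrow> (u has_real_derivative u' z) (at z within {a..b})"
    and cont: "continuous_on {a..b} u'"
  shows "has_weak_deriv a b (class_on a b u) (class_on a b u')"
  unfolding has_weak_deriv_def
proof (intro allI impI)
  fix v assume v: "test_function a b v"
  have u_cont: "continuous_on {a..b} u"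
    using deriv DERIV_continuous continuous_on_eq_continuous_within by blast
  note cv = test_function_continuous[OF v, of "{a..b}"]
  note [measurable] = test_function_measurable[OF v]
  have "(LINT z:{a..b}|lebesgue. rep (class_on a b u) z * deriv v z) = (LINT z:{a..b}|lebesgue. u z * deriv v z)"
    by (rule set_integral_cong_AE_Icc)
      (measurable, intro continuous_set_integral(1) continuous_intros u_cont cv,
       use rep_class_on[OF u_cont] in \<open>auto elim!: eventually_mono\<close>)
  moreover have "(LINT z:{a..b}|lebesgue. rep (class_on a b u') z * v z) = (LINT z:{a..b}|lebesgue. u' z * v z)"
    by (rule set_integral_cong_AE_Icc)
      (measurable, intro continuous_set_integral(1) continuous_intros cont cv,
       use rep_class_on[OF cont] in \<open>auto elim!: eventually_mono\<close>)
  ultimately show "(LINT z:{a..b}|lebesgue. rep (class_on a b u) z * deriv v z) =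
      - (LINT z:{a..b}|lebesgue. rep (class_on a b u') z * v z)"
    using integral_by_parts_test_function[OF v ab deriv cont] by simp
qed

text \<open>Elliptic regularity in dimension one: subtracting from \<open>p u'\<close> a classical primitive of its weak
  derivative leaves a continuous function with weak derivative \<open>0\<close>.\<close>

lemma eigenfunction_classical:
  assumes ab: "a < b"
    and p: "\<And>z. z \<in> {a..b} \<Longrightarrow> (p has_real_derivative p' z) (at z within {a..b})" "continuous_on {a..b} p'"
    and q: "continuous_on {a..b} q" and rho: "continuous_on {a..b} rho" "\<And>z. z \<in> {a..b} \<Longrightarrow> rho z > 0"
    and f: "f \<in> sturm_liouville_domain a b bc_a bc_b"
    and eigen: "- sturm_liouville a b p q rho f = l *\<^sub>R f"
  shows "\<exists>u u'. f = class_on a b u \<and>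
     (\<forall>z\<in>{a..b}. (u has_real_derivative u' z) (at z within {a..b})) \<and>
     (\<forall>z\<in>{a..b}. ((\<lambda>z. p z * u' z) has_real_derivative (q z + l * rho z) * u z) (at z within {a..b})) \<and>
     fst bc_a * u' a + snd bc_a * u a = 0 \<and> fst bc_b * u' b + snd bc_b * u b = 0"
proof -
  obtain u u' where f_eq: "f = class_on a b u"
    and u: "\<And>z. z \<in> {a..b} \<Longrightarrow> (u has_real_derivative u' z) (at z within {a..b})"
    and u'_cont: "continuous_on {a..b} u'"
    and bc: "fst bc_a * u' a + snd bc_a * u a = 0" "fst bc_b * u' b + snd bc_b * u b = 0"
    using f unfolding sturm_liouville_domain_def by blast
  have u_cont: "continuous_on {a..b} u" and p_cont: "continuous_on {a..b} p"
    using u p(1) DERIV_continuous continuous_on_eq_continuous_within by blast+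
  define h where "h = class_on a b u'"
  have h_L2: "h \<in> L2 a b" unfolding h_def by (rule class_on_L2[OF u'_cont])
  have wd: "weak_deriv a b f = h"
    unfolding f_eq h_def
    by (intro weak_deriv_eqI class_on_L2 u'_cont has_weak_deriv_class_on[OF less_imp_le[OF ab] u u'_cont])
  \<comment> \<open>Membership in \<open>H2\<close> supplies a weak second derivative
    \<open>k\<close>; the product rule then exhibits \<open>n\<close> as the weak derivative of
    \<open>- p u'\<close>, so the outer \<open>weak_deriv\<close> in \<open>sturm_liouville\<close>
    can be evaluated.\<close>
  have "h \<in> H1 a b" using f wd by (simp add: sturm_liouville_domain_def H2_def)
  then obtain k where k: "k \<in> L2 a b" "has_weak_deriv a b h k" unfolding H1_def by blast
  define m where "m = mult_on a b (\<lambda>z. - p z) h"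
  define n where "n = mult_on a b (\<lambda>z. - p z) k + mult_on a b (\<lambda>z. - p' z) h"
  have mp: "\<And>z. z \<in> {a..b} \<Longrightarrow> ((\<lambda>z. - p z) has_real_derivative - p' z) (at z within {a..b})"
    "continuous_on {a..b} (\<lambda>z. - p' z)" "continuous_on {a..b} (\<lambda>z. - p z)"
    using p p_cont by (auto intro!: derivative_intros continuous_intros)
  have n_deriv: "has_weak_deriv a b m n"
    unfolding m_def n_def by (rule has_weak_deriv_mult_on[OF h_L2 k mp(1,2)])
  have n_L2: "n \<in> L2 a b"
    unfolding n_def by (intro subspace_add[OF subspace_L2] mult_on_L2 mp(2,3) k h_L2)
  have inv_rho: "continuous_on {a..b} (\<lambda>z. 1 / rho z)"
    by (intro continuous_intros rho(1)) (use rho(2) in fastforce)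
  define y where "y = n + mult_on a b q f"
  have "sturm_liouville a b p q rho f = mult_on a b (\<lambda>z. 1 / rho z) y"
    unfolding sturm_liouville_def wd m_def[symmetric] weak_deriv_eqI[OF n_L2 n_deriv] y_def ..
  then have eq: "- mult_on a b (\<lambda>z. 1 / rho z) y = l *\<^sub>R f" using eigen by simp
  \<comment> \<open>The eigenvalue equation, an identity of classes, is solved almost everywhere for
    \<open>n\<close>; the right-hand side is continuous on \<open>[a,b]\<close> although
    \<open>n\<close> was only in \<open>L2\<close>.\<close>
  have n_rep: "AE z in lebesgue. z \<in> {a..b} \<longrightarrow> rep n z = - ((q z + l * rho z) * u z)"
    using rep_uminus[of "mult_on a b (\<lambda>z. 1 / rho z) y"] rep_scale[of l f]
      rep_mult_on[OF inv_rho, of y] rep_plus[of n "mult_on a b q f"] rep_mult_on[OF q, of f]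
      rep_class_on[OF u_cont]
    unfolding eq y_def[symmetric] f_eq[symmetric]
  proof eventually_elim
    case (elim z)
    show ?case
    proof
      assume z: "z \<in> {a..b}"
      then have "l * u z = - ((1 / rho z) * (rep n z + q z * u z))" using elim by simp
      then have "l * u z * rho z = - (rep n z + q z * u z)" using rho(2)[OF z] by (simp add: field_simps)
      then show "rep n z = - ((q z + l * rho z) * u z)" by (simp add: algebra_simps)
    qed
  qed
  define r where "r z = (q z + l * rho z) * u z" for z
  have r_cont: "continuous_on {a..b} r" unfolding r_def by (intro continuous_intros q rho(1) u_cont)
  define Q where "Q z = integral {a..z} r" for z
  have Q: "(Q has_real_derivative r z) (at z within {a..b})" if "z \<in> {a..b}" for z
    unfolding Q_def by (rule integral_has_real_derivative[OF r_cont that])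
  have Q_cont: "continuous_on {a..b} Q"
    using Q DERIV_continuous continuous_on_eq_continuous_within by blast
  define W where "W z = p z * u' z - Q z" for z
  have W_cont: "continuous_on {a..b} W" unfolding W_def by (intro continuous_intros p_cont u'_cont Q_cont)
  have "W z = W a" if "z \<in> {a..b}" for z
  proof (rule constant_if_orthogonal_to_derivatives[OF ab W_cont _ that])
    fix v assume v: "test_function a b v"
    note cv = test_function_continuous[OF v, of "{a..b}"]
    note [measurable] = test_function_measurable[OF v]
    have 1: "(LINT z:{a..b}|lebesgue. rep m z * deriv v z) = (LINT z:{a..b}|lebesgue. - (p z * u' z * deriv v z))"
    proof (rule set_integral_cong_AE_Icc)
      show "set_integrable lebesgue {a..b} (\<lambda>z. - (p z * u' z * deriv v z))"
        by (intro continuous_set_integral(1) continuous_intros p_cont u'_cont cv)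
      show "AE z in lebesgue. z \<in> {a..b} \<longrightarrow> rep m z * deriv v z = - (p z * u' z * deriv v z)"
        using rep_mult_on[OF mp(3), of h] rep_class_on[OF u'_cont] unfolding m_def[symmetric] h_def[symmetric]
        by eventually_elim auto
    qed measurable
    have 2: "(LINT z:{a..b}|lebesgue. rep n z * v z) = (LINT z:{a..b}|lebesgue. - (r z * v z))"
    proof (rule set_integral_cong_AE_Icc)
      show "set_integrable lebesgue {a..b} (\<lambda>z. - (r z * v z))"
        by (intro continuous_set_integral(1) continuous_intros r_cont cv)
      show "AE z in lebesgue. z \<in> {a..b} \<longrightarrow> rep n z * v z = - (r z * v z)"
        using n_rep by eventually_elim (auto simp: r_def)
    qed measurable
    have 3: "(LINT z:{a..b}|lebesgue. Q z * deriv v z) = - (LINT z:{a..b}|lebesgue. r z * v z)"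
      by (rule integral_by_parts_test_function[OF v less_imp_le[OF ab] Q r_cont])
    have "(LINT z:{a..b}|lebesgue. - (p z * u' z * deriv v z)) = (LINT z:{a..b}|lebesgue. r z * v z)"
    proof -
      have "(LINT z:{a..b}|lebesgue. - (r z * v z)) = - (LINT z:{a..b}|lebesgue. r z * v z)"
        by (intro set_integral_uminus continuous_set_integral(1) continuous_intros r_cont cv)
      then show ?thesis using n_deriv v 1 2 by (simp add: has_weak_deriv_def)
    qed
    moreover have "(LINT z:{a..b}|lebesgue. - (p z * u' z * deriv v z)) = - (LINT z:{a..b}|lebesgue. p z * u' z * deriv v z)"
      by (intro set_integral_uminus continuous_set_integral(1) continuous_intros p_cont u'_cont cv)
    moreover have "(LINT z:{a..b}|lebesgue. W z * deriv v z) =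
        (LINT z:{a..b}|lebesgue. p z * u' z * deriv v z) - (LINT z:{a..b}|lebesgue. Q z * deriv v z)"
      unfolding W_def left_diff_distrib
      by (intro set_integral_diff(2) continuous_set_integral(1) continuous_intros p_cont u'_cont Q_cont cv)
    ultimately show "(LINT z:{a..b}|lebesgue. W z * deriv v z) = 0" using 3 by simp
  qed
  then have pu: "p z * u' z = W a + Q z" if "z \<in> {a..b}" for z using that by (simp add: W_def algebra_simps)
  have "((\<lambda>z. p z * u' z) has_real_derivative r z) (at z within {a..b})" if z: "z \<in> {a..b}" for z
  proof (rule has_field_derivative_transform_within[OF _ zero_less_one z])
    show "((\<lambda>z. W a + Q z) has_real_derivative r z) (at z within {a..b})"
      using DERIV_add[OF DERIV_const Q[OF z]] by simp
  qed (simp add: pu)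
  then show ?thesis using f_eq u bc unfolding r_def by blast
qed

subsection \<open>Eigenvalues of the Sturm-Liouville problem\<close>

lemma deriv_nonneg_imp_le:
  fixes f :: "real \<Rightarrow> real"
  assumes deriv: "\<And>z. z \<in> {a..b} \<Longrightarrow> (f has_real_derivative f' z) (at z within {a..b})"
    and nonneg: "\<And>z. z \<in> {x..y} \<Longrightarrow> 0 \<le> f' z" and xy: "a \<le> x" "x \<le> y" "y \<le> b"
  shows "f x \<le> f y"
proof (rule DERIV_nonneg_imp_increasing_open[OF xy(2)])
  have "continuous_on {a..b} f"
    using deriv DERIV_continuous continuous_on_eq_continuous_within by blast
  then show "continuous_on {x..y} f" by (rule continuous_on_subset) (use xy in auto)
  fix z assume z: "x < z" "z < y"
  have "(f has_real_derivative f' z) (at z)"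
    using deriv[of z] z xy by (simp add: at_within_Icc_at)
  then show "\<exists>d. (f has_real_derivative d) (at z) \<and> 0 \<le> d" using nonneg[of z] z by auto
qed

text \<open>The function \<open>c * (y - a) - f y * exp (- L * (y - a))\<close> is nondecreasing,
  since the exponential is at most \<open>1\<close> on the interval. \<open>0 <= f a\<close> permits
  replacing \<open>z - a\<close> by \<open>b - a\<close> in the exponent, for a bound uniform in
  \<open>z\<close>.\<close>

lemma gronwall:
  fixes f :: "real \<Rightarrow> real"
  assumes deriv: "\<And>z. z \<in> {a..b} \<Longrightarrow> (f has_real_derivative f' z) (at z within {a..b})"
    and le: "\<And>z. z \<in> {a..b} \<Longrightarrow> f' z \<le> L * f z + c" and c: "0 \<le> c" and L: "0 \<le> L"
    and f0: "0 \<le> f a" and z: "z \<in> {a..b}"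
  shows "f z \<le> exp (L * (b - a)) * (f a + c * (b - a))"
proof -
  define g where "g y = c * (y - a) - f y * exp (- L * (y - a))" for y
  have "g a \<le> g z"
  proof (rule deriv_nonneg_imp_le[of a b g "\<lambda>y. c - (f' y - L * f y) * exp (- L * (y - a))"])
    show "(g has_real_derivative c - (f' y - L * f y) * exp (- L * (y - a))) (at y within {a..b})"
      if "y \<in> {a..b}" for y
      unfolding g_def using deriv[OF that] by (auto intro!: derivative_eq_intros simp: algebra_simps)
    show "0 \<le> c - (f' y - L * f y) * exp (- L * (y - a))" if "y \<in> {a..z}" for y
    proof -
      have "(f' y - L * f y) * exp (- L * (y - a)) \<le> c * exp (- L * (y - a))"
        using le[of y] that z by (intro mult_right_mono) auto
      also have "\<dots> \<le> c * 1" using c L that by (intro mult_left_mono) auto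
      finally show ?thesis by simp
    qed
  qed (use z in auto)
  then have "f z * exp (- L * (z - a)) \<le> f a + c * (z - a)" by (simp add: g_def)
  then have "f z * exp (- L * (z - a)) * exp (L * (z - a)) \<le> (f a + c * (z - a)) * exp (L * (z - a))"
    by (intro mult_right_mono) auto
  then have "f z \<le> (f a + c * (z - a)) * exp (L * (z - a))"
    by (simp add: mult.assoc flip: exp_add)
  also have "\<dots> \<le> (f a + c * (b - a)) * exp (L * (b - a))"
    using z c L f0 by (intro mult_mono add_left_mono mult_left_mono) (auto intro!: mult_left_mono add_nonneg_nonneg)
  finally show ?thesis by (simp add: mult.commute)
qed

text \<open>\<open>w\<close> is the quasi-derivative \<open>p u'\<close>. Written as a first-order
  system in \<open>(u, w)\<close>, the equation contains no derivative of \<open>p\<close>.\<close>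

definition sl_solution :: "real \<Rightarrow> real \<Rightarrow> (real \<Rightarrow> real) \<Rightarrow> (real \<Rightarrow> real) \<Rightarrow> (real \<Rightarrow> real) \<Rightarrow>
    real \<Rightarrow> (real \<Rightarrow> real) \<Rightarrow> (real \<Rightarrow> real) \<Rightarrow> bool" where
  "sl_solution a b p q rho l u w \<longleftrightarrow> (\<forall>z\<in>{a..b}.
     (u has_real_derivative w z / p z) (at z within {a..b}) \<and>
     (w has_real_derivative (q z + l * rho z) * u z) (at z within {a..b}))"

lemma sl_solution_scale:
  "sl_solution a b p q rho l u w \<Longrightarrow> sl_solution a b p q rho l (\<lambda>z. c * u z) (\<lambda>z. c * w z)"
  unfolding sl_solution_def by (auto intro!: derivative_eq_intros)

text \<open>Lagrange's identity: the terms with \<open>q\<close> and \<open>1 / p\<close> cancel.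
  Primes mark the second solution, not derivatives.\<close>

lemma wronskian_has_derivative:
  assumes "sl_solution a b p q rho l u w" "sl_solution a b p q rho l' u' w'" "z \<in> {a..b}"
  shows "((\<lambda>z. w z * u' z - w' z * u z) has_real_derivative (l - l') * rho z * u z * u' z) (at z within {a..b})"
  using assms unfolding sl_solution_def by (auto intro!: derivative_eq_intros simp: algebra_simps)

text \<open>The constants bound the coefficients for all \<open>l\<close> in \<open>S\<close>
  simultaneously, so that every estimate in the locale, and in the end the gap between eigenvalues,
  is uniform over \<open>S\<close>.\<close>

locale sl_bounds =
  fixes a b :: real and p q rho :: "real \<Rightarrow> real" and S :: "real set" and P0 P1 K r0 r1 :: real
  assumes ab: "a < b"
    and p_bounds: "0 < P0" "\<And>z. z \<in> {a..b} \<Longrightarrow> P0 \<le> p z" "\<And>z. z \<in> {a..b} \<Longrightarrow> p z \<le> P1"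
    and rho_bounds: "0 < r0" "\<And>z. z \<in> {a..b} \<Longrightarrow> r0 \<le> rho z" "\<And>z. z \<in> {a..b} \<Longrightarrow> rho z \<le> r1"
    and K_bound: "\<And>l z. l \<in> S \<Longrightarrow> z \<in> {a..b} \<Longrightarrow> \<bar>q z + l * rho z\<bar> \<le> K" and K_nonneg: "0 \<le> K"
begin

abbreviation soln :: "real \<Rightarrow> (real \<Rightarrow> real) \<Rightarrow> (real \<Rightarrow> real) \<Rightarrow> bool" where
  "soln \<equiv> sl_solution a b p q rho"

definition L :: real where "L = 1 / P0 + K"

lemma L_nonneg: "0 \<le> L" using p_bounds(1) K_nonneg by (simp add: L_def)

lemma p_pos: "z \<in> {a..b} \<Longrightarrow> p z > 0" using p_bounds(1,2) by force

text \<open>The left side is the derivative of \<open>u^2 + w^2\<close> along a solution with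
  \<open>x = u z\<close> and \<open>y = w z\<close>. It equals
  \<open>1 / p z + q z + l * rho z\<close> times \<open>2 * x * y\<close>, which explains
  \<open>L = 1 / P0 + K\<close>.\<close>

lemma energy_form_le:
  assumes "l \<in> S" "z \<in> {a..b}"
  shows "2 * x * (y / p z) + 2 * y * ((q z + l * rho z) * x) \<le> L * (x\<^sup>2 + y\<^sup>2)"
proof -
  have p: "\<bar>1 / p z + (q z + l * rho z)\<bar> \<le> L"
  proof -
    have "\<bar>1 / p z\<bar> \<le> 1 / P0" using p_bounds assms(2) p_pos[OF assms(2)] by (simp add: frac_le)
    then show ?thesis using K_bound[OF assms] unfolding L_def by linarith
  qed
  have xy: "\<bar>2 * x * y\<bar> \<le> x\<^sup>2 + y\<^sup>2"
    using sum_squares_bound[of x y] sum_squares_bound[of x "- y"] by (simp add: abs_le_iff)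
  have "2 * x * (y / p z) + 2 * y * ((q z + l * rho z) * x) = (1 / p z + (q z + l * rho z)) * (2 * x * y)"
    by (simp add: algebra_simps)
  also have "\<dots> \<le> \<bar>1 / p z + (q z + l * rho z)\<bar> * \<bar>2 * x * y\<bar>"
    by (metis abs_ge_self abs_mult)
  also have "\<dots> \<le> L * (x\<^sup>2 + y\<^sup>2)" using p xy L_nonneg by (intro mult_mono) auto
  finally show ?thesis .
qed

lemma energy_bound:
  assumes l: "l \<in> S" and sol: "soln l u w" and z: "z \<in> {a..b}"
  shows "(u z)\<^sup>2 + (w z)\<^sup>2 \<le> exp (L * (b - a)) * ((u a)\<^sup>2 + (w a)\<^sup>2)"
proof -
  have "(u z)\<^sup>2 + (w z)\<^sup>2 \<le> exp (L * (b - a)) * (((u a)\<^sup>2 + (w a)\<^sup>2) + 0 * (b - a))"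
  proof (rule gronwall[of a b "\<lambda>z. (u z)\<^sup>2 + (w z)\<^sup>2"
        "\<lambda>z. 2 * u z * (w z / p z) + 2 * w z * ((q z + l * rho z) * u z)"])
    show "((\<lambda>z. (u z)\<^sup>2 + (w z)\<^sup>2) has_real_derivative
        2 * u z * (w z / p z) + 2 * w z * ((q z + l * rho z) * u z)) (at z within {a..b})" if "z \<in> {a..b}" for z
      using sol that unfolding sl_solution_def by (auto intro!: derivative_eq_intros)
    show "2 * u z * (w z / p z) + 2 * w z * ((q z + l * rho z) * u z) \<le> L * ((u z)\<^sup>2 + (w z)\<^sup>2) + 0"
      if "z \<in> {a..b}" for z using energy_form_le[OF l that] by simp
  qed (use L_nonneg z in auto)
  then show ?thesis by simp
qed

lemma solution_eq_0:
  assumes "l \<in> S" "soln l u w" "u a = 0" "w a = 0" "z \<in> {a..b}"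
  shows "u z = 0"
  using energy_bound[OF assms(1,2,5)] assms(3,4) sum_power2_le_zero_iff[of "u z" "w z"] by simp

text \<open>Gronwall bound for both components of a solution with initial values \<open>v1\<close>
  and \<open>v2\<close>; it does not depend on \<open>l\<close>.\<close>

definition M :: "real \<Rightarrow> real \<Rightarrow> real" where
  "M v1 v2 = sqrt (exp (L * (b - a)) * (v1\<^sup>2 + v2\<^sup>2))"

lemma solution_le:
  assumes "l \<in> S" "soln l u w" "z \<in> {a..b}"
  shows "\<bar>u z\<bar> \<le> M (u a) (w a)" "\<bar>w z\<bar> \<le> M (u a) (w a)"
proof -
  have "(u z)\<^sup>2 \<le> exp (L * (b - a)) * ((u a)\<^sup>2 + (w a)\<^sup>2)" "(w z)\<^sup>2 \<le> exp (L * (b - a)) * ((u a)\<^sup>2 + (w a)\<^sup>2)"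
    using energy_bound[OF assms] zero_le_power2[of "u z"] zero_le_power2[of "w z"] by linarith+
  then show "\<bar>u z\<bar> \<le> M (u a) (w a)" "\<bar>w z\<bar> \<le> M (u a) (w a)"
    unfolding M_def by (auto intro: real_le_rsqrt simp: power2_abs)
qed

text \<open>The differences solve the system for \<open>l\<close> with the extra term
  \<open>(l - l') * rho * u'\<close> in the second equation. Young's inequality splits the product
  of this term with \<open>w - w'\<close>; that accounts for \<open>L + 1\<close> in the exponent
  and for the square of \<open>l - l'\<close>.\<close>

lemma difference_bound:
  assumes l: "l \<in> S" and sol: "soln l u w" and sol': "soln l' u' w'"
    and l': "l' \<in> S" and init: "u' a = u a" "w' a = w a" and z: "z \<in> {a..b}"
  shows "(u z - u' z)\<^sup>2 \<le> exp ((L + 1) * (b - a)) * (r1 * M (u a) (w a))\<^sup>2 * (b - a) * (l - l')\<^sup>2"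
proof -
  let ?f = "\<lambda>z. (u z - u' z)\<^sup>2 + (w z - w' z)\<^sup>2"
  let ?c = "(l - l')\<^sup>2 * (r1 * M (u a) (w a))\<^sup>2"
  have "?f z \<le> exp ((L + 1) * (b - a)) * (?f a + ?c * (b - a))"
  proof (rule gronwall[of a b ?f "\<lambda>z. 2 * (u z - u' z) * ((w z - w' z) / p z) +
        2 * (w z - w' z) * ((q z + l * rho z) * (u z - u' z)) + 2 * (w z - w' z) * ((l - l') * (rho z * u' z))"])
    show "(?f has_real_derivative 2 * (u z - u' z) * ((w z - w' z) / p z) +
        2 * (w z - w' z) * ((q z + l * rho z) * (u z - u' z)) + 2 * (w z - w' z) * ((l - l') * (rho z * u' z)))
        (at z within {a..b})" if "z \<in> {a..b}" for z
    proof -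
      have "(u has_real_derivative w z / p z) (at z within {a..b})" "(u' has_real_derivative w' z / p z) (at z within {a..b})"
        "(w has_real_derivative (q z + l * rho z) * u z) (at z within {a..b})"
        "(w' has_real_derivative (q z + l' * rho z) * u' z) (at z within {a..b})"
        using sol sol' that by (auto simp: sl_solution_def)
      then have "(?f has_real_derivative 2 * (u z - u' z) * (w z / p z - w' z / p z) +
          2 * (w z - w' z) * ((q z + l * rho z) * u z - (q z + l' * rho z) * u' z)) (at z within {a..b})"
        by (auto intro!: derivative_eq_intros simp: algebra_simps diff_divide_distrib)
      then show ?thesis by (simp add: algebra_simps diff_divide_distrib)
    qed
    show "2 * (u z - u' z) * ((w z - w' z) / p z) + 2 * (w z - w' z) * ((q z + l * rho z) * (u z - u' z)) +
        2 * (w z - w' z) * ((l - l') * (rho z * u' z)) \<le> (L + 1) * ?f z + ?c" if z: "z \<in> {a..b}" for z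
    proof -
      have "2 * (u z - u' z) * ((w z - w' z) / p z) + 2 * (w z - w' z) * ((q z + l * rho z) * (u z - u' z)) \<le> L * ?f z"
        by (rule energy_form_le[OF l z])
      moreover have "2 * (w z - w' z) * ((l - l') * (rho z * u' z)) \<le> (w z - w' z)\<^sup>2 + ((l - l') * (rho z * u' z))\<^sup>2"
        by (rule sum_squares_bound)
      moreover have "((l - l') * (rho z * u' z))\<^sup>2 \<le> ?c"
      proof -
        have "\<bar>rho z * u' z\<bar> \<le> r1 * M (u a) (w a)"
          using rho_bounds(1) rho_bounds(2,3)[OF z] solution_le(1)[OF l' sol' z] init
          unfolding abs_mult by (intro mult_mono) auto
        then have "(rho z * u' z)\<^sup>2 \<le> (r1 * M (u a) (w a))\<^sup>2"
          using power_mono[of "\<bar>rho z * u' z\<bar>" _ 2] by simp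
        then show ?thesis by (simp add: power_mult_distrib mult_left_mono)
      qed
      moreover have "(w z - w' z)\<^sup>2 \<le> ?f z" by simp
      ultimately show ?thesis by (simp only: distrib_right mult_1_left)
    qed
  qed (use L_nonneg z init in auto)
  moreover have "(u z - u' z)\<^sup>2 \<le> ?f z" by simp
  moreover have "?f a = 0" using init by simp
  ultimately show ?thesis by (simp only: add_0_left mult_ac)
qed

lemma mean_value_bound:
  fixes g :: "real \<Rightarrow> real"
  assumes "\<And>z. z \<in> {a..b} \<Longrightarrow> (g has_real_derivative g' z) (at z within {a..b})"
    and "\<And>z. z \<in> {a..b} \<Longrightarrow> \<bar>g' z\<bar> \<le> B" and z: "z \<in> {a..b}"
  shows "\<bar>g z - g a\<bar> \<le> B * (z - a)"
proof -
  have "g a + B * (a - a) \<le> g z + B * (z - a)"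
  proof (rule deriv_nonneg_imp_le[of a b "\<lambda>z. g z + B * (z - a)" "\<lambda>z. g' z + B"])
    show "((\<lambda>z. g z + B * (z - a)) has_real_derivative g' z + B) (at z within {a..b})" if "z \<in> {a..b}" for z
      using assms(1)[OF that] by (auto intro!: derivative_eq_intros)
    show "0 \<le> g' y + B" if "y \<in> {a..z}" for y using assms(2)[of y] that z by force
  qed (use z in auto)
  moreover have "B * (a - a) - g a \<le> B * (z - a) - g z"
  proof (rule deriv_nonneg_imp_le[of a b "\<lambda>z. B * (z - a) - g z" "\<lambda>z. B - g' z"])
    show "((\<lambda>z. B * (z - a) - g z) has_real_derivative B - g' z) (at z within {a..b})" if "z \<in> {a..b}" for z
      using assms(1)[OF that] by (auto intro!: derivative_eq_intros)
    show "0 \<le> B - g' y" if "y \<in> {a..z}" for y using assms(2)[of y] that z by force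
  qed (use z in auto)
  ultimately show ?thesis by (simp add: abs_le_iff)
qed

text \<open>Near \<open>a\<close> a solution is governed by its initial values: if \<open>v1\<close>
  is nonzero, \<open>u\<close> keeps at least half its size; if \<open>v1 = 0\<close>,
  \<open>w\<close> keeps the sign and half the size of \<open>v2\<close>, so that \<open>u\<close>
  grows linearly in absolute value. A bound linear in \<open>z - a\<close> covers both
  cases.\<close>

lemma solution_lower_bound:
  assumes v: "v1 \<noteq> 0 \<or> v2 \<noteq> 0"
  shows "\<exists>k>0. \<exists>h>0. a + h \<le> b \<and> (\<forall>l\<in>S. \<forall>u w. soln l u w \<longrightarrow> u a = v1 \<longrightarrow> w a = v2 \<longrightarrow>
    (\<forall>z\<in>{a..a + h}. k * (z - a) \<le> \<bar>u z\<bar>))"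
proof (cases "v1 = 0")
  case False
  have M: "M v1 v2 \<ge> 0" by (simp add: M_def)
  define B where "B = M v1 v2 / P0 + 1"
  have B: "B > 0" using M p_bounds(1) by (simp add: B_def add_nonneg_pos)
  \<comment> \<open>On length \<open>h\<close> the solution moves by at most half of its initial
    value; \<open>h <= 1\<close> turns the resulting constant lower bound into one that is linear in
    \<open>z - a\<close>.\<close>
  define h where "h = min (min 1 (b - a)) (\<bar>v1\<bar> / (2 * B))"
  have h: "h > 0" "a + h \<le> b" "h \<le> 1"
    using B ab False by (auto simp: h_def)
  have "h \<le> \<bar>v1\<bar> / (2 * B)" by (simp add: h_def)
  then have Bh: "B * h \<le> \<bar>v1\<bar> / 2" using B by (simp add: field_simps)
  have "\<bar>v1\<bar> / 2 * (z - a) \<le> \<bar>u z\<bar>"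
    if l: "l \<in> S" and sol: "soln l u w" and init: "u a = v1" "w a = v2" and z: "z \<in> {a..a + h}" for l u w z
  proof -
    have "\<bar>u z - u a\<bar> \<le> B * (z - a)"
    proof (rule mean_value_bound)
      fix y assume y: "y \<in> {a..b}"
      show "(u has_real_derivative w y / p y) (at y within {a..b})" using sol y by (simp add: sl_solution_def)
      have "\<bar>w y / p y\<bar> \<le> M v1 v2 / P0"
        using solution_le(2)[OF l sol y] init p_bounds(1,2) y p_pos[OF y] M by (simp add: abs_divide frac_le)
      then show "\<bar>w y / p y\<bar> \<le> B" by (simp add: B_def)
    qed (use z h in auto)
    also have "\<dots> \<le> B * h" using z B by (intro mult_left_mono) auto
    also have "\<dots> \<le> \<bar>v1\<bar> / 2" by (rule Bh)
    finally have "\<bar>v1\<bar> / 2 \<le> \<bar>u z\<bar>" using init by linarith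
    moreover have "\<bar>v1\<bar> / 2 * (z - a) \<le> \<bar>v1\<bar> / 2 * 1" using z h by (intro mult_left_mono) auto
    ultimately show ?thesis by linarith
  qed
  then show ?thesis using h False by (intro exI[of _ "\<bar>v1\<bar> / 2"] conjI exI[of _ h]) auto
next
  case True
  then have v2: "v2 \<noteq> 0" using v by simp
  have M: "M v1 v2 \<ge> 0" by (simp add: M_def)
  define B where "B = K * M v1 v2 + 1"
  have B: "B > 0" using M K_nonneg by (simp add: B_def add_nonneg_pos)
  define h where "h = min (b - a) (\<bar>v2\<bar> / (2 * B))"
  have h: "h > 0" "a + h \<le> b"
    using B ab v2 by (auto simp: h_def)
  have "h \<le> \<bar>v2\<bar> / (2 * B)" by (simp add: h_def)
  then have Bh: "B * h \<le> \<bar>v2\<bar> / 2" using B by (simp add: field_simps)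
  have P1: "P1 > 0" using p_bounds(1) p_bounds(2,3)[of a] ab by simp
  \<comment> \<open>The sign of \<open>v2\<close> reduces both orientations to an increasing
    \<open>s * u\<close>.\<close>
  define s where "s = sgn v2"
  have s: "s * v2 = \<bar>v2\<bar>" "\<bar>s\<bar> = 1" using v2 by (auto simp: s_def sgn_if)
  have "\<bar>v2\<bar> / (2 * P1) * (z - a) \<le> \<bar>u z\<bar>"
    if l: "l \<in> S" and sol: "soln l u w" and init: "u a = v1" "w a = v2" and z: "z \<in> {a..a + h}" for l u w z
  proof -
    have w: "\<bar>v2\<bar> / 2 \<le> s * w y" if y: "y \<in> {a..a + h}" for y
    proof -
      have "\<bar>w y - w a\<bar> \<le> B * (y - a)"
      proof (rule mean_value_bound)
        fix x assume x: "x \<in> {a..b}"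
        show "(w has_real_derivative (q x + l * rho x) * u x) (at x within {a..b})"
          using sol x by (simp add: sl_solution_def)
        have "\<bar>(q x + l * rho x) * u x\<bar> \<le> K * M v1 v2"
          using solution_le(1)[OF l sol x] init K_bound[OF l x] K_nonneg unfolding abs_mult by (intro mult_mono) auto
        then show "\<bar>(q x + l * rho x) * u x\<bar> \<le> B" by (simp add: B_def)
      qed (use y h in auto)
      also have "\<dots> \<le> B * h" using y B by (intro mult_left_mono) auto
      also have "\<dots> \<le> \<bar>v2\<bar> / 2" by (rule Bh)
      finally have "\<bar>s * (w y - v2)\<bar> \<le> \<bar>v2\<bar> / 2" using s(2) init by (simp add: abs_mult)
      then have "\<bar>s * w y - \<bar>v2\<bar>\<bar> \<le> \<bar>v2\<bar> / 2" using s(1) by (simp add: right_diff_distrib)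
      then show ?thesis by linarith
    qed
    have "s * u a - \<bar>v2\<bar> / (2 * P1) * (a - a) \<le> s * u z - \<bar>v2\<bar> / (2 * P1) * (z - a)"
    proof (rule deriv_nonneg_imp_le[of a b "\<lambda>z. s * u z - \<bar>v2\<bar> / (2 * P1) * (z - a)" "\<lambda>z. s * (w z / p z) - \<bar>v2\<bar> / (2 * P1)"])
      show "((\<lambda>z. s * u z - \<bar>v2\<bar> / (2 * P1) * (z - a)) has_real_derivative s * (w y / p y) - \<bar>v2\<bar> / (2 * P1)) (at y within {a..b})"
        if "y \<in> {a..b}" for y
      proof -
        have "(u has_real_derivative w y / p y) (at y within {a..b})" using sol that by (simp add: sl_solution_def)
        then show ?thesis using P1 by (auto intro!: derivative_eq_intros)
      qed
      show "0 \<le> s * (w y / p y) - \<bar>v2\<bar> / (2 * P1)" if y: "y \<in> {a..z}" for y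
      proof -
        have y': "y \<in> {a..b}" "y \<in> {a..a + h}" using y z h by auto
        have "\<bar>v2\<bar> / 2 / P1 \<le> s * w y / p y"
          using w[OF y'(2)] p_bounds(3)[OF y'(1)] p_pos[OF y'(1)] by (intro frac_le) auto
        then show ?thesis by simp
      qed
    qed (use z h in auto)
    then have "\<bar>v2\<bar> / (2 * P1) * (z - a) \<le> s * u z" using init True by simp
    also have "\<dots> \<le> \<bar>s * u z\<bar>" by simp
    also have "\<dots> = \<bar>u z\<bar>" using s(2) by (simp add: abs_mult)
    finally show ?thesis .
  qed
  then show ?thesis using h v2 P1 by (intro exI[of _ "\<bar>v2\<bar> / (2 * P1)"] conjI exI[of _ h]) auto
qed

text \<open>If \<open>l\<close> and \<open>l'\<close> are close then so are \<open>u\<close> and \<open>u'\<close>, and hence the integral of \<open>rho u u'\<close>, which is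
  the increment of the Wronskian divided by \<open>l - l'\<close>, is positive.\<close>

lemma eigenvalue_gap:
  assumes v: "v1 \<noteq> 0 \<or> v2 \<noteq> 0"
  shows "\<exists>d>0. \<forall>l\<in>S. \<forall>l'\<in>S. \<forall>u w u' w'. l \<noteq> l' \<longrightarrow>
    soln l u w \<longrightarrow> soln l' u' w' \<longrightarrow>
    u a = v1 \<longrightarrow> w a = v2 \<longrightarrow> u' a = v1 \<longrightarrow> w' a = v2 \<longrightarrow> w b * u' b = w' b * u b \<longrightarrow> d \<le> \<bar>l - l'\<bar>"
proof -
  obtain k h where k: "k > 0" and h: "h > 0" "a + h \<le> b"
    and low: "\<And>l u w z. l \<in> S \<Longrightarrow> soln l u w \<Longrightarrow> u a = v1 \<Longrightarrow> w a = v2 \<Longrightarrow>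
      z \<in> {a..a + h} \<Longrightarrow> k * (z - a) \<le> \<bar>u z\<bar>"
    using solution_lower_bound[OF v] by blast
  have r1: "r1 > 0" using rho_bounds(1) rho_bounds(2,3)[of a] ab by simp
  define C where "C = exp ((L + 1) * (b - a)) * (r1 * M v1 v2)\<^sup>2 * (b - a)"
  have C: "C \<ge> 0" using ab by (simp add: C_def)
  \<comment> \<open>The integral of \<open>r0 / 2 * (k * (z - a))^2\<close> over
    \<open>[a, a + h]\<close>, a lower bound for half the weighted squared norm of
    \<open>u\<close>.\<close>
  define c0 where "c0 = r0 * k\<^sup>2 / 6 * h ^ 3"
  have c0: "c0 > 0" using rho_bounds(1) k h by (simp add: c0_def)
  \<comment> \<open>\<open>+ 1\<close> ensures a positive denominator in \<open>d\<close>; the rest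
    is the factor of \<open>(l - l')^2\<close> in the upper bound obtained at
    \<open>b\<close>.\<close>
  define D where "D = r1 * C * (b - a) / 2 + 1"
  have D: "D > 0" using r1 C ab by (simp add: D_def add_nonneg_pos)
  define d where "d = sqrt (c0 / D)"
  have d: "d > 0" using c0 D by (simp add: d_def)
  have "d \<le> \<bar>l - l'\<bar>"
    if l: "l \<in> S" "l' \<in> S" and ne: "l \<noteq> l'" and sol: "soln l u w"
      and sol': "soln l' u' w'"
      and init: "u a = v1" "w a = v2" "u' a = v1" "w' a = v2" and bdry: "w b * u' b = w' b * u b" for l l' u w u' w'
  proof -
    have diff: "(u z - u' z)\<^sup>2 \<le> C * (l - l')\<^sup>2" if "z \<in> {a..b}" for z
      using difference_bound[OF l(1) sol sol' l(2) _ _ that] init by (simp add: C_def)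
    \<comment> \<open>\<open>m\<close> bounds the loss from replacing \<open>rho * u * u'\<close> by
      \<open>rho * u^2 / 2\<close>. Adding \<open>m * (z - a)\<close> to the divided Wronskian makes
      \<open>G\<close> nondecreasing; it starts at \<open>0\<close>, and the condition at
      \<open>b\<close> leaves only \<open>m * (b - a)\<close> there. Hence
      \<open>c0 <= m * (b - a)\<close>, where \<open>m\<close> is proportional to
      \<open>(l - l')^2\<close>.\<close>
    define m where "m = r1 * C * (l - l')\<^sup>2 / 2"
    define G where "G z = (w z * u' z - w' z * u z) / (l - l') + m * (z - a)" for z
    have G': "(G has_real_derivative rho z * u z * u' z + m) (at z within {a..b})" if "z \<in> {a..b}" for z
    proof -
      have "((\<lambda>z. m * (z - a)) has_real_derivative m) (at z within {a..b})"
        by (auto intro!: derivative_eq_intros)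
      from DERIV_add[OF DERIV_cdivide[OF wronskian_has_derivative[OF sol sol' that], of "l - l'"] this]
      show ?thesis using ne by (simp add: G_def[abs_def] mult.assoc)
    qed
    have lower: "r0 / 2 * (u z)\<^sup>2 \<le> rho z * u z * u' z + m" if z: "z \<in> {a..b}" for z
    proof -
      have "(u z)\<^sup>2 / 2 - (u z - u' z)\<^sup>2 / 2 \<le> u z * u' z"
        using zero_le_power2[of "u' z"] by (simp add: power2_diff field_simps)
      then have "rho z * ((u z)\<^sup>2 / 2 - (u z - u' z)\<^sup>2 / 2) \<le> rho z * (u z * u' z)"
        using rho_bounds(1,2)[of] z by (intro mult_left_mono) force+
      moreover have "r0 / 2 * (u z)\<^sup>2 \<le> rho z / 2 * (u z)\<^sup>2"
        using rho_bounds(2)[OF z] by (intro mult_right_mono) auto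
      moreover have "rho z * ((u z - u' z)\<^sup>2 / 2) \<le> r1 * (C * (l - l')\<^sup>2 / 2)"
        using rho_bounds(3)[OF z] diff[OF z] r1 by (intro mult_mono) auto
      ultimately show ?thesis by (simp add: m_def right_diff_distrib)
    qed
    have "G a = 0" using init by (simp add: G_def)
    moreover have "G a - r0 * k\<^sup>2 / 6 * (a - a) ^ 3 \<le> G (a + h) - r0 * k\<^sup>2 / 6 * ((a + h) - a) ^ 3"
    proof (rule deriv_nonneg_imp_le[of a b "\<lambda>z. G z - r0 * k\<^sup>2 / 6 * (z - a) ^ 3"
          "\<lambda>z. rho z * u z * u' z + m - r0 * k\<^sup>2 / 2 * (z - a)\<^sup>2"])
      show "((\<lambda>z. G z - r0 * k\<^sup>2 / 6 * (z - a) ^ 3) has_real_derivative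
          rho z * u z * u' z + m - r0 * k\<^sup>2 / 2 * (z - a)\<^sup>2) (at z within {a..b})" if "z \<in> {a..b}" for z
        using G'[OF that] by (auto intro!: derivative_eq_intros)
      show "0 \<le> rho z * u z * u' z + m - r0 * k\<^sup>2 / 2 * (z - a)\<^sup>2" if z: "z \<in> {a..a + h}" for z
      proof -
        have "(k * (z - a))\<^sup>2 \<le> \<bar>u z\<bar>\<^sup>2"
          using low[OF l(1) sol init(1,2) z] k z by (intro power_mono) auto
        then have "r0 / 2 * (k * (z - a))\<^sup>2 \<le> r0 / 2 * (u z)\<^sup>2"
          using rho_bounds(1) by (intro mult_left_mono) auto
        then show ?thesis using lower[of z] z h by (simp add: power_mult_distrib)
      qed
    qed (use h in auto)
    moreover have "G (a + h) \<le> G b"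
    proof (rule deriv_nonneg_imp_le[OF G'])
      show "0 \<le> rho z * u z * u' z + m" if "z \<in> {a + h..b}" for z
      proof -
        have "0 \<le> r0 / 2 * (u z)\<^sup>2" using rho_bounds(1) by simp
        also have "\<dots> \<le> rho z * u z * u' z + m" using that h by (intro lower) auto
        finally show ?thesis .
      qed
    qed (use h in auto)
    moreover have "G b = m * (b - a)" using bdry by (simp add: G_def)
    ultimately have "c0 \<le> m * (b - a)" by (simp add: c0_def)
    also have "\<dots> = r1 * C * (b - a) / 2 * (l - l')\<^sup>2" by (simp add: m_def)
    also have "\<dots> \<le> D * (l - l')\<^sup>2" by (simp add: D_def distrib_right)
    finally have "c0 / D \<le> (l - l')\<^sup>2" using D by (simp add: divide_le_eq mult.commute)
    then have "d \<le> sqrt ((l - l')\<^sup>2)" unfolding d_def by (rule real_sqrt_le_mono)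
    then show ?thesis by simp
  qed
  then show ?thesis using d by blast
qed

end

section \<open>Boundary conditions, orthogonality and finiteness of eigenvalues in a bounded
  window\<close>

lemma boundary_wronskian_eq_0:
  fixes x y x' y' :: real
  assumes "c \<noteq> (0, 0)" "fst c * x' + snd c * x = 0" "fst c * y' + snd c * y = 0"
  shows "x' * y = y' * x"
proof -
  \<comment> \<open>Cramer's rule: a nonzero \<open>c\<close> annihilated by both rows forces the
    determinant to vanish.\<close>
  have "fst c * (x' * y - y' * x) = (fst c * x' + snd c * x) * y - (fst c * y' + snd c * y) * x"
    "snd c * (x' * y - y' * x) = (fst c * y' + snd c * y) * x' - (fst c * x' + snd c * x) * y'"
    by (simp_all add: algebra_simps)
  then have "fst c * (x' * y - y' * x) = 0" "snd c * (x' * y - y' * x) = 0"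
    using assms by simp_all
  then show ?thesis using assms(1) by (cases c) auto
qed

text \<open>The boundary condition cuts out the line spanned by \<open>(fst c, - snd c)\<close>, and
  \<open>t\<close> is the coefficient of the orthogonal projection onto it. All eigenfunctions
  therefore share their initial direction at \<open>a\<close>.\<close>

lemma boundary_condition_direction:
  fixes x x' :: real
  assumes "c \<noteq> (0, 0)" "fst c * x' + snd c * x = 0"
  shows "\<exists>t. x = t * fst c \<and> x' = - (t * snd c)"
proof -
  define D where "D = (fst c)\<^sup>2 + (snd c)\<^sup>2"
  have D: "D \<noteq> 0" using assms(1) by (cases c) (auto simp: D_def)
  have "(fst c * x - snd c * x') * fst c = D * x - snd c * (fst c * x' + snd c * x)"
    "(fst c * x - snd c * x') * snd c = fst c * (fst c * x' + snd c * x) - D * x'"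
    by (simp_all add: D_def algebra_simps power2_eq_square)
  then have "D * x = (fst c * x - snd c * x') * fst c" "D * x' = - ((fst c * x - snd c * x') * snd c)"
    using assms(2) by simp_all
  then have "x = (fst c * x - snd c * x') / D * fst c" "x' = - ((fst c * x - snd c * x') / D * snd c)"
    using D by (simp_all add: field_simps)
  then show ?thesis by blast
qed

lemma inner_weight_class_on:
  assumes "continuous_on {a..b} u" "continuous_on {a..b} v" "continuous_on {a..b} rho"
  shows "inner_weight a b rho (class_on a b u) (class_on a b v) = integral {a..b} (\<lambda>z. u z * v z * rho z)"
proof -
  have cont: "continuous_on {a..b} (\<lambda>z. u z * v z * rho z)" by (intro continuous_intros assms)
  have "inner_weight a b rho (class_on a b u) (class_on a b v) =
      (LINT z:{a..b}|lebesgue. rep (class_on a b u) z * rep (class_on a b v) z *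
        (if z \<in> {a..b} then rho z else 0))"
    unfolding inner_weight_def by (rule set_lebesgue_integral_cong) auto
  also have "\<dots> = (LINT z:{a..b}|lebesgue. u z * v z * rho z)"
  proof (rule set_integral_cong_AE_Icc)
    show "(\<lambda>z. rep (class_on a b u) z * rep (class_on a b v) z *
        (if z \<in> {a..b} then rho z else 0)) \<in> borel_measurable lebesgue"
      by (intro borel_measurable_times rep_measurable continuous_on_measurable_if assms)
    show "AE z in lebesgue. z \<in> {a..b} \<longrightarrow> rep (class_on a b u) z * rep (class_on a b v) z *
        (if z \<in> {a..b} then rho z else 0) = u z * v z * rho z"
      using rep_class_on[OF assms(1)] rep_class_on[OF assms(2)] by eventually_elim auto
  qed (rule continuous_set_integral(1)[OF cont])
  finally show ?thesis by (simp add: continuous_set_integral(2)[OF cont])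
qed

lemma sl_solution_continuous:
  assumes "sl_solution a b p q rho l u w"
  shows "continuous_on {a..b} u" "continuous_on {a..b} w"
  using assms DERIV_continuous continuous_on_eq_continuous_within unfolding sl_solution_def by blast+

text \<open>Integrating Lagrange's identity leaves the Wronskian at the two ends, where
  \<open>bdry\<close> annihilates it.\<close>

lemma sl_solutions_orthogonal:
  assumes ab: "a \<le> b" and ne: "l \<noteq> l'" and sol: "sl_solution a b p q rho l u w"
    and sol': "sl_solution a b p q rho l' u' w'" and rho: "continuous_on {a..b} rho"
    and bdry: "w a * u' a = w' a * u a" "w b * u' b = w' b * u b"
  shows "inner_weight a b rho (class_on a b u) (class_on a b u') = 0"
proof -
  note cont = sl_solution_continuous[OF sol] sl_solution_continuous[OF sol']
  have "((\<lambda>z. (l - l') * rho z * u z * u' z) has_integral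
      (w b * u' b - w' b * u b) - (w a * u' a - w' a * u a)) {a..b}"
    using wronskian_has_derivative[OF sol sol'] 
    by (intro fundamental_theorem_of_calculus[OF ab]) (simp add: has_real_derivative_iff_has_vector_derivative)
  then have "integral {a..b} (\<lambda>z. (l - l') * rho z * u z * u' z) = 0"
    using bdry by (simp add: integral_unique)
  moreover have "integral {a..b} (\<lambda>z. (l - l') * rho z * u z * u' z) =
      (l - l') * integral {a..b} (\<lambda>z. u z * u' z * rho z)"
    by (simp add: mult_ac flip: integral_mult_right)
  ultimately show ?thesis using ne by (simp add: inner_weight_class_on cont rho)
qed

text \<open>Near an accumulation point there would be two elements of \<open>S\<close> within
  \<open>d / 2\<close> of it; choosing the second closer than the first makes them
  different.\<close>

lemma finite_if_separated_and_bounded: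
  fixes S :: "real set"
  assumes "S \<subseteq> {x..y}" "d > 0" and sep: "\<And>s t. s \<in> S \<Longrightarrow> t \<in> S \<Longrightarrow> s \<noteq> t \<Longrightarrow> d \<le> \<bar>s - t\<bar>"
  shows "finite S"
proof (rule ccontr)
  assume "infinite S"
  then obtain z where z: "z islimpt S"
    using Heine_Borel_imp_Bolzano_Weierstrass[OF compact_Icc _ assms(1)] by blast
  obtain s where s: "s \<in> S" "s \<noteq> z" "dist s z < d / 2"
    using z assms(2) unfolding islimpt_approachable by (meson half_gt_zero)
  have "min (d / 2) (dist s z) > 0" using s assms(2) by simp
  then obtain t where t: "t \<in> S" "t \<noteq> z" "dist t z < min (d / 2) (dist s z)"
    using z unfolding islimpt_approachable by meson
  then have "s \<noteq> t" by auto
  then have "d \<le> \<bar>s - t\<bar>" using sep s t by blast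
  moreover have "dist s t < d" using dist_triangle2[of s t z] s t by simp
  ultimately show False by (simp add: dist_real_def)
qed

text \<open>A bounded window makes \<open>q + l * rho\<close> uniformly bounded, so
  \<open>sl_bounds\<close> applies. The gap compares solutions with equal initial values; each
  eigenfunction is brought to the values dictated by \<open>bc_a\<close> through division by its
  nonzero factor \<open>t l\<close>.\<close>

lemma finite_eigenvalues_above:
  assumes ab: "a < b"
    and p: "continuous_on {a..b} p" "\<And>z. z \<in> {a..b} \<Longrightarrow> p z > 0"
    and q: "continuous_on {a..b} q" and rho: "continuous_on {a..b} rho" "\<And>z. z \<in> {a..b} \<Longrightarrow> rho z > 0"
    and bc: "bc_a \<noteq> (0, 0)" "bc_b \<noteq> (0, 0)"
    and sol: "\<And>l. l \<in> S \<Longrightarrow> sl_solution a b p q rho l (u l) (\<lambda>z. p z * u' l z)"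
    and nz: "\<And>l. l \<in> S \<Longrightarrow> \<exists>z\<in>{a..b}. u l z \<noteq> 0"
    and bca: "\<And>l. l \<in> S \<Longrightarrow> fst bc_a * u' l a + snd bc_a * u l a = 0"
    and bcb: "\<And>l. l \<in> S \<Longrightarrow> fst bc_b * u' l b + snd bc_b * u l b = 0"
    and S: "S \<subseteq> {x..y}"
  shows "finite S"
proof -
  have ne: "{a..b} \<noteq> {}" using ab by simp
  have ends: "a \<in> {a..b}" "b \<in> {a..b}" using ab by auto
  obtain p0 where p0: "p0 \<in> {a..b}" "\<forall>z\<in>{a..b}. p p0 \<le> p z"
    using continuous_attains_inf[OF compact_Icc ne p(1)] by blast
  obtain p1 where p1: "p1 \<in> {a..b}" "\<forall>z\<in>{a..b}. p z \<le> p p1"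
    using continuous_attains_sup[OF compact_Icc ne p(1)] by blast
  obtain r0 where r0: "r0 \<in> {a..b}" "\<forall>z\<in>{a..b}. rho r0 \<le> rho z"
    using continuous_attains_inf[OF compact_Icc ne rho(1)] by blast
  obtain r1 where r1: "r1 \<in> {a..b}" "\<forall>z\<in>{a..b}. rho z \<le> rho r1"
    using continuous_attains_sup[OF compact_Icc ne rho(1)] by blast
  obtain Q where Q: "Q \<ge> 0" "\<And>z. z \<in> {a..b} \<Longrightarrow> \<bar>q z\<bar> \<le> Q"
    using continuous_on_Icc_bounded[OF q] by metis
  define K where "K = Q + max \<bar>x\<bar> \<bar>y\<bar> * rho r1"
  have K: "\<bar>q z + l * rho z\<bar> \<le> K" if "l \<in> S" "z \<in> {a..b}" for l z
  proof -
    have "x \<le> l" "l \<le> y" using S that(1) by auto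
    then have "\<bar>l\<bar> \<le> max \<bar>x\<bar> \<bar>y\<bar>" by linarith
    then have "\<bar>l * rho z\<bar> \<le> max \<bar>x\<bar> \<bar>y\<bar> * rho r1"
      unfolding abs_mult using rho(2)[OF that(2)] r1(2) that(2) by (intro mult_mono) auto
    then show ?thesis using Q(2)[OF that(2)] abs_triangle_ineq[of "q z" "l * rho z"] unfolding K_def by linarith
  qed
  interpret sl_bounds a b p q rho S "p p0" "p p1" K "rho r0" "rho r1"
  proof
    have "0 \<le> rho r1" using rho(2)[OF r1(1)] by simp
    then show "0 \<le> K" unfolding K_def using Q(1) by (intro add_nonneg_nonneg mult_nonneg_nonneg) auto
  qed (use ab p p0 p1 rho r0 r1 K in auto)
  \<comment> \<open>The direction solving the boundary condition at \<open>a\<close>, in the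
    coordinates \<open>(u, p u')\<close> of the system.\<close>
  define v1 where "v1 = fst bc_a"
  define v2 where "v2 = - (p a * snd bc_a)"
  have "v1 \<noteq> 0 \<or> v2 \<noteq> 0" using bc(1) p(2)[OF ends(1)] by (cases bc_a) (auto simp: v1_def v2_def)
  from eigenvalue_gap[OF this] obtain d where d: "d > 0"
    and gap: "\<And>l l' f g f' g'. l \<in> S \<Longrightarrow> l' \<in> S \<Longrightarrow> l \<noteq> l' \<Longrightarrow> sl_solution a b p q rho l f g \<Longrightarrow>
      sl_solution a b p q rho l' f' g' \<Longrightarrow> f a = v1 \<Longrightarrow> g a = v2 \<Longrightarrow> f' a = v1 \<Longrightarrow> g' a = v2 \<Longrightarrow>
      g b * f' b = g' b * f b \<Longrightarrow> d \<le> \<bar>l - l'\<bar>" by blast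
  have "\<exists>t. t \<noteq> 0 \<and> u l a = t * v1 \<and> p a * u' l a = t * v2" if l: "l \<in> S" for l
  proof -
    obtain t where t: "u l a = t * fst bc_a" "u' l a = - (t * snd bc_a)"
      using boundary_condition_direction[OF bc(1) bca[OF l]] by blast
    have "t \<noteq> 0"
    proof
      assume "t = 0"
      then have "u l z = 0" if "z \<in> {a..b}" for z
        using solution_eq_0[OF l sol[OF l] _ _ that] t by simp
      then show False using nz[OF l] by blast
    qed
    then show ?thesis using t by (auto simp: v1_def v2_def)
  qed
  then obtain t where t: "\<And>l. l \<in> S \<Longrightarrow> t l \<noteq> 0" "\<And>l. l \<in> S \<Longrightarrow> u l a = t l * v1"
    "\<And>l. l \<in> S \<Longrightarrow> p a * u' l a = t l * v2" by metis
  have "d \<le> \<bar>l - l'\<bar>" if l: "l \<in> S" "l' \<in> S" "l \<noteq> l'" for l l'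
  proof (rule gap[OF l sl_solution_scale[OF sol[OF l(1)], of "1 / t l"] sl_solution_scale[OF sol[OF l(2)], of "1 / t l'"]])
    have "u' l b * u l' b = u' l' b * u l b"
      by (rule boundary_wronskian_eq_0[OF bc(2) bcb[OF l(1)] bcb[OF l(2)]])
    then show "1 / t l * (p b * u' l b) * (1 / t l' * u l' b) = 1 / t l' * (p b * u' l' b) * (1 / t l * u l b)"
      by (simp add: mult_ac)
  qed (use t l in auto)
  then show ?thesis by (rule finite_if_separated_and_bounded[OF S d])
qed

lemma filterlim_at_bot_if_finite_above:
  fixes f :: "nat \<Rightarrow> real"
  assumes "\<And>x. finite {n. x < f n}"
  shows "filterlim f at_bot sequentially"
  unfolding filterlim_at_bot
proof
  fix x
  obtain m where "\<And>n. x < f n \<Longrightarrow> n \<le> m"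
    using assms[of x] finite_nat_set_iff_bounded_le by auto
  then have "f n \<le> x" if "n \<ge> Suc m" for n using that by (metis not_le not_less_eq_eq)
  then show "eventually (\<lambda>n. f n \<le> x) sequentially" unfolding eventually_sequentially by blast
qed

theorem mainTheorem7:
  fixes a b :: real
    and p p' q rho :: "real \<Rightarrow> real"
    and bc_a bc_b :: "real \<times> real"
    and X D Xa :: "ae_fun set"
    and ip ipa :: "ae_fun \<Rightarrow> ae_fun \<Rightarrow> real"
    and A :: "ae_fun \<Rightarrow> ae_fun"
    and lam :: "nat \<Rightarrow> real"
    and phi :: "nat \<Rightarrow> ae_fun"
    and gamma eps mu alpha :: real
    and T :: "real \<Rightarrow> ae_fun \<Rightarrow> ae_fun"
  assumes "a < b"
    and "\<forall>z\<in>{a..b}. (p has_real_derivative p' z) (at z within {a..b})"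
    and "continuous_on {a..b} p" and "continuous_on {a..b} p'"
    and "continuous_on {a..b} q" and "continuous_on {a..b} rho"
    and "\<forall>z\<in>{a..b}. rho z > 0" and "\<forall>z\<in>{a..b}. p z > 0"
    and "bc_a \<noteq> (0, 0)" and "bc_b \<noteq> (0, 0)"
    and X: "X = L2 a b" and ip: "ip = inner_weight a b rho"
    and D: "D = sturm_liouville_domain a b bc_a bc_b"
    and A: "A = (\<lambda>f. - sturm_liouville a b p q rho f)"
    and "bij_betw lam UNIV (eigenvalues D A)"
    and "\<forall>n. phi n \<in> D \<and> A (phi n) = lam n *\<^sub>R phi n \<and> norm_of ip (phi n) = 1"
    and "eps > 0" and "\<forall>n. lam n < gamma" and "mu = gamma + eps" and "alpha > 0"
    and Xa: "Xa = frac_domain X ip lam phi mu alpha"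
    and ipa: "ipa = frac_inner X ip lam phi mu alpha"
    and "C0_semigroup_on Xa (norm_of ipa) T"
    and "infinitesimal_generator_on Xa (norm_of ipa) T
           (frac_generator_domain X ip lam phi mu alpha) A"
  shows "\<forall>t>0. compact_operator_on Xa (norm_of ipa) (T t)"
proof -
  have p: "\<And>z. z \<in> {a..b} \<Longrightarrow> (p has_real_derivative p' z) (at z within {a..b})" "\<And>z. z \<in> {a..b} \<Longrightarrow> p z > 0"
    and rho: "\<And>z. z \<in> {a..b} \<Longrightarrow> rho z > 0"
    and phi: "\<And>n. phi n \<in> D" "\<And>n. A (phi n) = lam n *\<^sub>R phi n" "\<And>n. norm_of ip (phi n) = 1"
    using assms(2,7,8,16) by auto
  have inj: "lam m = lam n \<longleftrightarrow> m = n" for m n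
    using assms(15) unfolding bij_betw_def by (simp add: inj_eq)
  define E where "E n u u' \<longleftrightarrow> phi n = class_on a b u \<and>
     (\<forall>z\<in>{a..b}. (u has_real_derivative u' z) (at z within {a..b})) \<and>
     (\<forall>z\<in>{a..b}. ((\<lambda>z. p z * u' z) has_real_derivative (q z + lam n * rho z) * u z) (at z within {a..b})) \<and>
     fst bc_a * u' a + snd bc_a * u a = 0 \<and> fst bc_b * u' b + snd bc_b * u b = 0" for n u u'
  have "\<exists>u u'. E n u u'" for n
    unfolding E_def
  proof (rule eigenfunction_classical[OF assms(1) p(1) assms(4,5,6) rho])
    show "phi n \<in> sturm_liouville_domain a b bc_a bc_b" using phi(1) by (simp add: D)
    show "- sturm_liouville a b p q rho (phi n) = lam n *\<^sub>R phi n" using phi(2)[of n] by (simp add: A)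
  qed
  then obtain u u' where E: "\<And>n. E n (u n) (u' n)" by metis
  have phi_eq: "phi n = class_on a b (u n)"
    and bca: "fst bc_a * u' n a + snd bc_a * u n a = 0"
    and bcb: "fst bc_b * u' n b + snd bc_b * u n b = 0" for n
    using E[of n] by (auto simp: E_def)
  have u_deriv: "(u n has_real_derivative u' n z) (at z within {a..b})"
    and w_deriv: "((\<lambda>z. p z * u' n z) has_real_derivative (q z + lam n * rho z) * u n z) (at z within {a..b})"
    if "z \<in> {a..b}" for n z
    using E[of n] that by (auto simp: E_def)
  have sol: "sl_solution a b p q rho (lam n) (u n) (\<lambda>z. p z * u' n z)" for n
    unfolding sl_solution_def
  proof (intro ballI conjI)
    fix z assume z: "z \<in> {a..b}"
    have "p z * u' n z / p z = u' n z" using p(2)[OF z] by simp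
    then show "(u n has_real_derivative p z * u' n z / p z) (at z within {a..b})" using u_deriv[OF z] by simp
  qed (rule w_deriv)
  note u_cont = sl_solution_continuous(1)[OF sol]
  \<comment> \<open>The hypotheses give unit norms; orthogonality follows because distinct indices
    have distinct eigenvalues, by the bijection with the set of eigenvalues, and both boundary
    Wronskians vanish.\<close>
  have orthonormal: "ip (phi m) (phi n) = (if m = n then 1 else 0)" for m n
  proof (cases "m = n")
    case True
    then show ?thesis using phi(3)[of n] by (simp add: norm_of_def)
  next
    case False
    have "u' m a * u n a = u' n a * u m a" "u' m b * u n b = u' n b * u m b"
      by (intro boundary_wronskian_eq_0[OF assms(9) bca bca] boundary_wronskian_eq_0[OF assms(10) bcb bcb])+
    then have "inner_weight a b rho (class_on a b (u m)) (class_on a b (u n)) = 0"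
      using False assms(1) by (intro sl_solutions_orthogonal[OF _ _ sol sol assms(6)]) (auto simp: inj mult_ac)
    then show ?thesis using False by (simp add: ip phi_eq)
  qed
  \<comment> \<open>All eigenvalues above \<open>x\<close> lie in the bounded window
    \<open>[x, gamma]\<close>; since \<open>lam\<close> is injective, their finiteness passes to the
    indices.\<close>
  have "finite {n. x < lam n}" for x
  proof -
    define S where "S = lam ` {n. x < lam n}"
    \<comment> \<open>\<open>N\<close> recovers the index from the eigenvalue, because
      \<open>finite_eigenvalues_above\<close> takes solutions indexed by \<open>l\<close> in
      \<open>S\<close>.\<close>
    define N where "N = inv lam"
    have N: "N (lam n) = n" for n unfolding N_def by (rule inv_f_f) (simp add: inj_def inj)
    have "finite S"
    proof (rule finite_eigenvalues_above[OF assms(1,3) p(2) assms(5,6) rho assms(9,10),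
          where u = "\<lambda>l. u (N l)" and u' = "\<lambda>l. u' (N l)" and x = x and y = gamma])
      fix l assume "l \<in> S"
      then obtain n where l: "l = lam n" by (auto simp: S_def)
      show "sl_solution a b p q rho l (u (N l)) (\<lambda>z. p z * u' (N l) z)" using sol by (simp add: l N)
      show "fst bc_a * u' (N l) a + snd bc_a * u (N l) a = 0" "fst bc_b * u' (N l) b + snd bc_b * u (N l) b = 0"
        by (rule bca bcb)+
      show "\<exists>z\<in>{a..b}. u (N l) z \<noteq> 0"
      proof (rule ccontr)
        assume "\<not> ?thesis"
        then have "integral {a..b} (\<lambda>z. u n z * u n z * rho z) = integral {a..b} (\<lambda>_. 0)"
          by (intro Henstock_Kurzweil_Integration.integral_cong) (simp add: l N)
        then have "ip (phi n) (phi n) = 0"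
          by (simp add: ip phi_eq inner_weight_class_on u_cont assms(6))
        then show False by (simp add: orthonormal)
      qed
    next
      show "S \<subseteq> {x..gamma}" using assms(18) by (auto simp: S_def less_imp_le)
    qed
    then show ?thesis
      unfolding S_def by (rule finite_imageD) (simp add: inj_on_def inj)
  qed
  then have lam_lim: "filterlim lam at_bot sequentially" by (rule filterlim_at_bot_if_finite_above)
  interpret hilbert_subspace X ip
    unfolding X ip by (rule hilbert_subspace_L2[OF assms(6) rho assms(1)])
  interpret spectral_sequence X ip phi lam mu eps alpha
  proof
    show "phi n \<in> X" for n unfolding phi_eq X by (rule class_on_L2[OF u_cont])
    show "ip (phi m) (phi n) = (if m = n then 1 else 0)" for m n by (rule orthonormal)
    show "eps \<le> mu - lam n" for n using assms(18,19) by (simp add: less_imp_le)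
  qed (fact assms)+
  \<comment> \<open>The generator hypothesis is evaluated at the eigenfunctions; with the eigenvalue
    equation it becomes the orbit derivative at \<open>0\<close> that
    \<open>diagonal_semigroup_compact\<close> expects.\<close>
  have gen: "((\<lambda>t. norm_of ipa ((1 / t) *\<^sub>R (T t (phi n) - phi n) - lam n *\<^sub>R phi n)) \<longlongrightarrow> 0) (at_right 0)" for n
    using conjunct2[OF bspec[OF conjunct2[OF assms(24)[unfolded infinitesimal_generator_on_def]]
        phi_in_generator_domain[of n]]] unfolding phi(2) .
  show ?thesis
  proof (intro allI impI)
    fix t :: real assume "t > 0"
    show "compact_operator_on Xa (norm_of ipa) (T t)"
      unfolding Xa ipa
    proof (rule diagonal_semigroup_compact[OF assms(23)[unfolded Xa ipa] phi_Xa wcoeff_phi _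
          gen[unfolded ipa] lam_lim \<open>t > 0\<close>])
      show "(mu - lam n) powr alpha \<noteq> 0" for n using weight_pos[of n] by simp
    qed
  qed
qed

end
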